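(* Let $T>0$, let $d,q\ge 1$ be integers, $p\in[2,+\infty)$, and let $b:[0,T]\times\mathbb{R}^d\times\mathcal{P}_p(\mathbb{R}^d)\to\mathbb{R}^d$ and $\sigma,\theta:[0,T]\times\mathbb{R}^d\times\mathcal{P}_p(\mathbb{R}^d)\to\mathbb{M}_{d\times q}$. Let $X_0,Y_0\in L^p(\mathbb{P})$ be $\mathcal{F}_0$-measurable $\mathbb{R}^d$-valued random variables. Assume (I): there are $\rho\in(0,1]$ and $L,\tilde L>0$ such that for all $0\le s\le t\le T$, $x,y\in\mathbb{R}^d$, $\mu,\nu\in\mathcal{P}_p(\mathbb{R}^d)$, and for each $f\in\{b,\sigma,\theta\}$ (with the Euclidean norm for $b$ and the operator norm for $\sigma,\theta$), $$\|f(t,x,\mu)-f(s,x,\mu)\|\le \tilde L\big(1+|x|+\mathcal{W}_p(\mu,\delta_0)\big)(t-s)^\rho,\qquad \|f(t,x,\mu)-f(t,y,\nu)\|\le L\big(|x-y|+\mathcal{W}_p(\mu,\nu)\big).$$ Assume moreover: (1) $b(t,\cdot,\mu)$ is affine for all $(t,\mu)$, and $b(t,x,\mu)=b(t,x,\nu)$ for all $(t,x)$ whenever $\mu,\nu\in\mathcal{P}_p(\mathbb{R}^d)$, $\mu\preceq_{cv}\nu$; (2) $\sigma(t,\lambda x+(1-\lambda)y,\mu)\preceq\lambda\sigma(t,x,\mu)+(1-\lambda)\sigma(t,y,\mu)$ for all $t\in[0,T]$, $\mu\in\mathcal{P}_p(\mathbb{R}^d)$, $x,y\in\mathbb{R}^d$,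 $\lambda\in[0,1]$; (3') $\theta(t,x,\mu)\preceq\theta(t,x,\nu)$ for all $(t,x)$ whenever $\mu,\nu\in\mathcal{P}_p(\mathbb{R}^d)$, $\mu\preceq_{cv}\nu$; (4) $\sigma(t,x,\mu)\preceq\theta(t,x,\mu)$ for all $(t,x,\mu)$; (5) $X_0\preceq_{cv}Y_0$. Let $X=(X_t)_{t\in[0,T]}$ and $Y=(Y_t)_{t\in[0,T]}$ be the solutions of $$dX_t=b(t,X_t,\mu_t)\,dt+\sigma(t,X_t,\mu_t)\,dB_t,\qquad dY_t=b(t,Y_t,\nu_t)\,dt+\theta(t,Y_t,\nu_t)\,dB_t,$$ with initial values $X_0$ and $Y_0$, where $\mu_t$ and $\nu_t$ are the probability distributions of $X_t$ and $Y_t$. Then for every $t\in[0,T]$, $\mu_t\preceq_{cv}\nu_t$.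
   Context: $(\Omega,\mathcal{F},(\mathcal{F}_t)_{t\ge0},\mathbb{P})$ is a filtered probability space satisfying the usual conditions and $(B_t)_{t\ge 0}$ is an $(\mathcal{F}_t)$-standard Brownian motion with values in $\mathbb{R}^q$. $\mathbb{M}_{d\times q}$ is the set of real $d\times q$ matrices with operator norm $\sup_{|z|\le1}|Az|$; for $A,B\in\mathbb{M}_{d\times q}$, $A\preceq B$ means that $BB^\top-AA^\top$ is positive semi-definite. $\mathcal{P}_p(\mathbb{R}^d)$ is the set of probability distributions on $\mathbb{R}^d$ with finite $p$-th moment, $\mathcal{W}_p$ is the $L^p$-Wasserstein distance (for the Euclidean norm $|\cdot|$), $\delta_0$ is the Dirac mass at $0$. Convex order: for $\mu,\nu\in\mathcal{P}_1(\mathbb{R}^d)$, $\mu\preceq_{cv}\nu$ means $\int\varphi\,d\mu\le\int\varphi\,d\nu$ for every convex $\varphi:\mathbb{R}^d\to\mathbb{R}$ (integrals in $(-\infty,+\infty]$); for integrable random variables, $U\preceq_{cv}V$ means that their distributions are so ordered. Under (I), the two equations have unique strong solutions with $\mathbb{E}\sup_{t\in[0,T]}|X_t|^p<\infty$ and $\mathbb{E}\sup_{t\in[0,T]}|Y_t|^p<\infty$. *)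

theory Defs
  imports "HOL-Probability.Probability"
begin

definition prob_dists :: "real \<Rightarrow> 'v::euclidean_space measure set" where
  "prob_dists p = {\<mu>. prob_space \<mu> \<and> sets \<mu> = sets borel \<and> integrable \<mu> (\<lambda>x. norm x powr p)}"

definition couplings :: "'v::euclidean_space measure \<Rightarrow> 'v measure \<Rightarrow> ('v \<times> 'v) measure set" where
  "couplings \<mu> \<nu> = {\<pi>. sets \<pi> = sets (borel \<Otimes>\<^sub>M borel) \<and> distr \<pi> borel fst = \<mu> \<and> distr \<pi> borel snd = \<nu>}"

text \<open>For \<open>\<mu>\<close> and \<open>\<nu>\<close> in \<^term>\<open>prob_dists p\<close>, \<open>p \<ge> 1\<close>, the infimum is finite, so the
  conversion to a real number loses nothing.\<close>

definition wasserstein :: "real \<Rightarrow> 'v::euclidean_space measure \<Rightarrow> 'v measure \<Rightarrow> real" where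
  "wasserstein p \<mu> \<nu> =
     enn2real (INF \<pi>\<in>couplings \<mu> \<nu>. \<integral>\<^sup>+z. ennreal (dist (fst z) (snd z) powr p) \<partial>\<pi>) powr (1 / p)"

text \<open>The integral of \<open>\<phi>\<close> with values in the extended reals, as the difference of the integrals of
  the positive and the negative part.  A convex \<open>\<phi>\<close> has an affine minorant, so that for
  \<open>\<mu>\<close> in \<^term>\<open>prob_dists 1\<close> the subtracted term is finite.\<close>

definition ext_integral :: "'v measure \<Rightarrow> ('v \<Rightarrow> real) \<Rightarrow> ereal" where
  "ext_integral \<mu> \<phi> = enn2ereal (\<integral>\<^sup>+x. ennreal (\<phi> x) \<partial>\<mu>) - enn2ereal (\<integral>\<^sup>+x. ennreal (- \<phi> x) \<partial>\<mu>)"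

definition convex_order :: "'v::euclidean_space measure \<Rightarrow> 'v measure \<Rightarrow> bool" (infix "\<preceq>cv" 50) where
  "\<mu> \<preceq>cv \<nu> \<longleftrightarrow> \<mu> \<in> prob_dists 1 \<and> \<nu> \<in> prob_dists 1 \<and>
     (\<forall>\<phi>. convex_on UNIV \<phi> \<longrightarrow> ext_integral \<mu> \<phi> \<le> ext_integral \<nu> \<phi>)"

abbreviation law :: "'a measure \<Rightarrow> ('a \<Rightarrow> 'v::euclidean_space) \<Rightarrow> 'v measure" where
  "law M U \<equiv> distr M borel U"

definition pos_semidef :: "real^'n^'n \<Rightarrow> bool" where
  "pos_semidef A \<longleftrightarrow> transpose A = A \<and> (\<forall>x. 0 \<le> x \<bullet> (A *v x))"

definition matrix_preceq :: "real^'q^'d \<Rightarrow> real^'q^'d \<Rightarrow> bool" (infix "\<preceq>m" 50) where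
  "A \<preceq>m B \<longleftrightarrow> pos_semidef (B ** transpose B - A ** transpose A)"

text \<open>The type class norm on matrices is the Frobenius norm, hence a separate operator norm.\<close>

definition matrix_onorm :: "real^'q^'d \<Rightarrow> real" where
  "matrix_onorm A = onorm (\<lambda>z. A *v z)"

definition affine_map :: "('v::real_vector \<Rightarrow> 'w::real_vector) \<Rightarrow> bool" where
  "affine_map f \<longleftrightarrow> (\<exists>g c. linear g \<and> (\<forall>x. f x = g x + c))"

text \<open>Coefficients are total functions; only their values for times in \<open>[0,T]\<close> and measures in
  \<^term>\<open>prob_dists p\<close> are ever constrained.\<close>

definition coeff_regular ::
  "('c::ab_group_add \<Rightarrow> real) \<Rightarrow> real \<Rightarrow> real \<Rightarrow> real \<Rightarrow> real \<Rightarrow> real \<Rightarrow>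
   (real \<Rightarrow> 'v::euclidean_space \<Rightarrow> 'v measure \<Rightarrow> 'c) \<Rightarrow> bool" where
  "coeff_regular nrm T p \<rho> L L' f \<longleftrightarrow>
     (\<forall>s t x y. \<forall>\<mu>\<in>prob_dists p. \<forall>\<nu>\<in>prob_dists p. 0 \<le> s \<and> s \<le> t \<and> t \<le> T \<longrightarrow>
        nrm (f t x \<mu> - f s x \<mu>) \<le> L' * (1 + norm x + wasserstein p \<mu> (return borel 0)) * (t - s) powr \<rho> \<and>
        nrm (f t x \<mu> - f t y \<nu>) \<le> L * (norm (x - y) + wasserstein p \<mu> \<nu>))"

text \<open>Only the sigma-algebras \<open>F t\<close> with \<open>t \<ge> 0\<close> matter.\<close>

definition usual_filtration :: "'a measure \<Rightarrow> (real \<Rightarrow> 'a measure) \<Rightarrow> bool" where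
  "usual_filtration M F \<longleftrightarrow>
     (\<forall>t\<ge>0. subalgebra M (F t)) \<and>
     (\<forall>s t. 0 \<le> s \<and> s \<le> t \<longrightarrow> subalgebra (F t) (F s)) \<and>
     complete_measure M \<and> null_sets M \<subseteq> sets (F 0) \<and>
     (\<forall>t\<ge>0. sets (F t) = (\<Inter>u\<in>{t<..}. sets (F u)))"

text \<open>The increment over \<open>[s,t]\<close> has the centred normal distribution with covariance matrix
  \<open>(t - s)\<close> times the identity: its density is the product of the coordinate densities.\<close>

definition brownian_motion ::
  "'a measure \<Rightarrow> (real \<Rightarrow> 'a measure) \<Rightarrow> (real \<Rightarrow> 'a \<Rightarrow> real^'q) \<Rightarrow> bool" where
  "brownian_motion M F B \<longleftrightarrow>
     (\<forall>t\<ge>0. B t \<in> borel_measurable (F t)) \<and>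
     (AE \<omega> in M. B 0 \<omega> = 0) \<and>
     (AE \<omega> in M. continuous_on {0..} (\<lambda>t. B t \<omega>)) \<and>
     (\<forall>s t. 0 \<le> s \<and> s < t \<longrightarrow>
        prob_space.indep_set M (sets (F s))
          (sets (vimage_algebra (space M) (\<lambda>\<omega>. B t \<omega> - B s \<omega>) borel)) \<and>
        distributed M lborel (\<lambda>\<omega>. B t \<omega> - B s \<omega>)
          (\<lambda>x. ennreal (\<Prod>i\<in>UNIV. normal_density 0 (sqrt (t - s)) (x $ i))))"

definition progressively_measurable ::
  "(real \<Rightarrow> 'a measure) \<Rightarrow> real \<Rightarrow> (real \<Rightarrow> 'a \<Rightarrow> 'c::topological_space) \<Rightarrow> bool" where
  "progressively_measurable F T H \<longleftrightarrow>
     (\<forall>t\<in>{0..T}. (\<lambda>(s, \<omega>). H s \<omega>) \<in> borel_measurable (restrict_space borel {0..t} \<Otimes>\<^sub>M F t))"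

text \<open>A simple process takes the bounded, \<open>F (\<tau> i)\<close>-measurable value \<open>\<eta> i\<close> on the interval
  \<open>(\<tau> i, \<tau> (i + 1)]\<close>, for \<open>i < n\<close>.\<close>

definition simple_data ::
  "(real \<Rightarrow> 'a measure) \<Rightarrow> real \<Rightarrow> nat \<Rightarrow> (nat \<Rightarrow> real) \<Rightarrow> (nat \<Rightarrow> 'a \<Rightarrow> real^'q^'d) \<Rightarrow> bool" where
  "simple_data F T n \<tau> \<eta> \<longleftrightarrow>
     0 \<le> \<tau> 0 \<and> (\<forall>i<n. \<tau> i < \<tau> (Suc i)) \<and> \<tau> n \<le> T \<and>
     (\<forall>i<n. \<eta> i \<in> borel_measurable (F (\<tau> i)) \<and> (\<exists>C. \<forall>\<omega>\<in>space (F (\<tau> i)). norm (\<eta> i \<omega>) \<le> C))"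

definition simple_process ::
  "nat \<Rightarrow> (nat \<Rightarrow> real) \<Rightarrow> (nat \<Rightarrow> 'a \<Rightarrow> real^'q^'d) \<Rightarrow> real \<Rightarrow> 'a \<Rightarrow> real^'q^'d" where
  "simple_process n \<tau> \<eta> s \<omega> = (\<Sum>i<n. indicator {\<tau> i<..\<tau> (Suc i)} s *\<^sub>R \<eta> i \<omega>)"

definition simple_integral ::
  "(real \<Rightarrow> 'a \<Rightarrow> real^'q) \<Rightarrow> nat \<Rightarrow> (nat \<Rightarrow> real) \<Rightarrow> (nat \<Rightarrow> 'a \<Rightarrow> real^'q^'d) \<Rightarrow> real \<Rightarrow> 'a \<Rightarrow> real^'d" where
  "simple_integral B n \<tau> \<eta> t \<omega> =
     (\<Sum>i<n. \<eta> i \<omega> *v (B (min t (\<tau> (Suc i))) \<omega> - B (min t (\<tau> i)) \<omega>))"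

definition null_in_probability :: "'a measure \<Rightarrow> (nat \<Rightarrow> 'a \<Rightarrow> ennreal) \<Rightarrow> bool" where
  "null_in_probability M Z \<longleftrightarrow>
     (\<forall>n. Z n \<in> borel_measurable M) \<and>
     (\<forall>\<epsilon>>0. (\<lambda>n. measure M {\<omega>\<in>space M. ennreal \<epsilon> < Z n \<omega>}) \<longlonglongrightarrow> 0)"

definition continuous_adapted ::
  "'a measure \<Rightarrow> (real \<Rightarrow> 'a measure) \<Rightarrow> real \<Rightarrow> (real \<Rightarrow> 'a \<Rightarrow> 'v::euclidean_space) \<Rightarrow> bool" where
  "continuous_adapted M F T X \<longleftrightarrow>
     (\<forall>t\<in>{0..T}. X t \<in> borel_measurable (F t)) \<and>
     (\<forall>\<omega>\<in>space M. continuous_on {0..T} (\<lambda>t. X t \<omega>))"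

text \<open>\<open>J\<close> is a version of the process of integrals of \<open>H\<close> over \<open>[0,t]\<close> with respect to \<open>B\<close>,
  \<open>0 \<le> t \<le> T\<close>, for progressively measurable \<open>H\<close> with almost surely square integrable paths.
  The integral is the limit, uniformly on \<open>[0,T]\<close> in probability, of the integrals of simple
  processes whose squared distance to \<open>H\<close> in \<open>L\<^sup>2([0,T])\<close> tends to 0 in probability; it does not
  depend on the approximating sequence and is unique up to indistinguishability.  All suprema and
  inner integrals below are automatically measurable, because \<open>M\<close> is complete.\<close>

definition is_ito_integral ::
  "'a measure \<Rightarrow> (real \<Rightarrow> 'a measure) \<Rightarrow> (real \<Rightarrow> 'a \<Rightarrow> real^'q) \<Rightarrow> real \<Rightarrow>
   (real \<Rightarrow> 'a \<Rightarrow> real^'q^'d) \<Rightarrow> (real \<Rightarrow> 'a \<Rightarrow> real^'d) \<Rightarrow> bool" where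
  "is_ito_integral M F B T H J \<longleftrightarrow>
     progressively_measurable F T H \<and>
     (AE \<omega> in M. (\<integral>\<^sup>+s\<in>{0..T}. ennreal ((norm (H s \<omega>))\<^sup>2) \<partial>lborel) < \<infinity>) \<and>
     continuous_adapted M F T J \<and>
     (\<exists>n \<tau> \<eta>.
        (\<forall>k. simple_data F T (n k) (\<tau> k) (\<eta> k)) \<and>
        null_in_probability M (\<lambda>k \<omega>.
          \<integral>\<^sup>+s\<in>{0..T}. ennreal ((norm (simple_process (n k) (\<tau> k) (\<eta> k) s \<omega> - H s \<omega>))\<^sup>2) \<partial>lborel) \<and>
        null_in_probability M (\<lambda>k \<omega>.
          SUP t\<in>{0..T}. ennreal (norm (simple_integral B (n k) (\<tau> k) (\<eta> k) t \<omega> - J t \<omega>))))"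

text \<open>Solutions are understood in the class of continuous adapted processes on \<open>[0,T]\<close> with
  \<open>p\<close>-integrable supremum, in which existence and uniqueness hold for regular coefficients.\<close>

definition mckean_vlasov_solution ::
  "'a measure \<Rightarrow> (real \<Rightarrow> 'a measure) \<Rightarrow> (real \<Rightarrow> 'a \<Rightarrow> real^'q) \<Rightarrow> real \<Rightarrow> real \<Rightarrow>
   (real \<Rightarrow> real^'d \<Rightarrow> (real^'d) measure \<Rightarrow> real^'d) \<Rightarrow>
   (real \<Rightarrow> real^'d \<Rightarrow> (real^'d) measure \<Rightarrow> real^'q^'d) \<Rightarrow>
   ('a \<Rightarrow> real^'d) \<Rightarrow> (real \<Rightarrow> 'a \<Rightarrow> real^'d) \<Rightarrow> bool" where
  "mckean_vlasov_solution M F B T p b \<sigma> X0 X \<longleftrightarrow>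
     continuous_adapted M F T X \<and>
     (\<integral>\<^sup>+\<omega>. (SUP t\<in>{0..T}. ennreal (norm (X t \<omega>) powr p)) \<partial>M) < \<infinity> \<and>
     (AE \<omega> in M. set_integrable lborel {0..T} (\<lambda>s. b s (X s \<omega>) (law M (X s)))) \<and>
     (\<exists>J. is_ito_integral M F B T (\<lambda>s \<omega>. \<sigma> s (X s \<omega>) (law M (X s))) J \<and>
        (AE \<omega> in M. \<forall>t\<in>{0..T}.
           X t \<omega> = X0 \<omega> + (LINT s:{0..t}|lborel. b s (X s \<omega>) (law M (X s))) + J t \<omega>))"

end

theory Submission
  imports Defs
begin

text \<open>Both solutions are compared through their Euler schemes, in which each step uses the coefficients
  at the law of the scheme itself.  Conditional on the present value \<open>x\<close>, one step of the scheme is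
  Gaussian, and \<open>E \<phi> (x + A Z)\<close> is, for convex \<open>\<phi>\<close> and standard normal \<open>Z\<close>, jointly convex in
  \<open>(x, A)\<close> and monotone in \<open>A\<close>: \<open>A \<preceq>m B\<close> means \<open>A = B K\<close> with a contraction \<open>K\<close>, a contraction is a
  convex combination of orthogonal matrices, and the law of \<open>Z\<close> is invariant under these.  Hence if the laws
  \<open>\<mu>\<close> and \<open>\<nu>\<close> of the two schemes are ordered at one grid point, the chain
  \<open>\<sigma> t x \<mu> \<preceq>m \<theta> t x \<mu> \<preceq>m \<theta> t x \<nu>\<close> orders them at the next one.  The order passes to the
  limit because the schemes converge in \<open>L\<^sup>p\<close>.  The moment estimate behind this is a discrete
  Burkholder inequality, obtained from the second order expansion of \<open>|m + v|\<^sup>p\<close>.\<close>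

section \<open>Elementary inequalities\<close>

text \<open>The roles of the two schemes are not symmetric. The transition operator of the first one
  has to map convex functions to convex functions, which is where the affine drift and the convexity
  of \<open>\<sigma>\<close> enter; the second one has to dominate the first pointwise, from a
  common present value. Drifts are not compared but identified: \<open>b\<close> takes equal values
  at ordered laws. The obstacle is the stochastic integral. \<open>is_ito_integral\<close> yields
  one approximating sequence that converges in probability, hence no moments. Moment bounds are
  proved for finite sums, with constants independent of the partition, and are carried over by
  refining partitions until they contain the jump times of the simple processes, by passing to an
  almost surely convergent subsequence, and by Fatou's lemma. The exponent \<open>p \<ge> 2\<close>
  gives \<open>|m + v|^p\<close> an expansion whose remainder is in expectation of the order of the
  step. Convex functions may have infinite integrals. The comparisons are therefore made with
  Lipschitz convex functions, of which every convex function is an increasing limit.\<close>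

lemma powr_mult_le_add_powr:
  fixes a b s r :: real
  assumes "0 \<le> a" "0 \<le> b" "0 \<le> s" "0 \<le> r"
  shows "a powr s * b powr r \<le> a powr (s + r) + b powr (s + r)"
proof -
  have "a powr s * b powr r \<le> max a b powr s * max a b powr r"
    using assms by (intro mult_mono powr_mono2) auto
  also have "\<dots> = max a b powr (s + r)" by (simp add: powr_add)
  also have "\<dots> \<le> a powr (s + r) + b powr (s + r)" by (simp add: max_def)
  finally show ?thesis .
qed

lemma powr_add_le:
  fixes a b p :: real
  assumes "0 \<le> a" "0 \<le> b" "0 \<le> p"
  shows "(a + b) powr p \<le> 2 powr p * (a powr p + b powr p)"
proof -
  have "(a + b) powr p \<le> (2 * max a b) powr p"
    using assms by (intro powr_mono2) auto
  also have "\<dots> = 2 powr p * max a b powr p" using assms by (simp add: powr_mult)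
  also have "\<dots> \<le> 2 powr p * (a powr p + b powr p)" by (intro mult_left_mono) (auto simp: max_def)
  finally show ?thesis .
qed

lemma norm_add_powr_le:
  fixes x y :: "'a::real_normed_vector"
  assumes "0 \<le> p"
  shows "norm (x + y) powr p \<le> 2 powr p * (norm x powr p + norm y powr p)"
  using order_trans[OF powr_mono2[OF assms norm_ge_zero norm_triangle_ineq] powr_add_le[of "norm x" "norm y" p]] assms
  by simp

lemma norm_diff_powr_le:
  fixes x y :: "'a::real_normed_vector"
  assumes "0 \<le> p"
  shows "norm (x - y) powr p \<le> 2 powr p * (norm x powr p + norm y powr p)"
  using norm_add_powr_le[OF assms, of x "- y"] by simp

text \<open>Replaces Hoelder's inequality where a first moment is bounded by a \<open>p\<close>-th
  moment: above \<open>\<delta>\<close> one writes \<open>x = x powr (1 - p) * x powr p\<close>, and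
  the first factor does not increase with \<open>x\<close>. The free parameter is later matched to
  the size of the \<open>p\<close>-th moment.\<close>

lemma le_add_powr:
  fixes x \<delta> p :: real
  assumes "0 \<le> x" "0 < \<delta>" "1 \<le> p"
  shows "x \<le> \<delta> + \<delta> powr (1 - p) * x powr p"
proof (cases "x \<le> \<delta>")
  case True
  then show ?thesis using assms by (simp add: add_increasing2)
next
  case False
  then have "x = x powr (1 - p) * x powr p"
    using assms by (simp flip: powr_add)
  also have "\<dots> \<le> \<delta> powr (1 - p) * x powr p"
    using assms False by (intro mult_right_mono powr_mono2') auto
  finally show ?thesis using assms by simp
qed

text \<open>Taylor's formula at 1 with Lagrange remainder; away from 0 the second derivative is
  bounded. The interval from \<open>1/4\<close> to \<open>9/4\<close> is the range of
  \<open>|m + v|^2 / |m|^2\<close> for \<open>|v| \<le> |m| / 2\<close>.\<close>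

lemma powr_Taylor_bound:
  fixes r :: real
  assumes "1 \<le> r"
  obtains C where "0 \<le> C"
    "\<And>u. 1/4 \<le> u \<Longrightarrow> u \<le> 9/4 \<Longrightarrow> u powr r \<le> 1 + r * (u - 1) + C * (u - 1)\<^sup>2"
proof
  let ?C = "r * (r - 1) / 2 * 4 powr \<bar>r - 2\<bar>"
  show "0 \<le> ?C" using assms by auto
  fix u :: real assume u: "1/4 \<le> u" "u \<le> 9/4"
  show "u powr r \<le> 1 + r * (u - 1) + ?C * (u - 1)\<^sup>2"
  proof (cases "u = 1")
    case False
    define D where "D = (\<lambda>m::nat. \<lambda>t::real. if m = 0 then t powr r else if m = 1 then r * t powr (r - 1)
       else r * (r - 1) * t powr (r - 2))"
    have "\<exists>t. (if u < 1 then u < t \<and> t < 1 else 1 < t \<and> t < u) \<and>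
       u powr r = (\<Sum>m<2. D m 1 / fact m * (u - 1) ^ m) + D 2 t / fact 2 * (u - 1) ^ 2"
    proof (rule Taylor[where a = "1/4" and b = "9/4"])
      show "\<forall>m t. m < 2 \<and> 1 / 4 \<le> t \<and> t \<le> 9 / 4 \<longrightarrow> (D m has_real_derivative D (Suc m) t) (at t)"
      proof (intro allI impI)
        fix m :: nat and t :: real assume a: "m < 2 \<and> 1 / 4 \<le> t \<and> t \<le> 9 / 4"
        then consider "m = 0" | "m = 1" by linarith
        then show "(D m has_real_derivative D (Suc m) t) (at t)"
        proof cases
          case 1
          then show ?thesis using a by (auto simp: D_def intro!: derivative_eq_intros)
        next
          case 2
          then show ?thesis using a by (auto simp: D_def intro!: derivative_eq_intros)
        qed
      qed
    qed (use u False in \<open>auto simp: D_def\<close>)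
    then obtain t where t: "if u < 1 then u < t \<and> t < 1 else 1 < t \<and> t < u"
      and eq: "u powr r = (\<Sum>m<2. D m 1 / fact m * (u - 1) ^ m) + D 2 t / fact 2 * (u - 1) ^ 2" by blast
    have t': "1/4 \<le> t" "t \<le> 9/4" using t u by (auto split: if_splits)
    \<comment> \<open>Both \<open>t\<close> and \<open>1 / t\<close> are at most 4 on the interval,
      so one bound serves either sign of the exponent.\<close>
    have "t powr (r - 2) \<le> 4 powr \<bar>r - 2\<bar>"
    proof (cases "2 \<le> r")
      case True
      then show ?thesis using t' by (auto intro!: powr_mono2)
    next
      case False
      have "t powr (r - 2) = (1 / t) powr (2 - r)"
        using t' by (simp add: powr_divide flip: powr_minus_divide)
      also have "\<dots> \<le> 4 powr (2 - r)" using t' False by (intro powr_mono2) (auto simp: field_simps)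
      finally show ?thesis using False by simp
    qed
    then have "r * (r - 1) / 2 * t powr (r - 2) * (u - 1)\<^sup>2 \<le> ?C * (u - 1)\<^sup>2"
      using assms by (intro mult_right_mono mult_left_mono) auto
    moreover have "u powr r = 1 + r * (u - 1) + r * (r - 1) / 2 * t powr (r - 2) * (u - 1)\<^sup>2"
      unfolding eq by (simp add: D_def numeral_2_eq_2)
    ultimately show ?thesis by linarith
  qed simp
qed

text \<open>For \<open>|v| \<le> |m| / 2\<close> the power \<open>u powr (p / 2)\<close> of
  \<open>u = |m + v|^2 / |m|^2\<close> is expanded around 1; for larger \<open>v\<close> every term
  is of order \<open>|v|^p\<close>. The coefficient of \<open>m \<bullet> v\<close> is the exact
  derivative of the \<open>p\<close>-th power of the norm, so that this term can be removed by
  taking expectations.\<close>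

lemma norm_add_powr_Taylor_bound:
  fixes p :: real
  assumes p: "2 \<le> p"
  obtains C where "0 \<le> C"
    "\<And>m v :: 'a::real_inner. norm (m + v) powr p \<le> norm m powr p + p * norm m powr (p - 2) * (m \<bullet> v)
        + C * (norm m powr (p - 2) * (norm v)\<^sup>2 + norm v powr p)"
proof -
  obtain C where C: "0 \<le> C"
    "\<And>u. 1/4 \<le> u \<Longrightarrow> u \<le> 9/4 \<Longrightarrow> u powr (p/2) \<le> 1 + p/2 * (u - 1) + C * (u - 1)\<^sup>2"
    using powr_Taylor_bound[of "p/2"] p by auto
  \<comment> \<open>The case \<open>|m| < 2 * |v|\<close> costs \<open>3 powr p\<close> for the
    left-hand side and \<open>p * 2 powr p\<close> for the first order term. The expansion costs
    \<open>p / 2 + 7 * C\<close>, where 7 bounds the square of \<open>5/2\<close> and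
    \<open>|u - 1| \<le> 5/2 * |v| / |m|\<close>.\<close>
  let ?C = "p + 7 * C + 3 powr p + p * 2 powr p"
  show thesis
  proof
    show "0 \<le> ?C" using C p by (intro add_nonneg_nonneg) auto
    fix m v :: 'a
    have pos: "0 \<le> norm m powr (p - 2) * (norm v)\<^sup>2" "0 \<le> norm v powr p" by auto
    show "norm (m + v) powr p \<le> norm m powr p + p * norm m powr (p - 2) * (m \<bullet> v)
        + ?C * (norm m powr (p - 2) * (norm v)\<^sup>2 + norm v powr p)"
    proof (cases "norm m < 2 * norm v")
      case True
      have "norm (m + v) powr p \<le> (3 * norm v) powr p"
        using True p norm_triangle_ineq[of m v] by (intro powr_mono2) auto
      also have "\<dots> = 3 powr p * norm v powr p" by (simp add: powr_mult)
      finally have 1: "norm (m + v) powr p \<le> 3 powr p * norm v powr p" .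
      have "norm m powr (p - 2) * - (m \<bullet> v) \<le> norm m powr (p - 2) * (norm m * norm v)"
        using Cauchy_Schwarz_ineq2[of m v] by (intro mult_left_mono) auto
      also have "\<dots> \<le> (2 * norm v) powr (p - 2) * ((2 * norm v) * (2 * norm v))"
        using True p by (intro mult_mono powr_mono2) auto
      also have "\<dots> = (2 * norm v) powr (p - 2) * (2 * norm v) powr 2"
        by (simp add: powr_numeral power2_eq_square)
      also have "\<dots> = (2 * norm v) powr p" by (metis powr_add diff_add_cancel)
      also have "\<dots> = 2 powr p * norm v powr p" by (simp add: powr_mult)
      finally have 2: "p * (norm m powr (p - 2) * - (m \<bullet> v)) \<le> p * (2 powr p * norm v powr p)"
        using p by (intro mult_left_mono) auto
      have 3: "(3 powr p + p * 2 powr p) * norm v powr p \<le> ?C * (norm m powr (p - 2) * (norm v)\<^sup>2 + norm v powr p)"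
        using C p by (intro mult_mono) auto
      have "norm (m + v) powr p \<le> p * norm m powr (p - 2) * (m \<bullet> v) + ?C * (norm m powr (p - 2) * (norm v)\<^sup>2 + norm v powr p)"
        using 1 2 3 by (simp add: algebra_simps)
      then show ?thesis by (smt (verit) powr_ge_zero)
    next
      case False
      show ?thesis
      proof (cases "m = 0")
        case True
        with False show ?thesis by simp
      next
        case m0: False
        define a where "a = norm m"
        define u where "u = (norm (m + v))\<^sup>2 / a\<^sup>2"
        have a: "a > 0" using m0 by (simp add: a_def)
        have va: "norm v \<le> a / 2" using False by (simp add: a_def)
        have lo: "a / 2 \<le> norm (m + v)"
          using norm_triangle_ineq2[of m "- v"] va by (simp add: a_def)
        have hi: "norm (m + v) \<le> 3 / 2 * a"
          using norm_triangle_ineq[of m v] va by (simp add: a_def)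
        have u1: "1/4 \<le> u"
        proof -
          have "(a / 2)\<^sup>2 \<le> (norm (m + v))\<^sup>2" using lo a by (intro power_mono) auto
          then show ?thesis using a by (simp add: u_def field_simps)
        qed
        have u2: "u \<le> 9/4"
        proof -
          have "(norm (m + v))\<^sup>2 \<le> (3 / 2 * a)\<^sup>2" using hi a by (intro power_mono) auto
          then show ?thesis using a by (simp add: u_def field_simps)
        qed
        have uu: "u - 1 = (2 * (m \<bullet> v) + (norm v)\<^sup>2) / a\<^sup>2"
          using a by (simp add: u_def field_simps power2_norm_eq_inner inner_add_left inner_add_right
              inner_commute a_def)
        have "\<bar>2 * (m \<bullet> v) + (norm v)\<^sup>2\<bar> \<le> 2 * (a * norm v) + a / 2 * norm v"
        proof -
          have "\<bar>m \<bullet> v\<bar> \<le> a * norm v" using Cauchy_Schwarz_ineq2[of m v] by (simp add: a_def)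
          moreover have "(norm v)\<^sup>2 \<le> a / 2 * norm v"
            unfolding power2_eq_square using va by (intro mult_right_mono) auto
          ultimately show ?thesis by (smt (verit) zero_le_power2)
        qed
        then have "\<bar>2 * (m \<bullet> v) + (norm v)\<^sup>2\<bar> \<le> 5/2 * (a * norm v)" by simp
        then have "(2 * (m \<bullet> v) + (norm v)\<^sup>2)\<^sup>2 \<le> (5/2 * (a * norm v))\<^sup>2"
          by (rule abs_le_square_iff[THEN iffD1, OF order_trans]) (use a in auto)
        also have "\<dots> \<le> 7 * (a\<^sup>2 * (norm v)\<^sup>2)" using a by (simp add: power2_eq_square)
        finally have sq0: "(2 * (m \<bullet> v) + (norm v)\<^sup>2)\<^sup>2 \<le> 7 * (a\<^sup>2 * (norm v)\<^sup>2)" .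
        have sq: "(u - 1)\<^sup>2 \<le> 7 * (norm v)\<^sup>2 / a\<^sup>2"
        proof -
          from sq0 have "(u - 1)\<^sup>2 \<le> 7 * (a\<^sup>2 * (norm v)\<^sup>2) / (a\<^sup>2)\<^sup>2"
            unfolding uu power_divide by (intro divide_right_mono) auto
          also have "\<dots> = 7 * (norm v)\<^sup>2 / a\<^sup>2" using a by (simp add: power2_eq_square)
          finally show ?thesis .
        qed
        have ap: "a powr p = a powr (p - 2) * a\<^sup>2"
          using a powr_add[of a "p - 2" 2] by (simp add: powr_numeral)
        have eq: "norm (m + v) powr p = a powr p * u powr (p / 2)"
        proof -
          have "norm (m + v) / a > 0" using lo a by (intro divide_pos_pos) linarith+
          then have "u powr (p / 2) = (norm (m + v) / a) powr p"
            using powr_powr[of "norm (m + v) / a" 2 "p / 2"] by (simp add: u_def power_divide powr_numeral)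
          then show ?thesis using a by (simp add: powr_divide)
        qed
        also have "\<dots> \<le> a powr p * (1 + p/2 * (u - 1) + C * (u - 1)\<^sup>2)"
          by (intro mult_left_mono C u1 u2) auto
        also have "\<dots> \<le> a powr p * (1 + p/2 * (u - 1) + C * (7 * (norm v)\<^sup>2 / a\<^sup>2))"
          using sq C by (intro mult_left_mono add_left_mono) auto
        also have "\<dots> = a powr p + p * a powr (p - 2) * (m \<bullet> v) + (p / 2 + 7 * C) * (a powr (p - 2) * (norm v)\<^sup>2)"
          using a unfolding uu ap by (simp add: field_simps)
        also have "\<dots> \<le> a powr p + p * a powr (p - 2) * (m \<bullet> v) + ?C * (a powr (p - 2) * (norm v)\<^sup>2 + norm v powr p)"
        proof -
          have "(p / 2 + 7 * C) * (a powr (p - 2) * (norm v)\<^sup>2) \<le> ?C * (a powr (p - 2) * (norm v)\<^sup>2)"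
            using p by (intro mult_right_mono) auto
          also have "\<dots> \<le> ?C * (a powr (p - 2) * (norm v)\<^sup>2 + norm v powr p)"
            using C p by (intro mult_left_mono add_nonneg_nonneg mult_nonneg_nonneg) auto
          finally show ?thesis by simp
        qed
        finally show ?thesis by (simp add: a_def)
      qed
    qed
  qed
qed

text \<open>A step of the drift (\<open>w\<close>) and martingale (\<open>y\<close>) parts of a discretised Ito process; only the
  first order term in \<open>y\<close> has to be kept exactly, because its expectation vanishes.\<close>

lemma ito_step_bound:
  fixes p T :: real
  assumes p: "2 \<le> p" and T: "0 \<le> T"
  obtains K where "0 \<le> K"
    "\<And>(m :: 'a::real_inner) w y \<beta> g \<zeta> D. \<lbrakk>norm w \<le> D * \<beta>; norm y \<le> g * \<zeta>; 0 \<le> \<beta>; 0 \<le> g; 0 \<le> \<zeta>; 0 \<le> D; D \<le> T\<rbrakk> \<Longrightarrow>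
       norm (m + (w + y)) powr p \<le> norm m powr p + p * norm m powr (p - 2) * (m \<bullet> y)
        + K * ((norm m powr p + \<beta> powr p + g powr p) * (D + \<zeta>\<^sup>2 + \<zeta> powr p))"
proof -
  obtain C where C: "0 \<le> C"
    "\<And>m v :: 'a. norm (m + v) powr p \<le> norm m powr p + p * norm m powr (p - 2) * (m \<bullet> v)
        + C * (norm m powr (p - 2) * (norm v)\<^sup>2 + norm v powr p)"
    using norm_add_powr_Taylor_bound[OF p] by metis
  \<comment> \<open>The summand \<open>p\<close> pays for the first order term in \<open>w\<close>,
    \<open>2 * T + 2\<close> for the square of the increment, and the terms with
    \<open>2 powr p\<close> for its \<open>p\<close>-th power.\<close>
  define K where "K = p + C * (2 * T + 2 + 2 powr p * T powr (p - 1) + 2 powr p)"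
  show thesis
  proof
    show K0: "0 \<le> K" unfolding K_def using C p T by (intro add_nonneg_nonneg mult_nonneg_nonneg) auto
    fix m w y :: 'a and \<beta> g \<zeta> D :: real
    assume h: "norm w \<le> D * \<beta>" "norm y \<le> g * \<zeta>" "0 \<le> \<beta>" "0 \<le> g" "0 \<le> \<zeta>" "0 \<le> D" "D \<le> T"
    define S where "S = norm m powr p + \<beta> powr p + g powr p"
    have S0: "0 \<le> S" by (simp add: S_def)
    have young1: "norm m powr (p - 2) * \<beta>\<^sup>2 \<le> S"
      using powr_mult_le_add_powr[of "norm m" \<beta> "p - 2" 2] p h
      by (simp add: S_def powr_numeral) (smt (verit) powr_ge_zero)
    have young2: "norm m powr (p - 2) * g\<^sup>2 \<le> S"
      using powr_mult_le_add_powr[of "norm m" g "p - 2" 2] p h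
      by (simp add: S_def powr_numeral) (smt (verit) powr_ge_zero)
    have young3: "norm m powr (p - 2) * (norm m * \<beta>) \<le> S"
    proof -
      have "norm m powr (p - 2) * (norm m * \<beta>) = norm m powr (p - 1) * \<beta> powr 1"
        using h by (cases "m = 0") (auto simp: powr_diff powr_numeral power2_eq_square)
      also have "\<dots> \<le> norm m powr p + \<beta> powr p"
        using powr_mult_le_add_powr[of "norm m" \<beta> "p - 1" 1] p h by simp
      finally show ?thesis by (simp add: S_def) (smt (verit) powr_ge_zero)
    qed
    have A: "norm m powr (p - 2) * (m \<bullet> w) \<le> D * S"
    proof -
      have "norm m powr (p - 2) * (m \<bullet> w) \<le> norm m powr (p - 2) * (norm m * (D * \<beta>))"
        using order_trans[OF norm_cauchy_schwarz[of m w] mult_left_mono[OF h(1) norm_ge_zero[of m]]]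
        by (intro mult_left_mono) auto
      also have "\<dots> = D * (norm m powr (p - 2) * (norm m * \<beta>))" by simp
      also have "\<dots> \<le> D * S" using young3 h by (intro mult_left_mono)
      finally show ?thesis .
    qed
    have B: "norm m powr (p - 2) * (norm (w + y))\<^sup>2 \<le> 2 * T * D * S + 2 * \<zeta>\<^sup>2 * S"
    proof -
      have "(norm (w + y))\<^sup>2 \<le> (D * \<beta> + g * \<zeta>)\<^sup>2"
        using h norm_triangle_ineq[of w y] by (intro power_mono) auto
      also have "\<dots> \<le> 2 * (D * \<beta>)\<^sup>2 + 2 * (g * \<zeta>)\<^sup>2"
        using sum_squares_bound[of "D * \<beta>" "g * \<zeta>"] by (simp add: power2_sum)
      also have "\<dots> \<le> 2 * (T * D * \<beta>\<^sup>2) + 2 * (\<zeta>\<^sup>2 * g\<^sup>2)"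
      proof -
        have "D * D * \<beta>\<^sup>2 \<le> T * D * \<beta>\<^sup>2" using h by (intro mult_right_mono) auto
        then show ?thesis by (simp add: power2_eq_square algebra_simps)
      qed
      finally have "norm m powr (p - 2) * (norm (w + y))\<^sup>2 \<le> norm m powr (p - 2) * (2 * (T * D * \<beta>\<^sup>2) + 2 * (\<zeta>\<^sup>2 * g\<^sup>2))"
        by (intro mult_left_mono) auto
      also have "\<dots> = 2 * T * D * (norm m powr (p - 2) * \<beta>\<^sup>2) + 2 * \<zeta>\<^sup>2 * (norm m powr (p - 2) * g\<^sup>2)"
        by (simp add: algebra_simps)
      also have "\<dots> \<le> 2 * T * D * S + 2 * \<zeta>\<^sup>2 * S"
        using young1 young2 h T by (intro add_mono mult_left_mono) auto
      finally show ?thesis .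
    qed
    have E: "norm (w + y) powr p \<le> 2 powr p * (T powr (p - 1) * D * S) + 2 powr p * (\<zeta> powr p * S)"
    proof -
      have "norm (w + y) powr p \<le> (D * \<beta> + g * \<zeta>) powr p"
        using h norm_triangle_ineq[of w y] p by (intro powr_mono2) auto
      also have "\<dots> \<le> 2 powr p * (D powr p * \<beta> powr p + g powr p * \<zeta> powr p)"
        using powr_add_le[of "D * \<beta>" "g * \<zeta>" p] h p by (simp add: powr_mult)
      \<comment> \<open>Exactly one factor \<open>D\<close> is kept and the others are bounded by
        \<open>T\<close>: terms linear in the step are the ones whose sum over a partition stays
        bounded under refinement.\<close>
      also have "D powr p * \<beta> powr p + g powr p * \<zeta> powr p \<le> T powr (p - 1) * D * S + \<zeta> powr p * S"
      proof (intro add_mono)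
        have "D powr p = D powr (p - 1) * D"
          using h by (cases "D = 0") (auto simp: powr_diff)
        also have "\<dots> \<le> T powr (p - 1) * D"
          using h p by (intro mult_right_mono powr_mono2) auto
        finally have 1: "D powr p \<le> T powr (p - 1) * D" .
        show "D powr p * \<beta> powr p \<le> T powr (p - 1) * D * S"
          by (rule mult_mono[OF 1]) (use h in \<open>auto simp: S_def add_increasing add_increasing2\<close>)
        have "g powr p \<le> S" by (simp add: S_def)
        then show "g powr p * \<zeta> powr p \<le> \<zeta> powr p * S"
          by (metis mult.commute mult_left_mono powr_ge_zero)
      qed
      then have "2 powr p * (D powr p * \<beta> powr p + g powr p * \<zeta> powr p) \<le> 2 powr p * (T powr (p - 1) * D * S + \<zeta> powr p * S)"
        by (intro mult_left_mono) auto
      finally show ?thesis by (simp add: algebra_simps)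
    qed
    define U where "U = D + \<zeta>\<^sup>2 + \<zeta> powr p"
    have U: "D \<le> U" "\<zeta>\<^sup>2 \<le> U" "\<zeta> powr p \<le> U" using h by (auto simp: U_def)
    have "norm (m + (w + y)) powr p \<le> norm m powr p + p * norm m powr (p - 2) * (m \<bullet> y)
       + (p * (D * S) + C * ((2 * T * D * S + 2 * \<zeta>\<^sup>2 * S) + (2 powr p * (T powr (p - 1) * D * S) + 2 powr p * (\<zeta> powr p * S))))"
    proof -
      have "p * (norm m powr (p - 2) * (m \<bullet> w)) \<le> p * (D * S)" using A p by (intro mult_left_mono) auto
      moreover have "C * (norm m powr (p - 2) * (norm (w + y))\<^sup>2 + norm (w + y) powr p)
        \<le> C * ((2 * T * D * S + 2 * \<zeta>\<^sup>2 * S) + (2 powr p * (T powr (p - 1) * D * S) + 2 powr p * (\<zeta> powr p * S)))"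
        using B E C by (intro mult_left_mono add_mono) auto
      ultimately show ?thesis using C(2)[of m "w + y"] by (simp add: inner_add_right algebra_simps)
    qed
    also have "p * (D * S) + C * ((2 * T * D * S + 2 * \<zeta>\<^sup>2 * S) + (2 powr p * (T powr (p - 1) * D * S) + 2 powr p * (\<zeta> powr p * S)))
       \<le> p * (U * S) + C * ((2 * T * U * S + 2 * U * S) + (2 powr p * (T powr (p - 1) * U * S) + 2 powr p * (U * S)))"
      using U S0 C p T by (intro add_mono mult_left_mono mult_right_mono) auto
    also have "\<dots> = K * (S * U)" by (simp add: K_def algebra_simps)
    finally show "norm (m + (w + y)) powr p \<le> norm m powr p + p * norm m powr (p - 2) * (m \<bullet> y)
        + K * ((norm m powr p + \<beta> powr p + g powr p) * (D + \<zeta>\<^sup>2 + \<zeta> powr p))"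
      by (simp add: S_def U_def)
  qed
qed

lemma discrete_Gronwall_step:
  fixes a d g :: "nat \<Rightarrow> real"
  assumes "a 0 = 0" "0 \<le> K" "\<And>j. j < m \<Longrightarrow> 0 \<le> d j" "\<And>j. j < m \<Longrightarrow> 0 \<le> g j"
    and step: "\<And>j. j < m \<Longrightarrow> a (Suc j) \<le> (1 + K * d j) * a j + K * d j * g j"
  shows "n \<le> m \<Longrightarrow> a n \<le> exp (K * (\<Sum>j<n. d j)) * (K * (\<Sum>j<n. d j * g j))"
proof (induction n)
  case 0
  then show ?case using assms by simp
next
  case (Suc n)
  have d: "0 \<le> d n" "0 \<le> g n" using Suc assms by auto
  have G: "0 \<le> (\<Sum>j<n. d j * g j)" using Suc.prems assms by (auto intro!: sum_nonneg)
  have E: "1 \<le> exp (K * (\<Sum>j<Suc n. d j))"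
    using Suc.prems assms by (subst one_le_exp_iff) (intro mult_nonneg_nonneg sum_nonneg, auto)
  have "a (Suc n) \<le> (1 + K * d n) * a n + K * d n * g n" using Suc.prems step by simp
  also have "(1 + K * d n) * a n \<le> exp (K * d n) * (exp (K * (\<Sum>j<n. d j)) * (K * (\<Sum>j<n. d j * g j)))"
  proof -
    have "(1 + K * d n) * a n \<le> (1 + K * d n) * (exp (K * (\<Sum>j<n. d j)) * (K * (\<Sum>j<n. d j * g j)))"
      using Suc d assms by (intro mult_left_mono) auto
    also have "\<dots> \<le> exp (K * d n) * (exp (K * (\<Sum>j<n. d j)) * (K * (\<Sum>j<n. d j * g j)))"
      using G assms by (intro mult_right_mono exp_ge_add_one_self mult_nonneg_nonneg) auto
    finally show ?thesis .
  qed
  also have "\<dots> = exp (K * (\<Sum>j<Suc n. d j)) * (K * (\<Sum>j<n. d j * g j))"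
    by (simp add: distrib_left exp_add)
  also have "K * d n * g n \<le> exp (K * (\<Sum>j<Suc n. d j)) * (K * (d n * g n))"
    using mult_right_mono[OF E, of "K * (d n * g n)"] d assms by (simp add: mult.assoc)
  finally show ?case by (simp add: algebra_simps)
qed

text \<open>The right-hand side solves the recursion with equality, by the geometric sum. This form
  serves the error of the Euler scheme, in which all earlier errors enter.\<close>

lemma discrete_Gronwall_sum:
  fixes a :: "nat \<Rightarrow> real"
  assumes "0 \<le> A" "0 \<le> B"
    and "\<And>k. k \<le> n \<Longrightarrow> a k \<le> A + B * (\<Sum>i<k. a i)"
  shows "k \<le> n \<Longrightarrow> a k \<le> A * (1 + B) ^ k"
proof (induction k rule: less_induct)
  case (less k)
  have "(\<Sum>i<k. a i) \<le> (\<Sum>i<k. A * (1 + B) ^ i)" using less by (intro sum_mono) auto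
  then have "a k \<le> A + B * (\<Sum>i<k. A * (1 + B) ^ i)"
    using assms(3)[OF less.prems] assms(2) by (meson add_left_mono mult_left_mono order_trans)
  also have "A + B * (\<Sum>i<k. A * (1 + B) ^ i) = A * (1 + B) ^ k"
    by (induction k) (auto simp: algebra_simps)
  finally show ?case .
qed

section \<open>Matrices\<close>

lemma norm_matrix_vector_mult_le:
  fixes A :: "real^'n^'m"
  shows "norm (A *v x) \<le> norm A * norm x"
proof -
  have "norm (A *v x) = L2_set (\<lambda>i. norm ((A *v x) $ i)) UNIV" by (simp add: norm_vec_def)
  also have "\<dots> \<le> L2_set (\<lambda>i. norm (A $ i) * norm x) UNIV"
    by (intro L2_set_mono) (simp_all add: matrix_vector_mul_component Cauchy_Schwarz_ineq2)
  also have "\<dots> = norm A * norm x"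
    by (simp add: norm_vec_def[of A] L2_set_left_distrib)
  finally show ?thesis .
qed

text \<open>Every entry is at most the operator norm. This is the bridge from the hypotheses on
  \<open>\<sigma>\<close> and \<open>\<theta>\<close> to the type class norm, in which the estimates
  are made.\<close>

lemma norm_le_matrix_onorm:
  fixes A :: "real^'n^'m"
  shows "norm A \<le> real (CARD('m) * CARD('n)) * matrix_onorm A"
proof -
  have "norm A \<le> (\<Sum>i\<in>UNIV. norm (A $ i))" by (simp add: norm_vec_def L2_set_le_sum)
  also have "\<dots> \<le> (\<Sum>i\<in>(UNIV::'m set). \<Sum>j\<in>(UNIV::'n set). \<bar>A $ i $ j\<bar>)" by (intro sum_mono norm_le_l1_cart)
  also have "\<dots> \<le> (\<Sum>i\<in>(UNIV::'m set). \<Sum>j\<in>(UNIV::'n set). matrix_onorm A)"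
    by (intro sum_mono) (simp add: matrix_onorm_def matrix_component_le_onorm)
  finally show ?thesis by simp
qed

text \<open>The quadratic form of \<open>C ** transpose C\<close> at \<open>y\<close> is the squared
  norm of \<open>transpose C *v y\<close>. Thus the matrix order compares norms of transposes, the
  form from which a factorization can be read off.\<close>

lemma matrix_preceqD:
  fixes A B :: "real^'q^'d"
  assumes "A \<preceq>m B"
  shows "norm (transpose A *v y) \<le> norm (transpose B *v y)"
proof -
  have quad: "y \<bullet> ((C ** transpose C) *v y) = (norm (transpose C *v y))\<^sup>2" for C :: "real^'q^'d"
    by (simp only: matrix_vector_mul_assoc[symmetric] dot_lmul_matrix[symmetric] transpose_matrix_vector
        power2_norm_eq_inner)
  have "0 \<le> y \<bullet> ((B ** transpose B - A ** transpose A) *v y)"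
    using assms by (auto simp: matrix_preceq_def pos_semidef_def)
  then have "(norm (transpose A *v y))\<^sup>2 \<le> (norm (transpose B *v y))\<^sup>2"
    by (simp add: matrix_vector_mult_diff_rdistrib inner_diff_right quad)
  then show ?thesis by (rule power2_le_imp_le) simp
qed

text \<open>By the norm inequality, sending \<open>Q y\<close> to \<open>P y\<close> is well defined
  and contractive on the range of \<open>Q\<close>. Composition with the orthogonal projection onto
  that range extends it to the whole space.\<close>

lemma Douglas_factorization:
  fixes P Q :: "'a::euclidean_space \<Rightarrow> 'b::euclidean_space"
  assumes "linear P" "linear Q" and le: "\<And>y. norm (P y) \<le> norm (Q y)"
  obtains g where "linear g" "\<And>y. g (Q y) = P y" "\<And>x. norm (g x) \<le> norm x"
proof -
  interpret P: linear P by fact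
  interpret Q: linear Q by fact
  have sub: "subspace (range Q)" using linear_subspace_image[OF assms(2) subspace_UNIV] .
  have "\<exists>w. \<forall>y. (x - Q w) \<bullet> Q y = 0" for x
  proof -
    obtain y z where "y \<in> span (range Q)" "\<And>w. w \<in> span (range Q) \<Longrightarrow> orthogonal z w" "x = y + z"
      using orthogonal_subspace_decomp_exists[of "range Q" x] by blast
    moreover obtain a where "y = Q a" using calculation(1) sub by (metis imageE span_eq_iff)
    ultimately have "\<forall>y. (x - Q a) \<bullet> Q y = 0" by (auto simp: orthogonal_def span_base)
    then show ?thesis ..
  qed
  \<comment> \<open>\<open>Q (w x)\<close> is the orthogonal projection of \<open>x\<close>. The
    preimage \<open>w x\<close> is chosen arbitrarily and need not depend linearly on
    \<open>x\<close>; \<open>uniq\<close> shows that \<open>P (w x)\<close> does not depend on the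
    choice.\<close>
  then obtain w where w: "\<And>x y. (x - Q (w x)) \<bullet> Q y = 0" by metis
  have uniq: "P a = P b" if "\<And>y. (x - Q a) \<bullet> Q y = 0" "\<And>y. (x - Q b) \<bullet> Q y = 0" for x a b
  proof -
    have "Q (a - b) \<bullet> Q (a - b) = 0"
      using that(1)[of "a - b"] that(2)[of "a - b"] by (simp add: Q.diff inner_diff_left)
    then have "norm (Q (a - b)) = 0" by simp
    then have "P (a - b) = 0" using le[of "a - b"] by simp
    then show ?thesis by (simp add: P.diff)
  qed
  show thesis
  proof
    show "linear (\<lambda>x. P (w x))"
    proof (rule linearI)
      fix x y
      have "P (w (x + y)) = P (w x + w y)"
        by (rule uniq[OF w]) (use w[of x] w[of y] in \<open>simp add: Q.add inner_diff_left inner_add_left\<close>)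
      then show "P (w (x + y)) = P (w x) + P (w y)" by (simp add: P.add)
    next
      fix c x
      have "P (w (c *\<^sub>R x)) = P (c *\<^sub>R w x)"
        by (rule uniq[OF w]) (use w[of x] in \<open>simp add: Q.scaleR inner_diff_left\<close>)
      then show "P (w (c *\<^sub>R x)) = c *\<^sub>R P (w x)" by (simp add: P.scaleR)
    qed
    show "P (w (Q y)) = P y" for y by (rule uniq[OF w]) simp
    fix x
    have "x \<bullet> Q (w x) = Q (w x) \<bullet> Q (w x)" using w[of x "w x"] by (simp add: inner_diff_left)
    then have "norm (Q (w x)) * norm (Q (w x)) \<le> norm x * norm (Q (w x))"
      using norm_cauchy_schwarz[of x "Q (w x)"] power2_norm_eq_inner[of "Q (w x)"] by (simp add: power2_eq_square)
    then have "norm (Q (w x)) \<le> norm x" by (cases "Q (w x) = 0") auto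
    then show "norm (P (w x)) \<le> norm x" by (rule order_trans[OF le])
  qed
qed

text \<open>The factorization is applied to the transposes. Transposing back puts the contraction to
  the right of \<open>B\<close>, next to the Gaussian vector. The transpose of the contraction
  \<open>g\<close> is a contraction because \<open>|K x|^2 = x \<bullet> g (K x)\<close>.\<close>

lemma matrix_preceq_factor:
  fixes A B :: "real^'q^'d"
  assumes "A \<preceq>m B"
  obtains K :: "real^'q^'q" where "A = B ** K" "\<And>x. norm (K *v x) \<le> norm x"
proof -
  obtain g where g: "linear g" "\<And>y. g (transpose B *v y) = transpose A *v y" "\<And>x. norm (g x) \<le> norm x"
    by (rule Douglas_factorization[OF matrix_vector_mul_linear matrix_vector_mul_linear matrix_preceqD[OF assms]]) blast
  define K where "K = transpose (matrix g)"
  show thesis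
  proof
    have "matrix g ** transpose B = transpose A"
      by (simp only: simp_thms matrix_eq matrix_vector_mul_assoc[symmetric] matrix_vector_mul(2)[OF g(1)] g(2))
    then have "transpose (matrix g ** transpose B) = A" by simp
    then show "A = B ** K" by (simp add: K_def matrix_transpose_mul)
    fix x
    have "norm (K *v x) * norm (K *v x) = x \<bullet> g (K *v x)"
    proof -
      have "norm (K *v x) * norm (K *v x) = (K *v x) \<bullet> (K *v x)"
        using power2_norm_eq_inner[of "K *v x"] by (simp only: power2_eq_square)
      also have "\<dots> = x \<bullet> (transpose K *v (K *v x))"
        using dot_lmul_matrix[of x "transpose K" "K *v x"] transpose_matrix_vector[of "transpose K" x]
        by (simp only: transpose_transpose)
      finally show ?thesis by (simp add: K_def g(1))
    qed
    also have "\<dots> \<le> norm x * norm (K *v x)"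
      by (rule order_trans[OF norm_cauchy_schwarz]) (simp add: g mult_left_mono)
    finally show "norm (K *v x) \<le> norm x" by (cases "K *v x = 0") auto
  qed
qed

section \<open>Extreme points of the unit ball of the operator norm\<close>

lemma linear_coeff_eq_0:
  fixes a d :: real
  assumes "\<And>s. 0 \<le> 2 * s * a + s\<^sup>2 * d"
  shows "a = 0"
proof (rule ccontr)
  assume "a \<noteq> 0"
  \<comment> \<open>At \<open>s = - a / D\<close> with \<open>D > d\<close> the negative linear term
    beats the quadratic one.\<close>
  define D where "D = \<bar>d\<bar> + 1"
  have D: "D > 0" "d < D" by (auto simp: D_def)
  have "0 \<le> 2 * (- a / D) * a + (- a / D)\<^sup>2 * d" by (rule assms)
  also have "\<dots> = a\<^sup>2 * (d - 2 * D) / D\<^sup>2" using D by (simp add: field_simps power2_eq_square)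
  also have "\<dots> < 0" using D \<open>a \<noteq> 0\<close> by (intro divide_neg_pos mult_pos_neg) auto
  finally show False by simp
qed

text \<open>If \<open>K\<close> shrinks some vector, let \<open>v\<close> be a unit vector at which
  \<open>|K v|\<close> is minimal, a singular vector for the smallest singular value
  \<open>c < 1\<close>. Minimality makes \<open>K v\<close> orthogonal to the image of the
  complement of \<open>v\<close>. Hence the image of \<open>v\<close> alone can be moved in two
  opposite directions: adding and subtracting the rank one map
  \<open>x \<mapsto> (v \<bullet> x) u\<close> leaves contractions, and \<open>K\<close> is their
  midpoint.\<close>

lemma extreme_contraction_isometry:
  fixes K :: "real^'n^'n"
  assumes "K extreme_point_of {K. \<forall>x. norm (K *v x) \<le> norm x}"
  shows "norm (K *v x) = norm x"
proof (rule ccontr)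
  let ?S = "{K :: real^'n^'n. \<forall>x. norm (K *v x) \<le> norm x}"
  have K: "norm (K *v x) \<le> norm x" for x using assms by (auto simp: extreme_point_of_def)
  assume "norm (K *v x) \<noteq> norm x"
  then have x: "norm (K *v x) < norm x" using K[of x] by simp
  have "sphere (0::real^'n) 1 \<noteq> {}" by simp
  moreover have "continuous_on (sphere 0 1) (\<lambda>y. norm (K *v y))"
    by (intro continuous_intros linear_continuous_on) simp
  ultimately obtain v where v: "norm v = 1" and min: "\<And>y. norm y = 1 \<Longrightarrow> norm (K *v v) \<le> norm (K *v y)"
    using continuous_attains_inf[of "sphere 0 1" "\<lambda>y. norm (K *v y)"] by auto
  define c where "c = norm (K *v v)"
  have min': "c * norm y \<le> norm (K *v y)" for y
  proof (cases "y = 0")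
    case False
    then have "c \<le> norm (K *v (inverse (norm y) *\<^sub>R y))" unfolding c_def by (intro min) simp
    then show ?thesis using False by (simp add: matrix_vector_mult_scaleR field_simps)
  qed simp
  have "c * norm x < norm x" using min'[of x] x by simp
  then have c1: "c < 1" by (metis mult_le_cancel_right1 norm_ge_zero not_le)
  have c0: "0 \<le> c" by (simp add: c_def)
  \<comment> \<open>First order condition at the minimum: along \<open>v + s w\<close> the
    difference of \<open>|K (v + s w)|^2\<close> and \<open>c^2 * |v + s w|^2\<close> is nonnegative
    and vanishes at \<open>s = 0\<close>, so its linear coefficient is 0.\<close>
  have orth: "(K *v v) \<bullet> (K *v w) = 0" if "v \<bullet> w = 0" for w
  proof (rule linear_coeff_eq_0)
    fix s
    have "(c * norm (v + s *\<^sub>R w))\<^sup>2 \<le> (norm (K *v (v + s *\<^sub>R w)))\<^sup>2"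
      using min' c0 by (intro power_mono) auto
    moreover have "(norm (v + s *\<^sub>R w))\<^sup>2 = 1 + s\<^sup>2 * (norm w)\<^sup>2"
      using v that unfolding power2_norm_eq_inner
      by (simp add: inner_add_left inner_add_right inner_commute norm_eq_1 power2_eq_square)
    moreover have "(norm (K *v (v + s *\<^sub>R w)))\<^sup>2 = c\<^sup>2 + 2 * s * ((K *v v) \<bullet> (K *v w)) + s\<^sup>2 * (norm (K *v w))\<^sup>2"
      unfolding c_def power2_norm_eq_inner
      by (simp add: matrix_vector_right_distrib matrix_vector_mult_scaleR inner_add_left inner_add_right inner_commute
         power2_eq_square)
    ultimately show "0 \<le> 2 * s * ((K *v v) \<bullet> (K *v w)) + s\<^sup>2 * ((norm (K *v w))\<^sup>2 - c\<^sup>2 * (norm w)\<^sup>2)"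
      by (simp add: power_mult_distrib algebra_simps)
  qed
  \<comment> \<open>\<open>K v\<close> is to be replaced by \<open>K v + u\<close> and by
    \<open>K v - u\<close>. If \<open>K v = 0\<close>, then \<open>K\<close> is not onto, and
    \<open>u\<close> is a unit vector orthogonal to its range. Otherwise \<open>u\<close> stretches
    \<open>K v\<close> to length 1 on one side, and on the other side the length is
    \<open>|2 * c - 1| \<le> 1\<close>.\<close>
  obtain u where u: "u \<noteq> 0" "norm (K *v v + u) \<le> 1" "norm (K *v v - u) \<le> 1"
    "\<And>w. v \<bullet> w = 0 \<Longrightarrow> (K *v v) \<bullet> (K *v w) = 0 \<and> u \<bullet> (K *v w) = 0"
  proof (cases "K *v v = 0")
    case True
    have "\<not> inj ((*v) K)"
    proof
      assume "inj ((*v) K)"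
      then have "v = 0" using True by (metis injD matrix_vector_mult_0_right)
      with v show False by simp
    qed
    then have "\<not> surj ((*v) K)"
      using linear_surjective_imp_injective[OF matrix_vector_mul_linear] by blast
    then obtain a where a: "a \<notin> range ((*v) K)" by blast
    obtain y z where yz: "y \<in> span (range ((*v) K))" "\<And>w. w \<in> span (range ((*v) K)) \<Longrightarrow> orthogonal z w" "a = y + z"
      using orthogonal_subspace_decomp_exists[of "range ((*v) K)" a] by blast
    have sp: "span (range ((*v) K)) = range ((*v) K)"
      by (simp add: linear_subspace_image)
    have z: "z \<noteq> 0" using a yz sp by auto
    show thesis
    proof (rule that[of "inverse (norm z) *\<^sub>R z"])
      show "(K *v v) \<bullet> (K *v w) = 0 \<and> inverse (norm z) *\<^sub>R z \<bullet> (K *v w) = 0" for w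
        using yz(2)[of "K *v w"] by (auto simp: True orthogonal_def span_base)
    qed (use z True in auto)
  next
    case False
    then have cp: "c > 0" by (simp add: c_def)
    show thesis
    proof (rule that[of "(1 / c - 1) *\<^sub>R (K *v v)"])
      show "(1 / c - 1) *\<^sub>R (K *v v) \<noteq> 0" using False c1 by simp
      have "K *v v + (1 / c - 1) *\<^sub>R (K *v v) = (1 / c) *\<^sub>R (K *v v)" by (simp add: algebra_simps)
      then show "norm (K *v v + (1 / c - 1) *\<^sub>R (K *v v)) \<le> 1" using cp by (simp add: c_def)
      have "K *v v - (1 / c - 1) *\<^sub>R (K *v v) = (2 - 1 / c) *\<^sub>R (K *v v)"
        by (simp add: algebra_simps scaleR_2)
      then have "norm (K *v v - (1 / c - 1) *\<^sub>R (K *v v)) = \<bar>2 - 1 / c\<bar> * c" by (simp add: c_def)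
      also have "\<dots> = \<bar>(2 - 1 / c) * c\<bar>" using cp by (simp add: abs_mult)
      also have "\<dots> = \<bar>2 * c - 1\<bar>" using cp by (simp add: left_diff_distrib)
      also have "\<dots> \<le> 1" using c0 c1 by auto
      finally show "norm (K *v v - (1 / c - 1) *\<^sub>R (K *v v)) \<le> 1" .
    qed (use orth in auto)
  qed
  define N where "N = matrix (\<lambda>x. (v \<bullet> x) *\<^sub>R u)"
  have N: "N *v x = (v \<bullet> x) *\<^sub>R u" for x
    unfolding N_def by (subst matrix_vector_mul(2)) (auto intro!: linearI simp: inner_add_right algebra_simps)
  \<comment> \<open>Pythagoras: the images of the two components of \<open>x\<close> stay
    orthogonal, so \<open>K v\<close> may be exchanged for any \<open>e\<close> of norm at most 1
    with the same orthogonality.\<close>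
  have contr: "norm ((v \<bullet> x) *\<^sub>R e + K *v (x - (v \<bullet> x) *\<^sub>R v)) \<le> norm x"
    if e: "norm e \<le> 1" and eo: "\<And>w. v \<bullet> w = 0 \<Longrightarrow> e \<bullet> (K *v w) = 0" for e x
  proof -
    define w where "w = x - (v \<bullet> x) *\<^sub>R v"
    have vw: "v \<bullet> w = 0" using v by (simp add: w_def inner_diff_right norm_eq_1)
    have "(norm ((v \<bullet> x) *\<^sub>R e + K *v w))\<^sup>2 = (v \<bullet> x)\<^sup>2 * (norm e)\<^sup>2 + (norm (K *v w))\<^sup>2"
      using eo[OF vw] unfolding power2_norm_eq_inner
      by (simp add: inner_add_left inner_add_right inner_commute power2_eq_square)
    also have "\<dots> \<le> (v \<bullet> x)\<^sup>2 * 1 + (norm w)\<^sup>2"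
      using e K by (intro add_mono mult_left_mono power_mono) (auto intro: power_le_one)
    also have "\<dots> = (norm x)\<^sup>2"
    proof -
      have "x = (v \<bullet> x) *\<^sub>R v + w" by (simp add: w_def)
      then have "(norm x)\<^sup>2 = (norm ((v \<bullet> x) *\<^sub>R v + w))\<^sup>2" by simp
      also have "\<dots> = (v \<bullet> x)\<^sup>2 * 1 + (norm w)\<^sup>2"
        using vw v by (simp only: power2_norm_eq_inner inner_add_left inner_add_right)
          (simp add: inner_commute power2_eq_square norm_eq_1)
      finally show ?thesis by simp
    qed
    finally show ?thesis unfolding w_def[symmetric] by (rule power2_le_imp_le) simp
  qed
  have split: "K *v x = (v \<bullet> x) *\<^sub>R (K *v v) + K *v (x - (v \<bullet> x) *\<^sub>R v)" for x
    by (simp add: matrix_vector_mult_diff_distrib matrix_vector_mult_scaleR)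
  have "K + N \<in> ?S" "K - N \<in> ?S"
  proof -
    have "(K + N) *v x = (v \<bullet> x) *\<^sub>R (K *v v + u) + K *v (x - (v \<bullet> x) *\<^sub>R v)"
      "(K - N) *v x = (v \<bullet> x) *\<^sub>R (K *v v - u) + K *v (x - (v \<bullet> x) *\<^sub>R v)" for x
      using split[of x] by (simp_all add: matrix_vector_mult_add_rdistrib matrix_vector_mult_diff_rdistrib N algebra_simps)
    then show "K + N \<in> ?S" "K - N \<in> ?S"
      using u by (auto simp: inner_add_left inner_diff_left intro!: contr)
  qed
  moreover have "K \<in> open_segment (K + N) (K - N)"
  proof -
    have "N *v v = u" using v by (simp add: N norm_eq_1)
    then have N0: "N \<noteq> 0" using u by auto
    have ne: "K + N \<noteq> K - N"
    proof (rule notI)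
      assume "K + N = K - N"
      moreover have "2 *\<^sub>R N = (K + N) - (K - N)" by (simp add: scaleR_2)
      ultimately have "2 *\<^sub>R N = 0" by simp
      then show False using N0 by simp
    qed
    have "midpoint (K + N) (K - N) = K" by (simp add: midpoint_def)
    then show ?thesis using midpoint_in_open_segment[of "K + N" "K - N"] ne by simp
  qed
  ultimately show False using assms by (auto simp: extreme_point_of_def)
qed

text \<open>The contractions form a compact convex set. In finite dimension such a set is the convex
  hull of its extreme points, and these are isometries.\<close>

lemma contraction_in_hull_orthogonal:
  fixes K :: "real^'n^'n"
  assumes "\<And>x. norm (K *v x) \<le> norm x"
  shows "K \<in> convex hull {U. orthogonal_transformation ((*v) U)}"
proof -
  let ?S = "{K :: real^'n^'n. \<forall>x. norm (K *v x) \<le> norm x}"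
  have conv: "convex ?S"
  proof (rule convexI)
    fix A B :: "real^'n^'n" and u v :: real
    assume h: "A \<in> ?S" "B \<in> ?S" "0 \<le> u" "0 \<le> v" "u + v = 1"
    have "norm ((u *\<^sub>R A + v *\<^sub>R B) *v x) \<le> norm x" for x
    proof -
      have "norm ((u *\<^sub>R A + v *\<^sub>R B) *v x) \<le> u * norm (A *v x) + v * norm (B *v x)"
        using norm_triangle_ineq[of "u *\<^sub>R (A *v x)" "v *\<^sub>R (B *v x)"] h
        by (simp add: matrix_vector_mult_add_rdistrib flip: scaleR_matrix_vector_assoc)
      also have "\<dots> \<le> u * norm x + v * norm x" using h by (intro add_mono mult_left_mono) auto
      finally show ?thesis using h by (simp flip: distrib_right)
    qed
    then show "u *\<^sub>R A + v *\<^sub>R B \<in> ?S" by simp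
  qed
  have "compact ?S"
  proof (subst compact_eq_bounded_closed, intro conjI)
    show "bounded ?S"
    proof (rule boundedI)
      fix A :: "real^'n^'n" assume "A \<in> ?S"
      then have "matrix_onorm A \<le> 1" unfolding matrix_onorm_def by (intro onorm_le) simp
      then show "norm A \<le> real (CARD('n) * CARD('n)) * 1"
        by (intro order_trans[OF norm_le_matrix_onorm] mult_left_mono) auto
    qed
    have "bounded_linear (\<lambda>A :: real^'n^'n. A *v x)" for x
      by (rule bounded_linear_intro[where K = "norm x"])
         (simp_all add: matrix_vector_mult_add_rdistrib scaleR_matrix_vector_assoc norm_matrix_vector_mult_le)
    then show "closed ?S"
      by (intro closed_Collect_all closed_Collect_le continuous_intros linear_continuous_on)
  qed
  from Krein_Milman_Minkowski[OF this conv]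
  have eq: "?S = convex hull {U. U extreme_point_of ?S}" .
  have "{U. U extreme_point_of ?S} \<subseteq> {U. orthogonal_transformation ((*v) U)}"
    by (auto simp: orthogonal_transformation extreme_contraction_isometry)
  then have "?S \<subseteq> convex hull {U. orthogonal_transformation ((*v) U)}"
    by (subst eq) (rule hull_mono)
  then show "K \<in> convex hull {U. orthogonal_transformation ((*v) U)}"
    using assms by auto
qed

section \<open>Gaussian measures\<close>

text \<open>Any translation-invariant measure is a multiple of Lebesgue measure; the unit ball, which is
  invariant under \<open>T\<close>, shows that the factor is 1.\<close>

lemma lborel_distr_orthogonal:
  fixes T :: "'a::euclidean_space \<Rightarrow> 'a"
  assumes "orthogonal_transformation T"
  shows "distr lborel borel T = lborel"
proof (rule measure_eqI)
  have lin: "linear T" and iso: "\<And>x. norm (T x) = norm x"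
    using assms by (auto simp: orthogonal_transformation)
  have bij: "bij T" using assms by (rule orthogonal_transformation_bij)
  define S where "S = inv T"
  have TS: "T (S x) = x" for x using bij by (simp add: S_def bij_is_surj surj_f_inv_f)
  have T[measurable]: "T \<in> borel_measurable borel"
    using lin by (intro borel_measurable_continuous_onI linear_continuous_on) (simp add: linear_conv_bounded_linear)
  have transl: "(\<integral>\<^sup>+y. h (c + y) \<partial>lborel) = (\<integral>\<^sup>+y. h y \<partial>lborel)"
    if [measurable]: "h \<in> borel_measurable borel" for h :: "'a \<Rightarrow> ennreal" and c
  proof -
    have "(\<integral>\<^sup>+y. h y \<partial>lborel) = (\<integral>\<^sup>+y. h y \<partial>distr lborel borel ((+) c))" by (simp add: lborel_distr_plus)
    also have "\<dots> = (\<integral>\<^sup>+y. h (c + y) \<partial>lborel)" by (subst nn_integral_distr) auto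
    finally show ?thesis ..
  qed
  let ?c = "emeasure lborel (ball 0 1 :: 'a set)"
  have c: "?c \<noteq> 0" "?c \<noteq> \<infinity>"
    using less_imp_neq[OF unit_ball_vol_pos[of "real DIM('a)", OF of_nat_0_le_iff]]
    by (simp_all add: emeasure_ball)
  have ball[measurable]: "ball x r \<in> sets borel" for x :: 'a and r by simp
  fix A assume "A \<in> sets (distr lborel borel T)"
  then have A[measurable]: "A \<in> sets borel" by simp
  \<comment> \<open>The double integral of this kernel is evaluated twice. For fixed
    \<open>x\<close>, translation invariance removes \<open>x\<close> from \<open>x + T y\<close>
    and leaves the image measure of \<open>A\<close>. Shifting \<open>x\<close> by
    \<open>- T y\<close> instead moves \<open>T\<close> into the indicator of the unit ball; as
    \<open>T\<close> is an isometry, this becomes a ball in \<open>y\<close> around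
    \<open>S x\<close>, and the Lebesgue measure of \<open>A\<close> is left.\<close>
  let ?i = "\<lambda>x y. indicator (ball 0 1) x * indicator A (x + T y) :: ennreal"
  have swap: "(\<integral>\<^sup>+x. \<integral>\<^sup>+y. f x y \<partial>lborel \<partial>lborel) = (\<integral>\<^sup>+y. \<integral>\<^sup>+x. f x y \<partial>lborel \<partial>lborel)"
    if "case_prod f \<in> borel_measurable (borel \<Otimes>\<^sub>M borel)" for f :: "'a \<Rightarrow> 'a \<Rightarrow> ennreal"
    using pair_sigma_finite.Fubini'[OF pair_sigma_finite.intro[OF sigma_finite_lborel sigma_finite_lborel], of f] that
    by simp
  have "(\<integral>\<^sup>+x. \<integral>\<^sup>+y. ?i x y \<partial>lborel \<partial>lborel) = ?c * emeasure (distr lborel borel T) A"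
  proof -
    have "(\<integral>\<^sup>+y. indicator A (x + T y) \<partial>lborel) = emeasure (distr lborel borel T) A" for x
    proof -
      have "x + T y = T (S x + y)" for y using linear_add[OF lin, of "S x" y] by (simp add: TS)
      then have "(\<integral>\<^sup>+y. indicator A (x + T y) \<partial>lborel) = (\<integral>\<^sup>+y. indicator A (T (S x + y)) \<partial>lborel)" by simp
      also have "\<dots> = (\<integral>\<^sup>+y. indicator A (T y) \<partial>lborel)" by (rule transl) simp
      also have "\<dots> = (\<integral>\<^sup>+y. indicator A y \<partial>distr lborel borel T)" by (subst nn_integral_distr) auto
      finally show ?thesis by simp
    qed
    then show ?thesis by (simp add: nn_integral_cmult nn_integral_multc)
  qed
  moreover have "(\<integral>\<^sup>+x. \<integral>\<^sup>+y. ?i x y \<partial>lborel \<partial>lborel) = ?c * emeasure lborel A"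
  proof -
    have "(\<integral>\<^sup>+x. \<integral>\<^sup>+y. ?i x y \<partial>lborel \<partial>lborel) = (\<integral>\<^sup>+y. \<integral>\<^sup>+x. ?i x y \<partial>lborel \<partial>lborel)"
      by (rule swap) measurable
    also have "\<dots> = (\<integral>\<^sup>+y. \<integral>\<^sup>+x. ?i (- T y + x) y \<partial>lborel \<partial>lborel)"
    proof (rule nn_integral_cong)
      show "(\<integral>\<^sup>+x. ?i x y \<partial>lborel) = (\<integral>\<^sup>+x. ?i (- T y + x) y \<partial>lborel)" for y
        by (rule transl[where h = "\<lambda>x. ?i x y", symmetric]) measurable
    qed
    also have "\<dots> = (\<integral>\<^sup>+x. \<integral>\<^sup>+y. ?i (- T y + x) y \<partial>lborel \<partial>lborel)"
      by (rule swap[symmetric]) measurable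
    also have "\<dots> = (\<integral>\<^sup>+x. \<integral>\<^sup>+y. indicator (ball (S x) 1) y * indicator A x \<partial>lborel \<partial>lborel)"
    proof (intro nn_integral_cong)
      fix x y
      have "- T y + x = T (S x - y)" using linear_diff[OF lin, of "S x" y] by (simp add: TS)
      then have "norm (- T y + x) = dist (S x) y" by (simp add: iso dist_norm)
      then show "?i (- T y + x) y = indicator (ball (S x) 1) y * indicator A x"
        by (simp add: indicator_def)
    qed
    also have "\<dots> = (\<integral>\<^sup>+x. ?c * indicator A x \<partial>lborel)"
      by (intro nn_integral_cong) (simp add: nn_integral_multc emeasure_ball)
    also have "\<dots> = ?c * emeasure lborel A" by (simp add: nn_integral_cmult)
    finally show ?thesis .
  qed
  ultimately have "?c * emeasure (distr lborel borel T) A = ?c * emeasure lborel A" by simp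
  then show "emeasure (distr lborel borel T) A = emeasure lborel A"
    using c by (simp add: ennreal_mult_cancel_left)
qed simp

text \<open>\<open>D\<close> is the variance of each coordinate and is meant to be positive. The
  density is written as in \<open>brownian_motion\<close>, so that it is literally that of an
  increment.\<close>

definition gaussian :: "real \<Rightarrow> (real^'q) measure" where
  "gaussian D = density lborel (\<lambda>x. ennreal (\<Prod>i\<in>UNIV. normal_density 0 (sqrt D) (x $ i)))"

lemma sets_gaussian [measurable_cong, simp]: "sets (gaussian D) = sets borel"
  and space_gaussian [simp]: "space (gaussian D) = UNIV"
  by (simp_all add: gaussian_def)

lemma borel_measurable_gaussian_density [measurable]:
  "(\<lambda>x :: real^'q. \<Prod>i\<in>UNIV. normal_density 0 s (x $ i)) \<in> borel_measurable borel"
  by (intro borel_measurable_prod measurable_compose[OF _ borel_measurable_normal_density]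
      borel_measurable_continuous_onI continuous_intros)

text \<open>The squares of the coordinates add up in the exponent. Dependence on the norm alone is
  what makes the law invariant under orthogonal maps.\<close>

lemma gaussian_density_norm:
  fixes x :: "real^'q"
  assumes "0 < D"
  shows "(\<Prod>i\<in>UNIV. normal_density 0 (sqrt D) (x $ i)) = (1 / sqrt (2 * pi * D)) ^ CARD('q) * exp (- (norm x)\<^sup>2 / (2 * D))"
proof -
  have "(norm x)\<^sup>2 = (\<Sum>i\<in>UNIV. (x $ i)\<^sup>2)"
    unfolding power2_norm_eq_inner inner_vec_def by (simp add: power2_eq_square)
  then have "exp (- (norm x)\<^sup>2 / (2 * D)) = (\<Prod>i\<in>UNIV. exp (- (x $ i)\<^sup>2 / (2 * D)))"
    by (simp add: sum_divide_distrib sum_negf flip: exp_sum)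
  then show ?thesis
    using assms unfolding normal_density_def by (simp add: prod_dividef power_divide prod.distrib)
qed

lemma prob_space_gaussian:
  assumes "0 < D"
  shows "prob_space (gaussian D :: (real^'q) measure)"
proof (rule prob_spaceI)
  let ?f = "\<lambda>x :: real^'q. \<Prod>b\<in>Basis. normal_density 0 (sqrt D) (x \<bullet> b)"
  have "(\<Prod>i\<in>UNIV. normal_density 0 (sqrt D) (x $ i)) = ?f x" for x :: "real^'q"
  proof -
    have B: "(Basis :: (real^'q) set) = (\<lambda>i. axis i 1) ` UNIV" by (auto simp: Basis_vec_def)
    have inj: "inj (\<lambda>i :: 'q. axis i (1::real))" by (auto simp: inj_on_def axis_eq_axis)
    show ?thesis unfolding B by (subst prod.reindex[OF inj]) (simp add: inner_axis)
  qed
  then have "emeasure (gaussian D :: (real^'q) measure) (space (gaussian D)) = (\<integral>\<^sup>+x. ennreal (?f x) \<partial>lborel)"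
    by (simp add: gaussian_def emeasure_density)
  also have "\<dots> = (\<integral>\<^sup>+x. (\<Prod>b\<in>(Basis :: (real^'q) set). ennreal (normal_density 0 (sqrt D) (x \<bullet> b))) \<partial>lborel)"
    by (simp add: prod_ennreal)
  also have "\<dots> = (\<Prod>b\<in>(Basis :: (real^'q) set). \<integral>\<^sup>+x. ennreal (normal_density 0 (sqrt D) x) \<partial>lborel)"
    by (rule nn_integral_lborel_prod) auto
  also have "(\<integral>\<^sup>+x. ennreal (normal_density 0 (sqrt D) x) \<partial>lborel) = 1"
    using prob_space.emeasure_space_1[OF prob_space_normal_density[of "sqrt D" 0]] assms
    by (simp add: emeasure_density)
  finally show "emeasure (gaussian D :: (real^'q) measure) (space (gaussian D)) = 1" by simp
qed

lemma distr_gaussian_orthogonal: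
  fixes T :: "real^'q \<Rightarrow> real^'q"
  assumes "0 < D" "orthogonal_transformation T"
  shows "distr (gaussian D) borel T = gaussian D"
proof (rule measure_eqI)
  have T[measurable]: "T \<in> borel_measurable borel"
    using assms(2) by (intro borel_measurable_continuous_onI linear_continuous_on)
      (simp add: orthogonal_transformation_def linear_conv_bounded_linear)
  let ?f = "\<lambda>x :: real^'q. \<Prod>i\<in>UNIV. normal_density 0 (sqrt D) (x $ i)"
  have f: "?f (T x) = ?f x" for x
    using assms by (simp add: gaussian_density_norm orthogonal_transformation)
  fix A assume "A \<in> sets (distr (gaussian D) borel T)"
  then have A[measurable]: "A \<in> sets borel" by simp
  have "emeasure (distr (gaussian D) borel T) A = (\<integral>\<^sup>+x. ennreal (?f x) * indicator A (T x) \<partial>lborel)"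
    by (simp add: emeasure_distr gaussian_def emeasure_density indicator_vimage[symmetric] measurable_sets_borel[OF T A] indicator_def vimage_def)
  also have "\<dots> = (\<integral>\<^sup>+x. ennreal (?f x) * indicator A x \<partial>distr lborel borel T)"
    by (subst nn_integral_distr) (auto simp: f)
  also have "\<dots> = emeasure (gaussian D) A"
    by (simp add: lborel_distr_orthogonal[OF assms(2)] gaussian_def emeasure_density)
  finally show "emeasure (distr (gaussian D) borel T) A = emeasure (gaussian D) A" .
qed simp

text \<open>The weight \<open>exp (|x|\<^sup>2 / (4 D))\<close>, which dominates every power of \<open>|x|\<close>, turns the Gaussian density of
  variance \<open>D\<close> into a multiple of the one of variance \<open>2 D\<close>.\<close>

lemma gaussian_moment:
  fixes r :: real
  assumes "0 \<le> r"
  obtains c where "0 \<le> c" "\<And>D. 0 < D \<Longrightarrow> integrable (gaussian D) (\<lambda>z :: real^'q. norm z powr r)"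
    "\<And>D. 0 < D \<Longrightarrow> (\<integral>z. norm (z :: real^'q) powr r \<partial>gaussian D) \<le> c * D powr (r / 2)"
proof
  \<comment> \<open>With \<open>y = |x| / sqrt D\<close>, the factor \<open>exp (r^2)\<close> comes
    from \<open>r * ln y \<le> r * y \<le> r^2 + y^2 / 4\<close>, and the power of
    \<open>sqrt 2\<close> is the quotient of the normalising constants for the variances
    \<open>D\<close> and \<open>2 * D\<close>.\<close>
  let ?c = "exp (r\<^sup>2) * sqrt 2 ^ CARD('q)"
  show "0 \<le> ?c" by simp
  fix D :: real assume D: "0 < D"
  let ?f = "\<lambda>D. \<lambda>x :: real^'q. \<Prod>i\<in>UNIV. normal_density 0 (sqrt D) (x $ i)"
  have key: "?f D x * norm x powr r \<le> ?c * D powr (r / 2) * ?f (2 * D) x" for x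
  proof -
    define y where "y = norm x / sqrt D"
    have nx: "norm x = sqrt D * y" using D by (simp add: y_def)
    have y0: "0 \<le> y" using D by (simp add: y_def)
    have "y powr r \<le> exp (r\<^sup>2) * exp (y\<^sup>2 / 4)"
    proof (cases "y = 0")
      case False
      then have "y > 0" using y0 by simp
      have "r * ln y \<le> r * y" using ln_bound[OF \<open>y > 0\<close>] assms by (intro mult_left_mono) auto
      also have "\<dots> \<le> r\<^sup>2 + y\<^sup>2 / 4"
        using zero_le_power2[of "r - y / 2"] by (simp add: power2_eq_square algebra_simps)
      finally show ?thesis using \<open>y > 0\<close> by (simp add: powr_def flip: exp_add)
    qed simp
    then have "norm x powr r \<le> D powr (r / 2) * (exp (r\<^sup>2) * exp (y\<^sup>2 / 4))"
      using D y0 unfolding nx by (simp add: powr_mult powr_half_sqrt[symmetric] powr_powr mult_left_mono)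
    then have "?f D x * norm x powr r \<le> ?f D x * (D powr (r / 2) * (exp (r\<^sup>2) * exp (y\<^sup>2 / 4)))"
      by (intro mult_left_mono prod_nonneg) auto
    also have "?f D x * exp (y\<^sup>2 / 4) = sqrt 2 ^ CARD('q) * ?f (2 * D) x"
    proof -
      have y2: "y\<^sup>2 = (norm x)\<^sup>2 / D" using D by (simp add: y_def power_divide)
      have "exp (- (norm x)\<^sup>2 / (2 * D)) * exp (y\<^sup>2 / 4) = exp (- (norm x)\<^sup>2 / (2 * (2 * D)))"
        unfolding y2 exp_add[symmetric] using D by (simp add: field_simps)
      moreover have "(1 / sqrt (2 * pi * D)) ^ CARD('q) = sqrt 2 ^ CARD('q) * (1 / sqrt (2 * pi * (2 * D))) ^ CARD('q)"
      proof -
        have "sqrt (2 * pi * (2 * D)) = sqrt 2 * sqrt (2 * pi * D)"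
          using real_sqrt_mult[of 2 "2 * pi * D"] by (simp add: mult_ac)
        then show ?thesis unfolding power_mult_distrib[symmetric] by simp
      qed
      ultimately show ?thesis using D by (simp add: gaussian_density_norm mult.assoc)
    qed
    then have "?f D x * (D powr (r / 2) * (exp (r\<^sup>2) * exp (y\<^sup>2 / 4))) = ?c * D powr (r / 2) * ?f (2 * D) x"
      by (simp add: mult_ac)
    finally show ?thesis .
  qed
  have nn: "0 \<le> ?f D x" for D x by (intro prod_nonneg) auto
  have "(\<integral>\<^sup>+z. ennreal (norm (z :: real^'q) powr r) \<partial>gaussian D) = (\<integral>\<^sup>+z. ennreal (?f D z * norm z powr r) \<partial>lborel)"
    unfolding gaussian_def by (subst nn_integral_density) (auto simp: ennreal_mult nn)
  also have "\<dots> \<le> (\<integral>\<^sup>+z. ennreal (?c * D powr (r / 2) * ?f (2 * D) z) \<partial>lborel)"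
    by (intro nn_integral_mono ennreal_leI key)
  also have "\<dots> = ennreal (?c * D powr (r / 2)) * (\<integral>\<^sup>+z. ennreal (?f (2 * D) z) \<partial>lborel)"
    by (subst nn_integral_cmult[symmetric]) (auto simp: ennreal_mult nn)
  also have "(\<integral>\<^sup>+z. ennreal (?f (2 * D) z) \<partial>lborel) = 1"
    using prob_space.emeasure_space_1[OF prob_space_gaussian[of "2 * D", where 'q = 'q]] D
    by (simp add: gaussian_def emeasure_density)
  finally have le: "(\<integral>\<^sup>+z. ennreal (norm (z :: real^'q) powr r) \<partial>gaussian D) \<le> ennreal (?c * D powr (r / 2))" by simp
  show int: "integrable (gaussian D) (\<lambda>z :: real^'q. norm z powr r)"
    using le by (intro integrableI_bounded) (auto intro: le_less_trans)
  show "(\<integral>z. norm (z :: real^'q) powr r \<partial>gaussian D) \<le> ?c * D powr (r / 2)"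
    using le nn_integral_eq_integral[OF int] by (simp add: ennreal_le_iff)
qed

lemma integrable_gaussian:
  assumes "0 < D"
  shows "integrable (gaussian D) (\<lambda>z :: real^'q. z)"
proof -
  obtain c where "\<And>D. 0 < D \<Longrightarrow> integrable (gaussian D) (\<lambda>z :: real^'q. norm z powr 1)"
    using gaussian_moment[of 1, where 'q = 'q] by auto
  from this[OF assms] show ?thesis by (rule Bochner_Integration.integrable_bound) auto
qed

text \<open>The law is invariant under \<open>z \<mapsto> - z\<close>, so the integral equals its
  own negative.\<close>

lemma integral_gaussian_inner:
  assumes "0 < D"
  shows "(\<integral>z. a \<bullet> (z :: real^'q) \<partial>gaussian D) = 0"
proof -
  have "orthogonal_transformation (\<lambda>z :: real^'q. - z)"
    by (auto simp: orthogonal_transformation_def intro!: linearI)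
  from distr_gaussian_orthogonal[OF assms this]
  have "(\<integral>z. a \<bullet> (z :: real^'q) \<partial>gaussian D) = (\<integral>z. a \<bullet> z \<partial>distr (gaussian D) borel (\<lambda>z. - z))" by simp
  also have "\<dots> = (\<integral>z. a \<bullet> - z \<partial>gaussian D)" by (subst integral_distr) auto
  finally show ?thesis by simp
qed

lemma integrable_lipschitz_comp:
  fixes \<phi> :: "'b::euclidean_space \<Rightarrow> real"
  assumes "finite_measure M" "C-lipschitz_on UNIV \<phi>" "integrable M f"
  shows "integrable M (\<lambda>\<omega>. \<phi> (f \<omega>))"
proof -
  interpret finite_measure M by fact
  have m: "\<phi> \<in> borel_measurable borel"
    using lipschitz_on_continuous_on[OF assms(2)] by (rule borel_measurable_continuous_onI)
  show ?thesis
  proof (rule Bochner_Integration.integrable_bound)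
    show "integrable M (\<lambda>\<omega>. \<bar>\<phi> 0\<bar> + C * norm (f \<omega>))" using assms(3) by simp
    show "(\<lambda>\<omega>. \<phi> (f \<omega>)) \<in> borel_measurable M"
      using m borel_measurable_integrable[OF assms(3)] by measurable
    have "\<bar>\<phi> (f \<omega>)\<bar> \<le> \<bar>\<phi> 0\<bar> + C * norm (f \<omega>)" for \<omega>
      using lipschitz_onD[OF assms(2), of "f \<omega>" 0] by (simp add: dist_real_def)
    then show "AE \<omega> in M. norm (\<phi> (f \<omega>)) \<le> norm (\<bar>\<phi> 0\<bar> + C * norm (f \<omega>))"
      by (auto intro!: AE_I2 order_trans[OF _ abs_ge_self])
  qed
qed

lemma integrable_gaussian_lipschitz:
  fixes A :: "real^'q^'d"
  assumes "0 < D" "C-lipschitz_on UNIV \<phi>"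
  shows "integrable (gaussian D) (\<lambda>z. \<phi> (x + A *v z) :: real)"
proof (rule integrable_lipschitz_comp[OF _ assms(2)])
  interpret prob_space "gaussian D :: (real^'q) measure" using assms(1) by (rule prob_space_gaussian)
  show "finite_measure (gaussian D :: (real^'q) measure)" by unfold_locales
  show "integrable (gaussian D) (\<lambda>z. x + A *v z)"
    by (intro Bochner_Integration.integrable_add integrable_const
       integrable_bounded_linear[OF matrix_vector_mul_bounded_linear integrable_gaussian[OF assms(1)]])
qed

text \<open>\<open>F\<close> is convex in the right factor and takes the same value, the right-hand
  side, at all orthogonal matrices. On their hull, which contains the contraction \<open>K\<close>,
  a convex function does not exceed its bound on the generating set. The Lipschitz condition
  provides integrability.\<close>

lemma gaussian_convex_mono:
  fixes A B :: "real^'q^'d"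
  assumes D: "0 < D" and le: "A \<preceq>m B" and conv: "convex_on UNIV \<phi>" and lip: "C-lipschitz_on UNIV \<phi>"
  shows "(\<integral>z. \<phi> (x + A *v z) \<partial>gaussian D) \<le> (\<integral>z. \<phi> (x + B *v z) \<partial>gaussian D)"
proof -
  obtain K :: "real^'q^'q" where K: "A = B ** K" "\<And>x. norm (K *v x) \<le> norm x"
    by (rule matrix_preceq_factor[OF le]) blast
  define F where "F = (\<lambda>K :: real^'q^'q. \<integral>z. \<phi> (x + (B ** K) *v z) \<partial>gaussian D)"
  let ?O = "{U :: real^'q^'q. orthogonal_transformation ((*v) U)}"
  have int: "integrable (gaussian D) (\<lambda>z. \<phi> (x + (B ** K) *v z))" for K
    by (rule integrable_gaussian_lipschitz[OF D lip])
  have cF: "convex_on (convex hull ?O) F"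
    unfolding convex_on_def
  proof (intro conjI ballI allI impI convex_convex_hull)
    fix U V :: "real^'q^'q" and u v :: real assume uv: "0 \<le> u" "0 \<le> v" "u + v = 1"
    have "F (u *\<^sub>R U + v *\<^sub>R V) \<le> (\<integral>z. u * \<phi> (x + (B ** U) *v z) + v * \<phi> (x + (B ** V) *v z) \<partial>gaussian D)"
      unfolding F_def
    proof (intro integral_mono int Bochner_Integration.integrable_add integrable_mult_right)
      fix z :: "real^'q"
      have "x + (B ** (u *\<^sub>R U + v *\<^sub>R V)) *v z = u *\<^sub>R (x + (B ** U) *v z) + v *\<^sub>R (x + (B ** V) *v z)"
      proof -
        have "x = u *\<^sub>R x + v *\<^sub>R x" using uv by (simp flip: scaleR_add_left)
        then show ?thesis
          by (simp add: scaleR_add_right matrix_vector_mult_add_rdistrib matrix_vector_right_distrib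
            matrix_vector_mult_scaleR algebra_simps flip: matrix_vector_mul_assoc scaleR_matrix_vector_assoc)
      qed
      then show "\<phi> (x + (B ** (u *\<^sub>R U + v *\<^sub>R V)) *v z) \<le> u * \<phi> (x + (B ** U) *v z) + v * \<phi> (x + (B ** V) *v z)"
        using conv uv by (simp add: convex_on_def)
    qed
    then show "F (u *\<^sub>R U + v *\<^sub>R V) \<le> u * F U + v * F V"
      by (simp add: F_def int)
  qed
  have FO: "F U = (\<integral>z. \<phi> (x + B *v z) \<partial>gaussian D)" if "U \<in> ?O" for U
  proof -
    have m: "\<phi> \<in> borel_measurable borel"
      using lipschitz_on_continuous_on[OF lip] by (rule borel_measurable_continuous_onI)
    have [measurable]: "(\<lambda>z. \<phi> (x + B *v z)) \<in> borel_measurable borel" "(\<lambda>z. U *v z) \<in> borel_measurable borel"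
      by (intro measurable_compose[OF _ m] borel_measurable_continuous_onI continuous_intros linear_continuous_on; simp)+
    have "(\<integral>z. \<phi> (x + B *v z) \<partial>gaussian D) = (\<integral>z. \<phi> (x + B *v z) \<partial>distr (gaussian D) borel ((*v) U))"
      by (subst distr_gaussian_orthogonal[OF D]) (use that in auto)
    also have "\<dots> = (\<integral>z. \<phi> (x + B *v (U *v z)) \<partial>gaussian D)" by (subst integral_distr) auto
    finally show ?thesis by (simp add: F_def matrix_vector_mul_assoc)
  qed
  have "F K \<le> (\<integral>z. \<phi> (x + B *v z) \<partial>gaussian D)"
    using convex_on_convex_hull_bound[OF cF, of "\<integral>z. \<phi> (x + B *v z) \<partial>gaussian D"]
      contraction_in_hull_orthogonal[OF K(2)] FO by force
  then show ?thesis by (simp add: F_def K(1))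
qed

section \<open>Convex order\<close>

text \<open>A hyperplane separates the closed epigraph from the point
  \<open>(x0, \<phi> x0 - \<epsilon>)\<close>. The point of the graph above it lies on the other
  side, so the hyperplane is not vertical and is the graph of an affine function. Giving away
  \<open>\<epsilon>\<close> makes the point lie off the epigraph, where strict separation is
  possible.\<close>

lemma convex_on_affine_minorant:
  fixes \<phi> :: "'a::euclidean_space \<Rightarrow> real"
  assumes conv: "convex_on UNIV \<phi>" and "0 < \<epsilon>"
  obtains a c where "\<And>x. a \<bullet> x + c \<le> \<phi> x" "\<phi> x0 - \<epsilon> < a \<bullet> x0 + c"
proof -
  have cont: "continuous_on UNIV \<phi>" using conv by (intro convex_on_continuous) auto
  have cont': "continuous_on UNIV (\<lambda>z :: 'a \<times> real. \<phi> (fst z))"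
    by (rule continuous_on_compose2[OF cont continuous_on_fst]) (auto intro: continuous_on_id)
  have "epigraph UNIV \<phi> = {z. \<phi> (fst z) \<le> snd z}" by (auto simp: epigraph_def)
  then have "closed (epigraph UNIV \<phi>)" using cont' by (auto intro!: closed_Collect_le continuous_intros)
  moreover have "(x0, \<phi> x0 - \<epsilon>) \<notin> epigraph UNIV \<phi>" using assms by (simp add: epigraph_def)
  ultimately obtain w \<beta> where w: "w \<bullet> (x0, \<phi> x0 - \<epsilon>) < \<beta>" "\<And>z. z \<in> epigraph UNIV \<phi> \<Longrightarrow> \<beta> < w \<bullet> z"
    using separating_hyperplane_closed_point[OF convex_epigraphI[OF conv]] by metis
  obtain a s where as: "w = (a, s)" by (cases w)
  have sep: "\<beta> < a \<bullet> x + s * \<phi> x" for x using w(2)[of "(x, \<phi> x)"] by (simp add: as epigraph_def)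
  have x0: "a \<bullet> x0 + s * (\<phi> x0 - \<epsilon>) < \<beta>" using w(1) by (simp add: as)
  have "0 < s * \<epsilon>" using sep[of x0] x0 by (simp add: algebra_simps)
  then have s: "0 < s" using assms by (simp add: zero_less_mult_iff)
  show thesis
  proof
    show "(- 1 / s) *\<^sub>R a \<bullet> x + \<beta> / s \<le> \<phi> x" for x using sep[of x] s by (simp add: field_simps)
    show "\<phi> x0 - \<epsilon> < (- 1 / s) *\<^sub>R a \<bullet> x0 + \<beta> / s" using x0 s by (simp add: field_simps)
  qed
qed

text \<open>Maxima of finitely many affine minorants are convex, increase with their number, and
  have the sum of the slopes as a Lipschitz constant. A countable family of minorants nearly touches
  \<open>\<phi>\<close> on a dense set; at other points convergence is derived by an argument that
  does not involve the slopes.\<close>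

lemma convex_on_lipschitz_approx:
  fixes \<phi> :: "'a::euclidean_space \<Rightarrow> real"
  assumes conv: "convex_on UNIV \<phi>"
  obtains f :: "nat \<Rightarrow> 'a \<Rightarrow> real" and C :: "nat \<Rightarrow> real"
  where "\<And>n. convex_on UNIV (f n)" "\<And>n. (C n)-lipschitz_on UNIV (f n)"
    "\<And>x. incseq (\<lambda>n. f n x)" "\<And>x. (\<lambda>n. f n x) \<longlonglongrightarrow> \<phi> x"
proof -
  have cont: "continuous_on UNIV \<phi>" using conv by (intro convex_on_continuous) auto
  obtain D :: "'a set" where D: "countable D" "\<And>X. open X \<Longrightarrow> X \<noteq> {} \<Longrightarrow> \<exists>d\<in>D. d \<in> X"
    using countable_dense_exists by blast
  have "D \<noteq> {}" using D(2)[of UNIV] by auto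
  \<comment> \<open>An index \<open>i\<close> will encode a point of the dense set together with a
    tolerance \<open>1 / Suc m\<close>, so that every pair occurs.\<close>
  define e where "e = from_nat_into D"
  have "\<forall>i. \<exists>a c. (\<forall>x. a \<bullet> x + c \<le> \<phi> x) \<and>
      \<phi> (e (fst (prod_decode i))) - 1 / Suc (snd (prod_decode i)) < a \<bullet> e (fst (prod_decode i)) + c"
  proof
    fix i
    show "\<exists>a c. (\<forall>x. a \<bullet> x + c \<le> \<phi> x) \<and>
      \<phi> (e (fst (prod_decode i))) - 1 / Suc (snd (prod_decode i)) < a \<bullet> e (fst (prod_decode i)) + c"
      by (rule convex_on_affine_minorant[OF conv, of "1 / Suc (snd (prod_decode i))" "e (fst (prod_decode i))"]) auto
  qed
  then obtain a c where ac: "\<And>i x. a i \<bullet> x + c i \<le> \<phi> x"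
    "\<And>i. \<phi> (e (fst (prod_decode i))) - 1 / Suc (snd (prod_decode i)) < a i \<bullet> e (fst (prod_decode i)) + c i"
    by metis
  define l where "l = (\<lambda>i x. a i \<bullet> x + c i)"
  define f where "f = (\<lambda>n x. Max ((\<lambda>i. l i x) ` {..n}))"
  have lf: "l i x \<le> f n x" if "i \<le> n" for i n x using that by (auto simp: f_def)
  have fle: "f n x \<le> z" if "\<And>i. i \<le> n \<Longrightarrow> l i x \<le> z" for n x z using that by (auto simp: f_def)
  show thesis
  proof
    show "convex_on UNIV (f n)" for n
      unfolding convex_on_def
    proof (intro conjI ballI allI impI convex_UNIV)
      fix x y :: 'a and u v :: real assume uv: "0 \<le> u" "0 \<le> v" "u + v = 1"
      show "f n (u *\<^sub>R x + v *\<^sub>R y) \<le> u * f n x + v * f n y"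
      proof (rule fle)
        fix i assume i: "i \<le> n"
        have "l i (u *\<^sub>R x + v *\<^sub>R y) = u * l i x + v * l i y"
        proof -
          have "u * c i + v * c i = c i" using uv by (simp flip: distrib_right)
          then show ?thesis unfolding l_def inner_add_right inner_scaleR_right distrib_left by linarith
        qed
        also have "\<dots> \<le> u * f n x + v * f n y" using uv lf[OF i] by (intro add_mono mult_left_mono)
        finally show "l i (u *\<^sub>R x + v *\<^sub>R y) \<le> u * f n x + v * f n y" .
      qed
    qed
    show "(\<Sum>i\<le>n. norm (a i))-lipschitz_on UNIV (f n)" for n
    proof (rule lipschitz_onI)
      let ?C = "\<Sum>i\<le>n. norm (a i)"
      have le: "f n x \<le> f n y + ?C * dist x y" for x y
      proof (rule fle)
        fix i assume i: "i \<le> n"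
        have "l i x = l i y + a i \<bullet> (x - y)" by (simp add: l_def inner_diff_right)
        also have "\<dots> \<le> f n y + norm (a i) * norm (x - y)"
          using lf[OF i] norm_cauchy_schwarz by (intro add_mono)
        also have "\<dots> \<le> f n y + ?C * dist x y"
          unfolding dist_norm using i
          by (intro add_mono mult_right_mono member_le_sum) auto
        finally show "l i x \<le> f n y + ?C * dist x y" .
      qed
      show "dist (f n x) (f n y) \<le> ?C * dist x y" for x y
        using le[of x y] le[of y x] by (simp add: dist_real_def dist_commute abs_le_iff)
    qed (simp add: sum_nonneg)
    show inc: "incseq (\<lambda>n. f n x)" for x
      by (rule incseq_SucI) (auto intro!: fle lf)
    have f_le: "f n x \<le> \<phi> x" for n x using ac by (intro fle) (simp add: l_def)
    show "(\<lambda>n. f n x) \<longlonglongrightarrow> \<phi> x" for x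
    proof (rule LIMSEQ_I)
      fix r :: real assume r: "0 < r"
      \<comment> \<open>Reflection at \<open>d\<close>: an affine minorant satisfies
        \<open>l i x = 2 * l i d - l i (2 d - x)\<close>, which is at least
        \<open>2 * l i d - \<phi> (2 d - x)\<close> whatever its slope. By continuity of
        \<open>\<phi>\<close> this is close to \<open>\<phi> x\<close> for \<open>d\<close> near
        \<open>x\<close>. Half of \<open>r\<close> is spent here; the tolerance at \<open>d\<close>
        counts twice and hence has to be below \<open>r / 4\<close>.\<close>
      let ?X = "{y. \<phi> x - r / 2 < 2 * \<phi> y - \<phi> (2 *\<^sub>R y - x)}"
      have "continuous_on UNIV (\<lambda>y. \<phi> (2 *\<^sub>R y - x))"
        by (rule continuous_on_compose2[OF cont]) (auto intro!: continuous_intros)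
      then have "open ?X" using cont by (intro open_Collect_less continuous_intros)
      moreover have "x \<in> ?X" using r by (simp add: scaleR_2)
      ultimately obtain d where d: "d \<in> D" "d \<in> ?X" using D(2) by blast
      obtain k where k: "e k = d" using from_nat_into_surj[OF D(1) d(1)] by (auto simp: e_def)
      obtain m where m: "1 / real (Suc m) < r / 4" using reals_Archimedean[of "r / 4"] r
        by (auto simp: inverse_eq_divide)
      define i where "i = prod_encode (k, m)"
      have li: "\<phi> d - 1 / Suc m < l i d" using ac(2)[of i] by (simp add: i_def k l_def)
      have "2 * l i d - l i x = l i (2 *\<^sub>R d - x)" by (simp add: l_def inner_diff_right)
      also have "\<dots> \<le> \<phi> (2 *\<^sub>R d - x)" using ac(1) by (simp add: l_def)
      finally have "\<phi> x - r < l i x" using li d m by simp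
      then show "\<exists>no. \<forall>n\<ge>no. norm (f n x - \<phi> x) < r"
      proof (intro exI[of _ i] allI impI)
        fix n assume "i \<le> n"
        then show "norm (f n x - \<phi> x) < r"
          using lf[of i n x] f_le[of n x] \<open>\<phi> x - r < l i x\<close> by simp
      qed
    qed
  qed
qed

section \<open>Reduction of the convex order to Lipschitz test functions\<close>

lemma prob_distsD:
  assumes "\<mu> \<in> prob_dists 1"
  shows "prob_space \<mu>" "sets \<mu> = sets borel" "integrable \<mu> (\<lambda>x. x)"
proof -
  show *: "prob_space \<mu>" "sets \<mu> = sets borel" using assms by (auto simp: prob_dists_def)
  have "integrable \<mu> (\<lambda>x. norm x powr 1)" using assms by (simp add: prob_dists_def)
  then have "integrable \<mu> (\<lambda>x. norm x)" by simp
  moreover have "(\<lambda>x. x) \<in> borel_measurable \<mu>"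
    unfolding measurable_cong_sets[OF *(2) refl] by simp
  ultimately show "integrable \<mu> (\<lambda>x. x)" by (rule integrable_norm_cancel)
qed

lemma integrable_prob_dists_lipschitz:
  assumes "\<mu> \<in> prob_dists 1" "C-lipschitz_on UNIV \<phi>"
  shows "integrable \<mu> (\<phi> :: 'a::euclidean_space \<Rightarrow> real)"
proof -
  interpret prob_space \<mu> using assms(1) by (rule prob_distsD)
  have "finite_measure \<mu>" by unfold_locales
  then show ?thesis using integrable_lipschitz_comp[OF _ assms(2) prob_distsD(3)[OF assms(1)]] by simp
qed

lemma ext_integral_eq_integral:
  assumes "integrable \<mu> \<phi>"
  shows "ext_integral \<mu> \<phi> = ereal (\<integral>x. \<phi> x \<partial>\<mu>)"
proof -
  have fin: "(\<integral>\<^sup>+x. ennreal (\<phi> x) \<partial>\<mu>) \<noteq> \<infinity>" "(\<integral>\<^sup>+x. ennreal (- \<phi> x) \<partial>\<mu>) \<noteq> \<infinity>"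
    using assms by (auto simp: real_integrable_def)
  then obtain a b where ab: "(\<integral>\<^sup>+x. ennreal (\<phi> x) \<partial>\<mu>) = ennreal a" "(\<integral>\<^sup>+x. ennreal (- \<phi> x) \<partial>\<mu>) = ennreal b" "0 \<le> a" "0 \<le> b"
    by (metis ennreal_cases infinity_ennreal_def)
  then show ?thesis
    using real_lebesgue_integral_def[OF assms] by (simp add: ext_integral_def)
qed

lemma convex_orderD:
  assumes "\<mu> \<preceq>cv \<nu>" "convex_on UNIV \<phi>" "C-lipschitz_on UNIV \<phi>"
  shows "(\<integral>x. \<phi> x \<partial>\<mu>) \<le> (\<integral>x. \<phi> x \<partial>\<nu>)"
proof -
  have m: "\<mu> \<in> prob_dists 1" "\<nu> \<in> prob_dists 1" using assms(1) by (auto simp: convex_order_def)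
  have "ext_integral \<mu> \<phi> \<le> ext_integral \<nu> \<phi>" using assms by (auto simp: convex_order_def)
  then show ?thesis
    by (simp add: ext_integral_eq_integral integrable_prob_dists_lipschitz[OF _ assms(3)] m)
qed

text \<open>Positive parts converge monotonically, and negative parts are dominated by that of
  \<open>f 0\<close>. The limit of the negative parts is finite, so the difference in the extended
  reals is continuous there.\<close>

lemma tendsto_ext_integral:
  fixes f :: "nat \<Rightarrow> 'a \<Rightarrow> real"
  assumes f: "\<And>n. integrable \<mu> (f n)" and inc: "\<And>x. incseq (\<lambda>n. f n x)" and lim: "\<And>x. (\<lambda>n. f n x) \<longlonglongrightarrow> \<phi> x"
  shows "(\<lambda>n. ereal (\<integral>x. f n x \<partial>\<mu>)) \<longlonglongrightarrow> ext_integral \<mu> \<phi>"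
proof -
  have [measurable]: "f n \<in> borel_measurable \<mu>" for n using f by auto
  have [measurable]: "\<phi> \<in> borel_measurable \<mu>" by (rule borel_measurable_LIMSEQ_real[OF lim]) simp
  have le: "f n x \<le> \<phi> x" for n x using incseq_le[OF inc lim] .
  have "(\<lambda>n. \<integral>\<^sup>+x. ennreal (f n x) \<partial>\<mu>) \<longlonglongrightarrow> (\<integral>\<^sup>+x. ennreal (\<phi> x) \<partial>\<mu>)"
  proof (rule nn_integral_LIMSEQ)
    show "incseq (\<lambda>n x. ennreal (f n x))" using inc by (auto simp: incseq_def le_fun_def intro: ennreal_leI)
    show "(\<lambda>n. ennreal (f n x)) \<longlonglongrightarrow> ennreal (\<phi> x)" for x by (intro tendsto_ennrealI lim)
  qed simp
  moreover have "(\<lambda>n. \<integral>\<^sup>+x. ennreal (- f n x) \<partial>\<mu>) \<longlonglongrightarrow> (\<integral>\<^sup>+x. ennreal (- \<phi> x) \<partial>\<mu>)"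
  proof (rule nn_integral_dominated_convergence[where w = "\<lambda>x. ennreal (- f 0 x)"])
    show "(\<integral>\<^sup>+x. ennreal (- f 0 x) \<partial>\<mu>) < \<infinity>"
      using f[of 0] by (auto simp: real_integrable_def top.not_eq_extremum)
    show "AE x in \<mu>. (\<lambda>n. ennreal (- f n x)) \<longlonglongrightarrow> ennreal (- \<phi> x)"
      by (intro AE_I2 tendsto_ennrealI tendsto_minus lim)
    show "AE x in \<mu>. ennreal (- f n x) \<le> ennreal (- f 0 x)" for n
      using inc by (auto simp: incseq_def intro!: AE_I2 ennreal_leI)
  qed simp_all
  moreover have "(\<integral>\<^sup>+x. ennreal (- \<phi> x) \<partial>\<mu>) \<noteq> \<infinity>"
  proof -
    have "(\<integral>\<^sup>+x. ennreal (- \<phi> x) \<partial>\<mu>) \<le> (\<integral>\<^sup>+x. ennreal (- f 0 x) \<partial>\<mu>)"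
      using le by (intro nn_integral_mono ennreal_leI) auto
    also have "\<dots> < \<infinity>" using f[of 0] by (auto simp: real_integrable_def top.not_eq_extremum)
    finally show ?thesis by simp
  qed
  ultimately have "(\<lambda>n. enn2ereal (\<integral>\<^sup>+x. ennreal (f n x) \<partial>\<mu>) - enn2ereal (\<integral>\<^sup>+x. ennreal (- f n x) \<partial>\<mu>)) \<longlonglongrightarrow> ext_integral \<mu> \<phi>"
    unfolding ext_integral_def
    by (intro tendsto_diff_ereal_general tendsto_enn2erealI)
      (auto simp: enn2ereal_eq_top_iff)
  then show ?thesis
    using ext_integral_eq_integral[OF f] by (simp add: ext_integral_def)
qed

text \<open>The extended integrals follow the increasing approximation of a convex function by
  Lipschitz convex ones. The latter have finite integrals and are stable under approximation of the
  random variables in \<open>L^p\<close>, so the comparisons are made with them.\<close>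

lemma convex_orderI:
  assumes m: "\<mu> \<in> prob_dists 1" "\<nu> \<in> prob_dists 1"
    and le: "\<And>\<phi> C. convex_on UNIV \<phi> \<Longrightarrow> C-lipschitz_on UNIV \<phi> \<Longrightarrow> (\<integral>x. \<phi> x \<partial>\<mu>) \<le> (\<integral>x. \<phi> x \<partial>\<nu>)"
  shows "\<mu> \<preceq>cv \<nu>"
  unfolding convex_order_def
proof (intro conjI allI impI m)
  fix \<phi> :: "'a \<Rightarrow> real" assume "convex_on UNIV \<phi>"
  then obtain f C where f: "\<And>n. convex_on UNIV (f n)" "\<And>n. (C n)-lipschitz_on UNIV (f n)"
    "\<And>x. incseq (\<lambda>n. f n x)" "\<And>x. (\<lambda>n. f n x) \<longlonglongrightarrow> \<phi> x"
    by (rule convex_on_lipschitz_approx) blast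
  have "(\<lambda>n. ereal (\<integral>x. f n x \<partial>\<mu>)) \<longlonglongrightarrow> ext_integral \<mu> \<phi>" "(\<lambda>n. ereal (\<integral>x. f n x \<partial>\<nu>)) \<longlonglongrightarrow> ext_integral \<nu> \<phi>"
    by (intro tendsto_ext_integral integrable_prob_dists_lipschitz[OF _ f(2)] m f)+
  then show "ext_integral \<mu> \<phi> \<le> ext_integral \<nu> \<phi>"
    by (rule LIMSEQ_le) (use le[OF f(1,2)] in auto)
qed

section \<open>Brownian increments\<close>

lemma abs_vector_matrix_component_le:
  fixes A :: "real^'q^'d"
  shows "\<bar>(x v* A) $ i\<bar> \<le> norm x * norm A"
proof -
  have "(x v* A) $ i = (x v* A) \<bullet> axis i 1" by (simp add: inner_axis)
  also have "\<dots> = x \<bullet> (A *v axis i 1)" by (rule dot_lmul_matrix)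
  finally have "\<bar>(x v* A) $ i\<bar> \<le> norm x * norm (A *v axis i 1)" using Cauchy_Schwarz_ineq2 by metis
  also have "\<dots> \<le> norm x * norm A"
    using norm_matrix_vector_mult_le[of A "axis i 1"] by (intro mult_left_mono) (auto simp: norm_axis_1)
  finally show ?thesis .
qed

lemma borel_measurable_matrix_vector_mult [measurable]:
  fixes A :: "'a \<Rightarrow> real^'q^'d"
  assumes [measurable]: "A \<in> borel_measurable M" "z \<in> borel_measurable M"
  shows "(\<lambda>\<omega>. A \<omega> *v z \<omega>) \<in> borel_measurable M"
proof -
  have "bounded_bilinear ((*v) :: real^'q^'d \<Rightarrow> real^'q \<Rightarrow> real^'d)"
    by (rule bounded_bilinear.intro)
      (auto simp: matrix_vector_mult_add_rdistrib matrix_vector_right_distrib scaleR_matrix_vector_assoc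
        matrix_vector_mult_scaleR intro!: exI[of _ 1] norm_matrix_vector_mult_le)
  from bounded_bilinear.continuous_on[OF this continuous_on_fst continuous_on_snd, OF continuous_on_id continuous_on_id, of UNIV]
  have "(\<lambda>x. fst x *v snd x :: real^'d) \<in> borel_measurable (borel :: ((real^'q^'d) \<times> (real^'q)) measure)"
    by (intro borel_measurable_continuous_onI) simp
  then have "(\<lambda>x. fst x *v snd x :: real^'d) \<in> borel_measurable (borel \<Otimes>\<^sub>M borel :: ((real^'q^'d) \<times> (real^'q)) measure)"
    by (simp add: borel_prod)
  from measurable_compose[OF measurable_Pair[OF assms] this] show ?thesis by simp
qed

lemma integrable_if_bounded:
  fixes f g :: "'a \<Rightarrow> real"
  assumes "f \<in> borel_measurable M" "integrable M g" "\<And>\<omega>. \<bar>f \<omega>\<bar> \<le> g \<omega>"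
  shows "integrable M f"
  by (rule Bochner_Integration.integrable_bound[OF assms(2,1)])
     (use assms(3) in \<open>auto intro!: AE_I2 order_trans[OF _ abs_ge_self]\<close>)

lemma integrable_add_powr:
  fixes f g :: "'a \<Rightarrow> 'v::euclidean_space"
  assumes p: "0 \<le> p" and [measurable]: "f \<in> borel_measurable M" "g \<in> borel_measurable M"
    and int: "integrable M (\<lambda>\<omega>. norm (f \<omega>) powr p)" "integrable M (\<lambda>\<omega>. norm (g \<omega>) powr p)"
  shows "integrable M (\<lambda>\<omega>. norm (f \<omega> + g \<omega>) powr p)" "integrable M (\<lambda>\<omega>. norm (f \<omega> - g \<omega>) powr p)"
proof -
  have i: "integrable M (\<lambda>\<omega>. 2 powr p * (norm (f \<omega>) powr p + norm (g \<omega>) powr p))" using int by simp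
  show "integrable M (\<lambda>\<omega>. norm (f \<omega> + g \<omega>) powr p)"
    by (rule integrable_if_bounded[OF _ i]) (auto intro: norm_add_powr_le[OF p])
  show "integrable M (\<lambda>\<omega>. norm (f \<omega> - g \<omega>) powr p)"
    by (rule integrable_if_bounded[OF _ i]) (auto intro: norm_diff_powr_le[OF p])
qed

locale brownian_filtration = prob_space M for M :: "'a measure" +
  fixes F :: "real \<Rightarrow> 'a measure" and B :: "real \<Rightarrow> 'a \<Rightarrow> real^'q"
  assumes usual: "usual_filtration M F" and bm: "brownian_motion M F B"
begin

lemma subalgebra_F: "0 \<le> t \<Longrightarrow> subalgebra M (F t)"
  and subalgebra_F_mono: "0 \<le> s \<Longrightarrow> s \<le> t \<Longrightarrow> subalgebra (F t) (F s)"
  using usual by (auto simp: usual_filtration_def)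

lemma space_F: "0 \<le> t \<Longrightarrow> space (F t) = space M"
  using subalgebra_F by (auto simp: subalgebra_def)

lemma measurable_F: "0 \<le> t \<Longrightarrow> f \<in> measurable (F t) N \<Longrightarrow> f \<in> measurable M N"
  by (rule measurable_from_subalg[OF subalgebra_F])

lemma measurable_F_mono: "0 \<le> s \<Longrightarrow> s \<le> t \<Longrightarrow> f \<in> measurable (F s) N \<Longrightarrow> f \<in> measurable (F t) N"
  by (rule measurable_from_subalg[OF subalgebra_F_mono])

lemma B_measurable_F: "0 \<le> s \<Longrightarrow> s \<le> t \<Longrightarrow> B s \<in> borel_measurable (F t)"
  using bm by (intro measurable_F_mono[of s t]) (auto simp: brownian_motion_def)

lemma B_measurable: "0 \<le> t \<Longrightarrow> B t \<in> borel_measurable M"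
  by (rule measurable_F[OF _ B_measurable_F]) auto

lemma increment_measurable:
  assumes "0 \<le> s" "s \<le> t" shows "(\<lambda>\<omega>. B t \<omega> - B s \<omega>) \<in> borel_measurable M"
  using B_measurable[of s] B_measurable[of t] assms by simp

lemma distr_increment:
  assumes "0 \<le> s" "s < t"
  shows "distr M borel (\<lambda>\<omega>. B t \<omega> - B s \<omega>) = gaussian (t - s)"
proof -
  have "distributed M lborel (\<lambda>\<omega>. B t \<omega> - B s \<omega>)
          (\<lambda>x. ennreal (\<Prod>i\<in>UNIV. normal_density 0 (sqrt (t - s)) (x $ i)))"
    using bm assms by (auto simp: brownian_motion_def)
  then have "distr M lborel (\<lambda>\<omega>. B t \<omega> - B s \<omega>) = gaussian (t - s)"
    by (simp add: distributed_distr_eq_density gaussian_def)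
  moreover have "distr M lborel (\<lambda>\<omega>. B t \<omega> - B s \<omega>) = distr M borel (\<lambda>\<omega>. B t \<omega> - B s \<omega>)"
    by (rule distr_cong) auto
  ultimately show ?thesis by simp
qed

lemma indep_increment_sets:
  assumes st: "0 \<le> s" "s < t"
  shows "indep_set (sets (F s)) (sets (vimage_algebra (space M) (\<lambda>\<omega>. B t \<omega> - B s \<omega>) borel))"
  using bm st by (auto simp: brownian_motion_def)

text \<open>On rectangles the probability factorizes by independence of \<open>F s\<close> and the
  increment, and rectangles determine the measure. In this form conditioning on the present becomes
  Fubini's theorem.\<close>

lemma distr_Pair_increment:
  assumes st: "0 \<le> s" "s < t" and U: "U \<in> measurable (F s) N"
  shows "distr M (N \<Otimes>\<^sub>M borel) (\<lambda>\<omega>. (U \<omega>, B t \<omega> - B s \<omega>)) = distr M N U \<Otimes>\<^sub>M gaussian (t - s)"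
proof -
  let ?Z = "\<lambda>\<omega>. B t \<omega> - B s \<omega>"
  have Um[measurable]: "U \<in> measurable M N" by (rule measurable_F[OF st(1) U])
  have Z[measurable]: "?Z \<in> borel_measurable M" using increment_measurable[of s t] st by simp
  interpret U: prob_space "distr M N U" by (rule prob_space_distr) simp
  interpret G: prob_space "gaussian (t - s) :: (real^'q) measure" using st by (intro prob_space_gaussian) simp
  have "distr M N U \<Otimes>\<^sub>M gaussian (t - s) = distr M (N \<Otimes>\<^sub>M borel) (\<lambda>\<omega>. (U \<omega>, ?Z \<omega>))"
  proof (rule pair_measure_eqI)
    show "sigma_finite_measure (distr M N U)" "sigma_finite_measure (gaussian (t - s) :: (real^'q) measure)"
      by unfold_locales
    show "sets (distr M N U \<Otimes>\<^sub>M gaussian (t - s)) = sets (distr M (N \<Otimes>\<^sub>M borel) (\<lambda>\<omega>. (U \<omega>, ?Z \<omega>)))"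
      by (simp cong: sets_pair_measure_cong)
    fix A C assume "A \<in> sets (distr M N U)" "C \<in> sets (gaussian (t - s) :: (real^'q) measure)"
    then have A[measurable]: "A \<in> sets N" and C[measurable]: "C \<in> sets borel" by auto
    have "U -` A \<inter> space M \<in> sets (F s)" using measurable_sets[OF U A] space_F[OF st(1)] by simp
    moreover have "?Z -` C \<inter> space M \<in> sets (vimage_algebra (space M) ?Z borel)"
      using C by (rule in_vimage_algebra)
    ultimately have "prob ((U -` A \<inter> space M) \<inter> (?Z -` C \<inter> space M)) = prob (U -` A \<inter> space M) * prob (?Z -` C \<inter> space M)"
      by (rule indep_setD[OF indep_increment_sets[OF st]])
    then have "emeasure M ((U -` A \<inter> space M) \<inter> (?Z -` C \<inter> space M)) = emeasure M (U -` A \<inter> space M) * emeasure M (?Z -` C \<inter> space M)"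
      by (simp add: emeasure_eq_measure ennreal_mult)
    moreover have "(\<lambda>\<omega>. (U \<omega>, ?Z \<omega>)) -` (A \<times> C) \<inter> space M = (U -` A \<inter> space M) \<inter> (?Z -` C \<inter> space M)"
      by auto
    ultimately show "emeasure (distr M N U) A * emeasure (gaussian (t - s)) C = emeasure (distr M (N \<Otimes>\<^sub>M borel) (\<lambda>\<omega>. (U \<omega>, ?Z \<omega>))) (A \<times> C)"
      unfolding distr_increment[OF st, symmetric] by (simp add: emeasure_distr)
  qed
  then show ?thesis ..
qed

lemma increment_mult:
  fixes f :: "'a \<Rightarrow> real"
  assumes st: "0 \<le> s" "s < t" and f: "f \<in> borel_measurable (F s)" "integrable M f"
    and g: "integrable (gaussian (t - s)) g"
  shows "integrable M (\<lambda>\<omega>. f \<omega> * g (B t \<omega> - B s \<omega>))"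
    and "(\<integral>\<omega>. f \<omega> * g (B t \<omega> - B s \<omega>) \<partial>M) = (\<integral>\<omega>. f \<omega> \<partial>M) * (\<integral>z. g z \<partial>gaussian (t - s))"
proof -
  let ?Z = "\<lambda>\<omega>. B t \<omega> - B s \<omega>"
  have gm: "g \<in> borel_measurable borel" using borel_measurable_integrable[OF g] by simp
  have Z: "?Z \<in> borel_measurable M" using increment_measurable[of s t] st by simp
  have gZ: "integrable M (\<lambda>\<omega>. g (?Z \<omega>))" "(\<integral>\<omega>. g (?Z \<omega>) \<partial>M) = (\<integral>z. g z \<partial>gaussian (t - s))"
    using g integrable_distr_eq[OF Z gm] integral_distr[OF Z gm] by (simp_all add: distr_increment[OF st])
  let ?V = "vimage_algebra (space M) ?Z borel"
  have gV: "(\<lambda>\<omega>. g (?Z \<omega>)) \<in> borel_measurable ?V"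
    by (rule measurable_compose[OF measurable_vimage_algebra1 gm]) auto
  have sub1: "sigma_sets (space M) {f -` A \<inter> space M |A. A \<in> sets borel} \<subseteq> sets (F s)"
    using sets.sigma_sets_subset[of "{f -` A \<inter> space M |A. A \<in> sets borel}" "F s"]
      measurable_sets[OF f(1)] space_F[OF st(1)] by auto
  have sub2: "sigma_sets (space M) {(\<lambda>\<omega>. g (?Z \<omega>)) -` A \<inter> space M |A. A \<in> sets borel} \<subseteq> sets ?V"
    using sets.sigma_sets_subset[of "{(\<lambda>\<omega>. g (?Z \<omega>)) -` A \<inter> space M |A. A \<in> sets borel}" ?V]
      measurable_sets[OF gV] by auto
  have "indep_set (sigma_sets (space M) {f -` A \<inter> space M |A. A \<in> sets borel})
      (sigma_sets (space M) {(\<lambda>\<omega>. g (?Z \<omega>)) -` A \<inter> space M |A. A \<in> sets borel})"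
    using indep_increment_sets[OF st] sub1 sub2 unfolding indep_sets2_eq by (meson subset_iff)
  then have "indep_var borel f borel (\<lambda>\<omega>. g (?Z \<omega>))"
    unfolding indep_var_eq using measurable_F[OF st(1) f(1)] borel_measurable_integrable[OF gZ(1)] by blast
  from indep_var_integrable[OF this f(2) gZ(1)] indep_var_lebesgue_integral[OF this f(2) gZ(1)]
  show "integrable M (\<lambda>\<omega>. f \<omega> * g (?Z \<omega>))"
    "(\<integral>\<omega>. f \<omega> * g (?Z \<omega>) \<partial>M) = (\<integral>\<omega>. f \<omega> \<partial>M) * (\<integral>z. g z \<partial>gaussian (t - s))"
    by (simp_all add: gZ)
qed

text \<open>The martingale property, in the form that removes the first order term of
  \<open>|m + v|^p\<close>. Coordinatewise the integrand is an \<open>F s\<close>-measurable factor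
  times a centred coordinate of the independent increment; Young's inequality with exponents
  \<open>p - 1\<close> and 1 makes the factor integrable.\<close>

lemma increment_orthogonal:
  fixes m :: "'a \<Rightarrow> real^'d" and G :: "'a \<Rightarrow> real^'q^'d"
  assumes p: "2 \<le> p" and st: "0 \<le> s" "s < t"
    and [measurable]: "m \<in> borel_measurable (F s)" "G \<in> borel_measurable (F s)"
    and int: "integrable M (\<lambda>\<omega>. norm (m \<omega>) powr p)" "integrable M (\<lambda>\<omega>. norm (G \<omega>) powr p)"
  shows "integrable M (\<lambda>\<omega>. norm (m \<omega>) powr (p - 2) * (m \<omega> \<bullet> (G \<omega> *v (B t \<omega> - B s \<omega>))))" (is "integrable M ?h")
    and "(\<integral>\<omega>. norm (m \<omega>) powr (p - 2) * (m \<omega> \<bullet> (G \<omega> *v (B t \<omega> - B s \<omega>))) \<partial>M) = 0"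
proof -
  let ?f = "\<lambda>i \<omega>. norm (m \<omega>) powr (p - 2) * (m \<omega> v* G \<omega>) $ i"
  have fm: "?f i \<in> borel_measurable (F s)" for i
  proof -
    have "(m \<omega> v* G \<omega>) $ i = m \<omega> \<bullet> (G \<omega> *v axis i 1)" for \<omega>
      by (metis dot_lmul_matrix inner_axis inner_real_def mult.right_neutral)
    then show ?thesis by simp
  qed
  have fb: "\<bar>?f i \<omega>\<bar> \<le> norm (m \<omega>) powr p + norm (G \<omega>) powr p" for i \<omega>
  proof -
    have "\<bar>?f i \<omega>\<bar> \<le> norm (m \<omega>) powr (p - 2) * (norm (m \<omega>) * norm (G \<omega>))"
      by (simp add: abs_mult mult_left_mono abs_vector_matrix_component_le)
    also have "\<dots> = norm (m \<omega>) powr (p - 1) * norm (G \<omega>) powr 1"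
      by (cases "m \<omega> = 0") (auto simp: powr_diff powr_numeral power2_eq_square)
    also have "\<dots> \<le> norm (m \<omega>) powr p + norm (G \<omega>) powr p"
      using powr_mult_le_add_powr[of "norm (m \<omega>)" "norm (G \<omega>)" "p - 1" 1] p by simp
    finally show ?thesis .
  qed
  have fi: "integrable M (?f i)" for i
    by (rule integrable_if_bounded[OF measurable_F[OF st(1) fm] Bochner_Integration.integrable_add[OF int] fb])
  have gi: "integrable (gaussian (t - s)) (\<lambda>z :: real^'q. z $ i)" for i
  proof (rule Bochner_Integration.integrable_bound)
    show "integrable (gaussian (t - s)) (\<lambda>z :: real^'q. norm z)"
      using integrable_gaussian[of "t - s"] st by (intro integrable_norm) auto
    show "(\<lambda>z :: real^'q. z $ i) \<in> borel_measurable (gaussian (t - s))"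
      by (simp add: measurable_cong_sets[OF sets_gaussian refl] borel_measurable_continuous_onI continuous_on_component continuous_on_id)
  qed (use component_le_norm_cart in auto)
  have g0: "(\<integral>z. (z :: real^'q) $ i \<partial>gaussian (t - s)) = 0" for i
    using integral_gaussian_inner[of "t - s" "axis i 1"] st by (simp add: inner_axis' )
  have eq: "?h = (\<lambda>\<omega>. \<Sum>i\<in>UNIV. ?f i \<omega> * (B t \<omega> - B s \<omega>) $ i)"
  proof
    fix \<omega>
    have "m \<omega> \<bullet> (G \<omega> *v (B t \<omega> - B s \<omega>)) = (\<Sum>i\<in>UNIV. (m \<omega> v* G \<omega>) $ i * (B t \<omega> - B s \<omega>) $ i)"
      by (subst dot_lmul_matrix[symmetric]) (simp add: inner_vec_def)
    then show "?h \<omega> = (\<Sum>i\<in>UNIV. ?f i \<omega> * (B t \<omega> - B s \<omega>) $ i)"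
      by (simp only: sum_distrib_left mult.assoc)
  qed
  show "integrable M ?h" unfolding eq
    by (intro Bochner_Integration.integrable_sum increment_mult(1)[OF st fm fi gi])
  have "integral\<^sup>L M ?h = (\<Sum>i\<in>UNIV. \<integral>\<omega>. ?f i \<omega> * (B t \<omega> - B s \<omega>) $ i \<partial>M)"
    unfolding eq by (intro Bochner_Integration.integral_sum increment_mult(1)[OF st fm fi gi])
  also have "\<dots> = 0" by (simp only: increment_mult(2)[OF st fm fi gi] g0) simp
  finally show "integral\<^sup>L M ?h = 0" .
qed

end

section \<open>Discretised Ito processes\<close>

lemma partition_mono:
  fixes \<pi> :: "nat \<Rightarrow> real"
  assumes "\<And>j. j < m \<Longrightarrow> \<pi> j \<le> \<pi> (Suc j)" "i \<le> j" "j \<le> m"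
  shows "\<pi> i \<le> \<pi> j"
  using assms(2,3)
proof (induction j rule: dec_induct)
  case (step n)
  then show ?case using assms(1)[of n] by linarith
qed simp

context brownian_filtration
begin

section \<open>Moment bounds for Ito sums\<close>

lemma integrable_increment_powr:
  fixes G :: "'a \<Rightarrow> real^'q^'d"
  assumes p: "0 \<le> p" and st: "0 \<le> s" "s < t" and G: "G \<in> borel_measurable (F s)" "integrable M (\<lambda>\<omega>. norm (G \<omega>) powr p)"
  shows "integrable M (\<lambda>\<omega>. norm (G \<omega> *v (B t \<omega> - B s \<omega>)) powr p)"
proof (rule integrable_if_bounded)
  have "integrable (gaussian (t - s)) (\<lambda>z :: real^'q. norm z powr p)"
    using gaussian_moment[OF p, where 'q = 'q] st by (metis diff_gt_0_iff_gt)
  moreover have "(\<lambda>\<omega>. norm (G \<omega>) powr p) \<in> borel_measurable (F s)" using G(1) by measurable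
  ultimately show "integrable M (\<lambda>\<omega>. norm (G \<omega>) powr p * norm (B t \<omega> - B s \<omega>) powr p)"
    by (intro increment_mult(1)[OF st _ G(2)])
  have [measurable]: "G \<in> borel_measurable M" "(\<lambda>\<omega>. B t \<omega> - B s \<omega>) \<in> borel_measurable M"
    using measurable_F[OF st(1) G(1)] increment_measurable[of s t] st by auto
  show "(\<lambda>\<omega>. norm (G \<omega> *v (B t \<omega> - B s \<omega>)) powr p) \<in> borel_measurable M" by measurable
  fix \<omega>
  have "norm (G \<omega> *v (B t \<omega> - B s \<omega>)) powr p \<le> (norm (G \<omega>) * norm (B t \<omega> - B s \<omega>)) powr p"
    using p by (intro powr_mono2 norm_matrix_vector_mult_le) auto
  then show "\<bar>norm (G \<omega> *v (B t \<omega> - B s \<omega>)) powr p\<bar> \<le> norm (G \<omega>) powr p * norm (B t \<omega> - B s \<omega>) powr p"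
    by (simp add: powr_mult)
qed

lemma integrable_step_powr:
  fixes m \<beta> :: "'a \<Rightarrow> real^'d" and G :: "'a \<Rightarrow> real^'q^'d"
  assumes p: "0 \<le> p" and st: "0 \<le> s" "s \<le> t"
    and m: "m \<in> borel_measurable (F s)" "\<beta> \<in> borel_measurable (F s)" "G \<in> borel_measurable (F s)"
    and int: "integrable M (\<lambda>\<omega>. norm (m \<omega>) powr p)" "integrable M (\<lambda>\<omega>. norm (\<beta> \<omega>) powr p)"
       "integrable M (\<lambda>\<omega>. norm (G \<omega>) powr p)"
  shows "integrable M (\<lambda>\<omega>. norm (m \<omega> + ((t - s) *\<^sub>R \<beta> \<omega> + G \<omega> *v (B t \<omega> - B s \<omega>))) powr p)"
proof -
  have [measurable]: "m \<in> borel_measurable M" "\<beta> \<in> borel_measurable M" "G \<in> borel_measurable M"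
     "(\<lambda>\<omega>. B t \<omega> - B s \<omega>) \<in> borel_measurable M"
    using measurable_F[OF st(1)] m increment_measurable[of s t] st by auto
  have "integrable M (\<lambda>\<omega>. norm (G \<omega> *v (B t \<omega> - B s \<omega>)) powr p)"
  proof (cases "s = t")
    case False
    then show ?thesis using st by (intro integrable_increment_powr p m int) auto
  qed simp
  moreover have "integrable M (\<lambda>\<omega>. norm ((t - s) *\<^sub>R \<beta> \<omega>) powr p)" using int(2) by (simp add: powr_mult)
  ultimately show ?thesis by (intro integrable_add_powr p int) auto
qed

text \<open>Expectation of the pointwise bound \<open>ito_step_bound\<close>. The first order term
  drops out, and by independence the increment \<open>Z\<close> enters through the mean of
  \<open>D + |Z|^2 + |Z|^p\<close>. This is of order \<open>D\<close>, because the two Gaussian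
  moments are of order \<open>D\<close> and \<open>D powr (p / 2)\<close> with
  \<open>p / 2 \<ge> 1\<close>.\<close>

lemma ito_step_moment:
  fixes T p :: real
  assumes p: "2 \<le> p" and T: "0 \<le> T"
  obtains K where "0 \<le> K"
    "\<And>s t (m :: 'a \<Rightarrow> real^'d) \<beta> G. \<lbrakk>0 \<le> s; s \<le> t; t \<le> s + T; m \<in> borel_measurable (F s); \<beta> \<in> borel_measurable (F s);
       G \<in> borel_measurable (F s); integrable M (\<lambda>\<omega>. norm (m \<omega>) powr p);
       integrable M (\<lambda>\<omega>. norm (\<beta> \<omega>) powr p); integrable M (\<lambda>\<omega>. norm (G \<omega>) powr p)\<rbrakk> \<Longrightarrow>
       (\<integral>\<omega>. norm (m \<omega> + ((t - s) *\<^sub>R \<beta> \<omega> + G \<omega> *v (B t \<omega> - B s \<omega>))) powr p \<partial>M)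
       \<le> (1 + K * (t - s)) * (\<integral>\<omega>. norm (m \<omega>) powr p \<partial>M)
         + K * (t - s) * ((\<integral>\<omega>. norm (\<beta> \<omega>) powr p \<partial>M) + (\<integral>\<omega>. norm (G \<omega>) powr p \<partial>M))"
proof -
  obtain K where K: "0 \<le> K"
    "\<And>(m :: real^'d) w y \<beta> g \<zeta> D. \<lbrakk>norm w \<le> D * \<beta>; norm y \<le> g * \<zeta>; 0 \<le> \<beta>; 0 \<le> g; 0 \<le> \<zeta>; 0 \<le> D; D \<le> T\<rbrakk> \<Longrightarrow>
       norm (m + (w + y)) powr p \<le> norm m powr p + p * norm m powr (p - 2) * (m \<bullet> y)
        + K * ((norm m powr p + \<beta> powr p + g powr p) * (D + \<zeta>\<^sup>2 + \<zeta> powr p))"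
    by (rule ito_step_bound[OF p T]) blast
  obtain c2 where c2: "0 \<le> c2" "\<And>D. 0 < D \<Longrightarrow> integrable (gaussian D) (\<lambda>z :: real^'q. norm z powr 2)"
    "\<And>D. 0 < D \<Longrightarrow> (\<integral>z. norm (z :: real^'q) powr 2 \<partial>gaussian D) \<le> c2 * D powr (2 / 2)"
    by (rule gaussian_moment[of 2, where 'q = 'q]) auto
  obtain cp where cp: "0 \<le> cp" "\<And>D. 0 < D \<Longrightarrow> integrable (gaussian D) (\<lambda>z :: real^'q. norm z powr p)"
    "\<And>D. 0 < D \<Longrightarrow> (\<integral>z. norm (z :: real^'q) powr p \<partial>gaussian D) \<le> cp * D powr (p / 2)"
    by (rule gaussian_moment[of p, where 'q = 'q]) (use p in auto)
  \<comment> \<open>The power of \<open>T\<close> is the price for reducing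
    \<open>D powr (p / 2)\<close> to a multiple of \<open>D\<close>.\<close>
  let ?K = "K * (1 + c2 + cp * T powr (p / 2 - 1))"
  show thesis
  proof
    show K0: "0 \<le> ?K" using K(1) c2(1) cp(1) by auto
    fix s t and m \<beta> :: "'a \<Rightarrow> real^'d" and G :: "'a \<Rightarrow> real^'q^'d"
    assume st: "0 \<le> s" "s \<le> t" "t \<le> s + T"
      and m: "m \<in> borel_measurable (F s)" "\<beta> \<in> borel_measurable (F s)" "G \<in> borel_measurable (F s)"
      and int: "integrable M (\<lambda>\<omega>. norm (m \<omega>) powr p)" "integrable M (\<lambda>\<omega>. norm (\<beta> \<omega>) powr p)"
       "integrable M (\<lambda>\<omega>. norm (G \<omega>) powr p)"
    let ?e = "\<lambda>f. (\<integral>\<omega>. norm (f \<omega>) powr p \<partial>M)"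
    have e0: "0 \<le> ?e m" "0 \<le> ?e \<beta>" "0 \<le> (\<integral>\<omega>. norm (G \<omega>) powr p \<partial>M)" by (simp_all add: integral_nonneg_AE)
    show "(\<integral>\<omega>. norm (m \<omega> + ((t - s) *\<^sub>R \<beta> \<omega> + G \<omega> *v (B t \<omega> - B s \<omega>))) powr p \<partial>M)
       \<le> (1 + ?K * (t - s)) * ?e m + ?K * (t - s) * (?e \<beta> + (\<integral>\<omega>. norm (G \<omega>) powr p \<partial>M))"
    proof (cases "s = t")
      case False
      then have lt: "s < t" using st by simp
      define D where "D = t - s"
      have D: "0 < D" "D \<le> T" using lt st by (auto simp: D_def)
      let ?Z = "\<lambda>\<omega>. B t \<omega> - B s \<omega>"
      let ?S = "\<lambda>\<omega>. norm (m \<omega>) powr p + norm (\<beta> \<omega>) powr p + norm (G \<omega>) powr p"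
      let ?g = "\<lambda>z :: real^'q. D + norm z powr 2 + norm z powr p"
      have Sm: "?S \<in> borel_measurable (F s)" using m by measurable
      have Si: "integrable M ?S" using int by simp
      interpret G: prob_space "gaussian D :: (real^'q) measure" using D by (intro prob_space_gaussian) simp
      have gi: "integrable (gaussian D) ?g" using c2(2)[OF D(1)] cp(2)[OF D(1)] by simp
      have gle: "(\<integral>z. ?g z \<partial>gaussian D) \<le> (1 + c2 + cp * T powr (p / 2 - 1)) * D"
      proof -
        have "D powr (p / 2) = D powr (p / 2 - 1) * D" using D by (simp add: powr_diff)
        also have "\<dots> \<le> T powr (p / 2 - 1) * D" using D p by (intro mult_right_mono powr_mono2) auto
        finally have "cp * D powr (p / 2) \<le> cp * (T powr (p / 2 - 1) * D)" using cp(1) by (rule mult_left_mono)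
        moreover have "(\<integral>z. ?g z \<partial>gaussian D) = D + (\<integral>z. norm (z :: real^'q) powr 2 \<partial>gaussian D) + (\<integral>z. norm (z :: real^'q) powr p \<partial>gaussian D)"
          using c2(2)[OF D(1)] cp(2)[OF D(1)] G.prob_space by simp
        moreover have "(\<integral>z. norm (z :: real^'q) powr 2 \<partial>gaussian D) \<le> c2 * D" using c2(3)[OF D(1)] D by simp
        ultimately show ?thesis using cp(3)[OF D(1)] by (simp add: algebra_simps)
      qed
      note prod = increment_mult[OF st(1) lt Sm Si, of ?g, folded D_def, OF gi]
      let ?h = "\<lambda>\<omega>. norm (m \<omega>) powr (p - 2) * (m \<omega> \<bullet> (G \<omega> *v ?Z \<omega>))"
      note orth = increment_orthogonal[OF p st(1) lt m(1,3) int(1,3)]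
      have "(\<integral>\<omega>. norm (m \<omega> + ((t - s) *\<^sub>R \<beta> \<omega> + G \<omega> *v ?Z \<omega>)) powr p \<partial>M)
         \<le> (\<integral>\<omega>. (norm (m \<omega>) powr p + p * ?h \<omega>) + K * (?S \<omega> * ?g (?Z \<omega>)) \<partial>M)"
      proof (rule integral_mono)
        show "integrable M (\<lambda>\<omega>. norm (m \<omega> + ((t - s) *\<^sub>R \<beta> \<omega> + G \<omega> *v ?Z \<omega>)) powr p)"
          using p st by (intro integrable_step_powr m int) auto
        show "integrable M (\<lambda>\<omega>. (norm (m \<omega>) powr p + p * ?h \<omega>) + K * (?S \<omega> * ?g (?Z \<omega>)))"
          using prod(1) orth(1) int(1) by (intro Bochner_Integration.integrable_add integrable_mult_right)
        show "norm (m \<omega> + ((t - s) *\<^sub>R \<beta> \<omega> + G \<omega> *v ?Z \<omega>)) powr p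
          \<le> (norm (m \<omega>) powr p + p * ?h \<omega>) + K * (?S \<omega> * ?g (?Z \<omega>))" for \<omega>
          using K(2)[of "(t - s) *\<^sub>R \<beta> \<omega>" D "norm (\<beta> \<omega>)" "G \<omega> *v ?Z \<omega>" "norm (G \<omega>)" "norm (?Z \<omega>)" "m \<omega>"] D
          by (simp add: norm_matrix_vector_mult_le D_def powr_numeral)
      qed
      also have "\<dots> = ?e m + K * ((\<integral>\<omega>. ?S \<omega> \<partial>M) * (\<integral>z. ?g z \<partial>gaussian D))"
        using prod orth int(1) by simp
      also have "\<dots> \<le> ?e m + K * ((\<integral>\<omega>. ?S \<omega> \<partial>M) * ((1 + c2 + cp * T powr (p / 2 - 1)) * D))"
        using gle K(1) by (intro add_left_mono mult_left_mono) (auto intro!: integral_nonneg_AE)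
      also have "(\<integral>\<omega>. ?S \<omega> \<partial>M) = ?e m + ?e \<beta> + (\<integral>\<omega>. norm (G \<omega>) powr p \<partial>M)" using int by simp
      finally show ?thesis by (simp add: D_def[symmetric] algebra_simps)
    qed simp
  qed
qed

text \<open>The coefficients with index \<open>j\<close> act from \<open>\<pi> j\<close> to
  \<open>\<pi> (j + 1)\<close> and will be \<open>F (\<pi> j)\<close>-measurable: evaluation at the
  left end point. With \<open>\<beta>\<close> equal to 0 this is a discrete stochastic
  integral.\<close>

definition ito_sum :: "(nat \<Rightarrow> real) \<Rightarrow> (nat \<Rightarrow> 'a \<Rightarrow> real^'d) \<Rightarrow> (nat \<Rightarrow> 'a \<Rightarrow> real^'q^'d) \<Rightarrow> nat \<Rightarrow> 'a \<Rightarrow> real^'d" where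
  "ito_sum \<pi> \<beta> G m \<omega> = (\<Sum>j<m. (\<pi> (Suc j) - \<pi> j) *\<^sub>R \<beta> j \<omega> + G j \<omega> *v (B (\<pi> (Suc j)) \<omega> - B (\<pi> j) \<omega>))"

lemma ito_sum_Suc:
  "ito_sum \<pi> \<beta> G (Suc m) \<omega> = ito_sum \<pi> \<beta> G m \<omega> +
     ((\<pi> (Suc m) - \<pi> m) *\<^sub>R \<beta> m \<omega> + G m \<omega> *v (B (\<pi> (Suc m)) \<omega> - B (\<pi> m) \<omega>))"
  by (simp add: ito_sum_def)

lemma step_measurable_F:
  fixes m \<beta> :: "'a \<Rightarrow> real^'d" and G :: "'a \<Rightarrow> real^'q^'d"
  assumes st: "0 \<le> s" "s \<le> t"
    and m: "m \<in> borel_measurable (F s)" "\<beta> \<in> borel_measurable (F s)" "G \<in> borel_measurable (F s)"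
  shows "(\<lambda>\<omega>. m \<omega> + ((t - s) *\<^sub>R \<beta> \<omega> + G \<omega> *v (B t \<omega> - B s \<omega>))) \<in> borel_measurable (F t)"
proof -
  have [measurable]: "m \<in> borel_measurable (F t)" "\<beta> \<in> borel_measurable (F t)" "G \<in> borel_measurable (F t)"
    "B t \<in> borel_measurable (F t)" "B s \<in> borel_measurable (F t)"
    using measurable_F_mono[OF st] B_measurable_F[of t t] B_measurable_F[of s t] m st by auto
  show ?thesis by measurable
qed

lemma ito_sum_measurable_F:
  assumes mono: "0 \<le> \<pi> 0" "\<And>j. j < m \<Longrightarrow> \<pi> j \<le> \<pi> (Suc j)"
    and meas: "\<And>j. j < m \<Longrightarrow> \<beta> j \<in> borel_measurable (F (\<pi> j))" "\<And>j. j < m \<Longrightarrow> G j \<in> borel_measurable (F (\<pi> j))"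
  shows "n \<le> m \<Longrightarrow> ito_sum \<pi> \<beta> G n \<in> borel_measurable (F (\<pi> n))"
proof (induction n)
  case 0
  then show ?case by (simp add: ito_sum_def[abs_def])
next
  case (Suc n)
  have "0 \<le> \<pi> n" using partition_mono[of m \<pi> 0 n, OF mono(2)] mono(1) Suc.prems by simp
  then show ?case
    unfolding ito_sum_Suc[abs_def] using Suc by (intro step_measurable_F mono meas) auto
qed

text \<open>A step multiplies the moment by \<open>1 + K * D\<close> and adds a source term, so
  Gronwall's inequality applies. This is the discrete Burkholder inequality; the constant depends on
  the partition only through the bound \<open>T\<close> on its length, and so survives
  refinement.\<close>

lemma ito_sum_moment:
  fixes T p :: real
  assumes p: "2 \<le> p" and T: "0 \<le> T"
  obtains K where "0 \<le> K"
    "\<And>m \<pi> (\<beta> :: nat \<Rightarrow> 'a \<Rightarrow> real^'d) G. \<lbrakk>0 \<le> \<pi> 0; \<And>j. j < m \<Longrightarrow> \<pi> j \<le> \<pi> (Suc j); \<pi> m \<le> \<pi> 0 + T;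
       \<And>j. j < m \<Longrightarrow> \<beta> j \<in> borel_measurable (F (\<pi> j)); \<And>j. j < m \<Longrightarrow> G j \<in> borel_measurable (F (\<pi> j));
       \<And>j. j < m \<Longrightarrow> integrable M (\<lambda>\<omega>. norm (\<beta> j \<omega>) powr p); \<And>j. j < m \<Longrightarrow> integrable M (\<lambda>\<omega>. norm (G j \<omega>) powr p)\<rbrakk> \<Longrightarrow>
       integrable M (\<lambda>\<omega>. norm (ito_sum \<pi> \<beta> G m \<omega>) powr p) \<and>
       (\<integral>\<omega>. norm (ito_sum \<pi> \<beta> G m \<omega>) powr p \<partial>M)
       \<le> K * (\<Sum>j<m. (\<pi> (Suc j) - \<pi> j) * ((\<integral>\<omega>. norm (\<beta> j \<omega>) powr p \<partial>M) + (\<integral>\<omega>. norm (G j \<omega>) powr p \<partial>M)))"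
proof -
  obtain K where K: "0 \<le> K"
    "\<And>s t (m :: 'a \<Rightarrow> real^'d) \<beta> G. \<lbrakk>0 \<le> s; s \<le> t; t \<le> s + T; m \<in> borel_measurable (F s); \<beta> \<in> borel_measurable (F s);
       G \<in> borel_measurable (F s); integrable M (\<lambda>\<omega>. norm (m \<omega>) powr p);
       integrable M (\<lambda>\<omega>. norm (\<beta> \<omega>) powr p); integrable M (\<lambda>\<omega>. norm (G \<omega>) powr p)\<rbrakk> \<Longrightarrow>
       (\<integral>\<omega>. norm (m \<omega> + ((t - s) *\<^sub>R \<beta> \<omega> + G \<omega> *v (B t \<omega> - B s \<omega>))) powr p \<partial>M)
       \<le> (1 + K * (t - s)) * (\<integral>\<omega>. norm (m \<omega>) powr p \<partial>M)
         + K * (t - s) * ((\<integral>\<omega>. norm (\<beta> \<omega>) powr p \<partial>M) + (\<integral>\<omega>. norm (G \<omega>) powr p \<partial>M))"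
    by (rule ito_step_moment[OF p T]) blast
  show thesis
  proof
    show "0 \<le> exp (K * T) * K" using K by simp
    fix m \<pi> and \<beta> :: "nat \<Rightarrow> 'a \<Rightarrow> real^'d" and G :: "nat \<Rightarrow> 'a \<Rightarrow> real^'q^'d"
    assume mono: "0 \<le> \<pi> 0" "\<And>j. j < m \<Longrightarrow> \<pi> j \<le> \<pi> (Suc j)" "\<pi> m \<le> \<pi> 0 + T"
      and meas: "\<And>j. j < m \<Longrightarrow> \<beta> j \<in> borel_measurable (F (\<pi> j))" "\<And>j. j < m \<Longrightarrow> G j \<in> borel_measurable (F (\<pi> j))"
      and int: "\<And>j. j < m \<Longrightarrow> integrable M (\<lambda>\<omega>. norm (\<beta> j \<omega>) powr p)" "\<And>j. j < m \<Longrightarrow> integrable M (\<lambda>\<omega>. norm (G j \<omega>) powr p)"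
    have pos: "0 \<le> \<pi> j" "\<pi> 0 \<le> \<pi> j" "\<pi> j \<le> \<pi> m" if "j \<le> m" for j
      using partition_mono[of m \<pi> 0 j, OF mono(2)] partition_mono[of m \<pi> j m, OF mono(2)] mono(1) that by auto
    have step_int: "integrable M (\<lambda>\<omega>. norm (ito_sum \<pi> \<beta> G n \<omega>) powr p)" if "n \<le> m" for n
      using that
    proof (induction n)
      case (Suc n)
      show ?case unfolding ito_sum_Suc
        using Suc p by (intro integrable_step_powr meas int mono pos ito_sum_measurable_F[where m = m]) auto
    qed (simp add: ito_sum_def)
    define a where "a = (\<lambda>n. \<integral>\<omega>. norm (ito_sum \<pi> \<beta> G n \<omega>) powr p \<partial>M)"
    define g where "g = (\<lambda>j. (\<integral>\<omega>. norm (\<beta> j \<omega>) powr p \<partial>M) + (\<integral>\<omega>. norm (G j \<omega>) powr p \<partial>M))"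
    have g0: "0 \<le> g j" for j by (auto simp: g_def intro!: add_nonneg_nonneg integral_nonneg_AE)
    have "a m \<le> exp (K * (\<Sum>j<m. \<pi> (Suc j) - \<pi> j)) * (K * (\<Sum>j<m. (\<pi> (Suc j) - \<pi> j) * g j))"
    proof (rule discrete_Gronwall_step[where m = m])
      show "a 0 = 0" by (simp add: a_def ito_sum_def)
      show "a (Suc j) \<le> (1 + K * (\<pi> (Suc j) - \<pi> j)) * a j + K * (\<pi> (Suc j) - \<pi> j) * g j" if "j < m" for j
        unfolding a_def g_def ito_sum_Suc
        using that pos[of j] pos[of "Suc j"] mono
        by (intro K(2) meas int step_int ito_sum_measurable_F[where m = m]) auto
    qed (use K mono g0 in auto)
    also have "\<dots> \<le> exp (K * T) * (K * (\<Sum>j<m. (\<pi> (Suc j) - \<pi> j) * g j))"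
      using K(1) mono g0
      by (intro mult_right_mono mult_nonneg_nonneg sum_nonneg) (auto simp: sum_lessThan_telescope intro!: mult_left_mono)
    finally show "integrable M (\<lambda>\<omega>. norm (ito_sum \<pi> \<beta> G m \<omega>) powr p) \<and>
       (\<integral>\<omega>. norm (ito_sum \<pi> \<beta> G m \<omega>) powr p \<partial>M)
       \<le> exp (K * T) * K * (\<Sum>j<m. (\<pi> (Suc j) - \<pi> j) * ((\<integral>\<omega>. norm (\<beta> j \<omega>) powr p \<partial>M) + (\<integral>\<omega>. norm (G j \<omega>) powr p \<partial>M)))"
      using step_int[of m] by (simp add: a_def g_def mult.assoc)
  qed
qed

end

section \<open>Convergence in probability and partitions\<close>

text \<open>Truncation at 1 turns convergence in probability into convergence in \<open>L^1\<close>,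
  which has an almost surely convergent subsequence. Values below 1 are not touched by the
  truncation, so the same subsequence serves \<open>Z\<close>.\<close>

lemma (in prob_space) null_in_probability_AE_subseq:
  assumes "null_in_probability M Z"
  obtains r :: "nat \<Rightarrow> nat" where "strict_mono r" "AE \<omega> in M. (\<lambda>n. Z (r n) \<omega>) \<longlonglongrightarrow> 0"
proof -
  have Zm[measurable]: "Z n \<in> borel_measurable M" for n using assms by (simp add: null_in_probability_def)
  define u where "u = (\<lambda>n \<omega>. enn2real (min 1 (Z n \<omega>)))"
  have um[measurable]: "u n \<in> borel_measurable M" for n unfolding u_def by measurable
  have eu: "ennreal (u n \<omega>) = min 1 (Z n \<omega>)" for n \<omega>
    unfolding u_def by (rule ennreal_enn2real) (simp add: min_less_iff_disj)
  have u01: "0 \<le> u n \<omega>" "u n \<omega> \<le> 1" for n \<omega>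
  proof -
    show "0 \<le> u n \<omega>" by (simp add: u_def)
    have "ennreal (u n \<omega>) \<le> ennreal 1" unfolding eu by simp
    then show "u n \<omega> \<le> 1" by (subst (asm) ennreal_le_iff) auto
  qed
  have ui: "integrable M (u n)" for n
    by (rule integrable_const_bound[of _ 1]) (use u01 in auto)
  have "(\<lambda>n. \<integral>\<omega>. norm (u n \<omega>) \<partial>M) \<longlonglongrightarrow> 0"
  proof (rule LIMSEQ_I)
    fix e :: real assume e: "0 < e"
    have "(\<lambda>n. prob {\<omega>\<in>space M. ennreal (e / 2) < Z n \<omega>}) \<longlonglongrightarrow> 0"
      using assms e by (simp add: null_in_probability_def)
    then obtain N where N: "\<And>n. N \<le> n \<Longrightarrow> prob {\<omega>\<in>space M. ennreal (e / 2) < Z n \<omega>} < e / 2"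
      using LIMSEQ_D[of _ 0 "e / 2"] e by force
    have "norm ((\<integral>\<omega>. norm (u n \<omega>) \<partial>M) - 0) < e" if "N \<le> n" for n
    proof -
      let ?A = "{\<omega>\<in>space M. ennreal (e / 2) < Z n \<omega>}"
      have iA: "integrable M (indicat_real ?A)"
        by (intro integrable_real_indicator) (auto simp: less_top[symmetric])
      have "(\<integral>\<omega>. norm (u n \<omega>) \<partial>M) \<le> (\<integral>\<omega>. e / 2 + indicator ?A \<omega> \<partial>M)"
      proof (rule integral_mono)
        show "integrable M (\<lambda>\<omega>. e / 2 + indicat_real ?A \<omega>)" using iA by simp
        fix \<omega> assume \<omega>: "\<omega> \<in> space M"
        show "norm (u n \<omega>) \<le> e / 2 + indicat_real ?A \<omega>"
        proof (cases "\<omega> \<in> ?A")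
          case True
          then show ?thesis using u01[of n \<omega>] e by simp
        next
          case False
          then have "ennreal (u n \<omega>) \<le> ennreal (e / 2)"
            unfolding eu using \<omega> by (auto simp: min_le_iff_disj not_less)
          then show ?thesis using False u01[of n \<omega>] e by (simp add: ennreal_le_iff)
        qed
      qed (use ui in auto)
      also have "\<dots> = e / 2 + prob ?A"
        by (subst Bochner_Integration.integral_add) (use iA in \<open>auto simp: prob_space\<close>)
      finally show ?thesis using N[OF that] by (simp add: integral_nonneg_AE)
    qed
    then show "\<exists>N. \<forall>n\<ge>N. norm ((\<integral>\<omega>. norm (u n \<omega>) \<partial>M) - 0) < e" by blast
  qed
  from tendsto_L1_AE_subseq[OF ui this]
  obtain r where r: "strict_mono r" "AE \<omega> in M. (\<lambda>n. u (r n) \<omega>) \<longlonglongrightarrow> 0" by blast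
  have "(\<lambda>n. Z (r n) \<omega>) \<longlonglongrightarrow> 0" if u0: "(\<lambda>n. u (r n) \<omega>) \<longlonglongrightarrow> 0" for \<omega>
  proof -
    have "(\<lambda>n. ennreal (u (r n) \<omega>)) \<longlonglongrightarrow> ennreal 0" using u0 by (intro tendsto_ennrealI)
    moreover have "eventually (\<lambda>n. ennreal (u (r n) \<omega>) = Z (r n) \<omega>) sequentially"
    proof -
      have "eventually (\<lambda>n. u (r n) \<omega> < 1) sequentially" using order_tendstoD(2)[OF u0] by simp
      then show ?thesis
      proof eventually_elim
        case (elim n)
        then have "min 1 (Z (r n) \<omega>) < 1" unfolding eu[symmetric] using u01(1) by (simp add: ennreal_less_one_iff)
        then show ?case unfolding eu by (simp add: min_def split: if_splits)
      qed
    qed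
    ultimately show ?thesis by (simp add: filterlim_cong)
  qed
  then show thesis using r by (intro that[of r]) auto
qed

lemma null_in_probability_subseq:
  assumes "null_in_probability M Z" "strict_mono r"
  shows "null_in_probability M (\<lambda>n. Z (r n))"
  using assms LIMSEQ_subseq_LIMSEQ[OF _ assms(2)] unfolding null_in_probability_def comp_def by fastforce

lemma (in prob_space) AE_tendsto_0_imp_prob:
  fixes Q :: "nat \<Rightarrow> 'a \<Rightarrow> real"
  assumes [measurable]: "\<And>n. Q n \<in> borel_measurable M" and Q: "AE \<omega> in M. (\<lambda>n. Q n \<omega>) \<longlonglongrightarrow> 0" and "0 < \<delta>"
  shows "(\<lambda>n. prob {\<omega>\<in>space M. \<delta> < Q n \<omega>}) \<longlonglongrightarrow> 0"
proof -
  have "(\<lambda>n. \<integral>\<omega>. indicat_real {\<omega>\<in>space M. \<delta> < Q n \<omega>} \<omega> \<partial>M) \<longlonglongrightarrow> (\<integral>\<omega>. 0 \<partial>M)"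
  proof (rule integral_dominated_convergence[where w = "\<lambda>_. 1"])
    show "AE \<omega> in M. (\<lambda>n. indicat_real {\<omega>\<in>space M. \<delta> < Q n \<omega>} \<omega>) \<longlonglongrightarrow> 0"
      using Q
    proof eventually_elim
      case (elim \<omega>)
      have "eventually (\<lambda>n. Q n \<omega> < \<delta>) sequentially" using order_tendstoD(2)[OF elim] assms(3) by simp
      then have "eventually (\<lambda>n. indicat_real {\<omega>\<in>space M. \<delta> < Q n \<omega>} \<omega> = 0) sequentially"
        by eventually_elim auto
      then show ?case by (rule tendsto_eventually)
    qed
  qed auto
  then show ?thesis by simp
qed

section \<open>Partitions of an interval and their refinements\<close>

lemma strict_partition_exists:
  fixes P :: "real set"
  assumes P: "finite P" "P \<subseteq> {0..v}" "0 \<in> P" "v \<in> P"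
  obtains m \<pi> where "\<pi> 0 = 0" "\<pi> m = v" "\<And>j. j < m \<Longrightarrow> \<pi> j < \<pi> (Suc j)" "\<pi> ` {..m} = P"
proof -
  define l where "l = sorted_list_of_set P"
  have l: "set l = P" "sorted_wrt (<) l" using P(1) by (auto simp: l_def strict_sorted_list_of_set)
  have len: "0 < length l" using l(1) P(3) by (cases l) auto
  define m where "m = length l - 1"
  have lm: "length l = Suc m" using len by (simp add: m_def)
  have im: "(!) l ` {..m} = P"
  proof -
    have "{..m} = {..<length l}" by (simp add: lm lessThan_Suc_atMost)
    then show ?thesis using nth_image[of "length l" l] by (simp add: atLeast0LessThan l(1))
  qed
  have step: "l ! i < l ! j" if "i < j" "j \<le> m" for i j
    using sorted_wrt_nth_less[OF l(2) that(1)] that(2) by (simp add: lm)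
  have mem: "l ! i \<in> {0..v}" if "i \<le> m" for i using im P(2) that by auto
  show thesis
  proof
    obtain i where i: "i \<le> m" "l ! i = 0" using im P(3) by (metis atMost_iff imageE)
    show "l ! 0 = 0" using i step[of 0 i] mem[of 0] by (cases "i = 0") auto
    obtain k where k: "k \<le> m" "l ! k = v" using im P(4) by (metis atMost_iff imageE)
    show "l ! m = v" using k step[of k m] mem[of m] by (cases "k = m") auto
  qed (use step im in auto)
qed

lemma strict_partition_less_iff:
  fixes \<pi> :: "nat \<Rightarrow> real"
  assumes "\<And>j. j < m \<Longrightarrow> \<pi> j < \<pi> (Suc j)" "i \<le> m" "j \<le> m"
  shows "\<pi> i < \<pi> j \<longleftrightarrow> i < j"
proof -
  have le: "\<pi> i \<le> \<pi> j" if "i \<le> j" "j \<le> m" for i j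
    by (rule partition_mono[of m \<pi> i j, OF less_imp_le[OF assms(1)] that])
  have "\<pi> i < \<pi> j" if "i < j" "j \<le> m" for i j
    using assms(1)[of i] le[of "Suc i" j] that by auto
  then show ?thesis using le[of j i] assms(2,3) by (metis leI not_le)
qed

text \<open>Points of a strict partition are ordered as their indices are, so none lies inside a
  cell. In this way the jump times of simple processes are kept out of the cells of a
  refinement.\<close>

lemma partition_point_le:
  fixes \<pi> :: "nat \<Rightarrow> real"
  assumes strict: "\<And>j. j < m \<Longrightarrow> \<pi> j < \<pi> (Suc j)" and "c \<in> \<pi> ` {..m}" "j < m"
  shows "c < \<pi> (Suc j) \<Longrightarrow> c \<le> \<pi> j" and "\<pi> j < c \<Longrightarrow> \<pi> (Suc j) \<le> c"
proof -
  obtain i where i: "i \<le> m" "c = \<pi> i" using assms(2) by auto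
  have iff: "\<pi> a < \<pi> b \<longleftrightarrow> a < b" if "a \<le> m" "b \<le> m" for a b
    using strict_partition_less_iff[of m \<pi>, OF strict that] .
  show "c < \<pi> (Suc j) \<Longrightarrow> c \<le> \<pi> j" "\<pi> j < c \<Longrightarrow> \<pi> (Suc j) \<le> c"
    using iff[of i "Suc j"] iff[of j i] iff[of "Suc j" i] i assms(3) by (auto simp: not_less[symmetric])
qed

text \<open>No multiple of \<open>v / N\<close> lies inside a cell, since all of them are partition
  points; the first one after \<open>\<pi> j\<close> therefore bounds
  \<open>\<pi> (j + 1)\<close>.\<close>

lemma partition_mesh_le:
  fixes \<pi> :: "nat \<Rightarrow> real"
  assumes strict: "\<And>j. j < m \<Longrightarrow> \<pi> j < \<pi> (Suc j)" and ends: "\<pi> 0 = 0" "\<pi> m = v"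
    and N: "0 < N" "\<And>i. i \<le> N \<Longrightarrow> v * real i / real N \<in> \<pi> ` {..m}" and j: "j < m"
  shows "\<pi> (Suc j) - \<pi> j \<le> v / real N"
proof -
  have mono: "\<pi> i \<le> \<pi> k" if "i \<le> k" "k \<le> m" for i k
    by (rule partition_mono[of m \<pi> i k, OF less_imp_le[OF strict] that])
  have pj: "0 \<le> \<pi> j" "\<pi> j < v" using mono[of 0 j] mono[of "Suc j" m] strict[OF j] j ends by auto
  have v: "0 < v" using pj by simp
  define y where "y = \<pi> j * real N / v"
  define i where "i = nat \<lfloor>y\<rfloor>"
  have y: "0 \<le> y" "y < real N" using pj v N(1) by (auto simp: y_def field_simps)
  have i: "real i \<le> y" "y < real i + 1" using y by (auto simp: i_def)
  have iN: "Suc i \<le> N" using i y by linarith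
  have vi: "v * real i / real N \<le> \<pi> j" "\<pi> j < v * real (Suc i) / real N"
    using i v N(1) by (auto simp: y_def field_simps)
  have "\<pi> (Suc j) \<le> v * real (Suc i) / real N"
    by (rule partition_point_le(2)[OF strict N(2)[OF iN] j vi(2)])
  also have "\<dots> = v * real i / real N + v / real N" using N(1) by (simp add: field_simps)
  finally show ?thesis using vi by linarith
qed

text \<open>The indicator is the difference of those of \<open>x \<le> b\<close> and
  \<open>x \<le> a\<close>; each selects an initial segment of cells, over which the increments
  telescope. Cells are tested at their right end point because the intervals of a simple process are
  open on the left.\<close>

lemma partition_telescope:
  fixes f :: "real \<Rightarrow> 'v::real_vector" and \<pi> :: "nat \<Rightarrow> real"
  assumes strict: "\<And>j. j < m \<Longrightarrow> \<pi> j < \<pi> (Suc j)" and v: "\<pi> m = v"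
    and ab: "a \<le> b" "min v a \<in> \<pi> ` {..m}" "min v b \<in> \<pi> ` {..m}"
  shows "(\<Sum>j<m. indicat_real {a<..b} (\<pi> (Suc j)) *\<^sub>R (f (\<pi> (Suc j)) - f (\<pi> j))) = f (min v b) - f (min v a)"
proof -
  have iff: "\<pi> a < \<pi> b \<longleftrightarrow> a < b" if "a \<le> m" "b \<le> m" for a b
    using strict_partition_less_iff[of m \<pi>, OF strict that] .
  have one: "(\<Sum>j<m. (if \<pi> (Suc j) \<le> c then 1 else 0) *\<^sub>R (f (\<pi> (Suc j)) - f (\<pi> j))) = f (min v c) - f (\<pi> 0)"
    if "min v c \<in> \<pi> ` {..m}" for c
  proof -
    from that obtain k where "min v c = \<pi> k" "k \<in> {..m}" by (rule imageE)
    then have k: "k \<le> m" "\<pi> k = min v c" by simp_all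
    have eq: "\<pi> (Suc j) \<le> c \<longleftrightarrow> j < k" if "j < m" for j
    proof -
      have "\<pi> (Suc j) \<le> v" using iff[of m "Suc j"] that v by (auto simp: not_less[symmetric])
      then have "\<pi> (Suc j) \<le> c \<longleftrightarrow> \<pi> (Suc j) \<le> \<pi> k" by (auto simp: k)
      then show ?thesis using iff[of k "Suc j"] that k(1) by (auto simp: not_less[symmetric])
    qed
    have "(\<Sum>j<m. (if \<pi> (Suc j) \<le> c then 1 else 0) *\<^sub>R (f (\<pi> (Suc j)) - f (\<pi> j)))
      = (\<Sum>j<m. if j < k then f (\<pi> (Suc j)) - f (\<pi> j) else 0)"
      by (intro sum.cong) (auto simp: eq)
    also have "\<dots> = (\<Sum>j<k. f (\<pi> (Suc j)) - f (\<pi> j))"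
      using k(1) by (intro sum.mono_neutral_cong_right) auto
    also have "\<dots> = f (\<pi> k) - f (\<pi> 0)" by (rule sum_lessThan_telescope)
    finally show ?thesis by (simp add: k)
  qed
  have "indicat_real {a<..b} x = (if x \<le> b then 1 else 0) - (if x \<le> a then 1 else 0)" for x
    using ab(1) by (auto simp: indicator_def)
  then show ?thesis
    using one[OF ab(2)] one[OF ab(3)] by (simp add: scaleR_left_diff_distrib sum_subtractf)
qed

text \<open>Integration of a step function along a refinement: cell \<open>j\<close> receives the
  value of the step function at its right end point. The minimum with \<open>v\<close> stops the
  integral at time \<open>v\<close>, as in \<open>simple_integral\<close>.\<close>

lemma partition_refine_matrix:
  fixes f :: "real \<Rightarrow> real^'q" and A :: "nat \<Rightarrow> real^'q^'d" and \<pi> :: "nat \<Rightarrow> real"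
  assumes strict: "\<And>j. j < m \<Longrightarrow> \<pi> j < \<pi> (Suc j)" and v: "\<pi> m = v"
    and \<tau>: "\<And>i. i < n \<Longrightarrow> \<tau> i \<le> \<tau> (Suc i)" "\<And>i. i \<le> n \<Longrightarrow> min v (\<tau> i) \<in> \<pi> ` {..m}"
  shows "(\<Sum>i<n. A i *v (f (min v (\<tau> (Suc i))) - f (min v (\<tau> i))))
    = (\<Sum>j<m. (\<Sum>i<n. indicat_real {\<tau> i<..\<tau> (Suc i)} (\<pi> (Suc j)) *\<^sub>R A i) *v (f (\<pi> (Suc j)) - f (\<pi> j)))"
proof -
  have "A i *v (f (min v (\<tau> (Suc i))) - f (min v (\<tau> i)))
    = (\<Sum>j<m. (indicat_real {\<tau> i<..\<tau> (Suc i)} (\<pi> (Suc j)) *\<^sub>R A i) *v (f (\<pi> (Suc j)) - f (\<pi> j)))" if "i < n" for i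
  proof -
    have "f (min v (\<tau> (Suc i))) - f (min v (\<tau> i)) =
      (\<Sum>j<m. indicat_real {\<tau> i<..\<tau> (Suc i)} (\<pi> (Suc j)) *\<^sub>R (f (\<pi> (Suc j)) - f (\<pi> j)))"
      using that by (intro partition_telescope[symmetric] strict v \<tau>) auto
    then show ?thesis
      by (simp only: linear_sum[OF matrix_vector_mul_linear] matrix_vector_mult_scaleR scaleR_matrix_vector_assoc)
  qed
  then have "(\<Sum>i<n. A i *v (f (min v (\<tau> (Suc i))) - f (min v (\<tau> i))))
    = (\<Sum>i<n. \<Sum>j<m. (indicat_real {\<tau> i<..\<tau> (Suc i)} (\<pi> (Suc j)) *\<^sub>R A i) *v (f (\<pi> (Suc j)) - f (\<pi> j)))"
    by (intro sum.cong) auto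
  also have "\<dots> = (\<Sum>j<m. \<Sum>i<n. (indicat_real {\<tau> i<..\<tau> (Suc i)} (\<pi> (Suc j)) *\<^sub>R A i) *v (f (\<pi> (Suc j)) - f (\<pi> j)))"
    by (rule sum.swap)
  also have "\<dots> = (\<Sum>j<m. (\<Sum>i<n. indicat_real {\<tau> i<..\<tau> (Suc i)} (\<pi> (Suc j)) *\<^sub>R A i) *v (f (\<pi> (Suc j)) - f (\<pi> j)))"
  proof (rule sum.cong[OF refl])
    fix j
    have lin: "linear (\<lambda>A :: real^'q^'d. A *v (f (\<pi> (Suc j)) - f (\<pi> j)))"
      by (rule linearI) (simp_all add: matrix_vector_mult_add_rdistrib scaleR_matrix_vector_assoc)
    show "(\<Sum>i<n. (indicat_real {\<tau> i<..\<tau> (Suc i)} (\<pi> (Suc j)) *\<^sub>R A i) *v (f (\<pi> (Suc j)) - f (\<pi> j)))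
      = (\<Sum>i<n. indicat_real {\<tau> i<..\<tau> (Suc i)} (\<pi> (Suc j)) *\<^sub>R A i) *v (f (\<pi> (Suc j)) - f (\<pi> j))"
      by (rule linear_sum[OF lin, symmetric])
  qed
  finally show ?thesis .
qed

lemma partition_refine_scaleR:
  fixes \<beta> :: "nat \<Rightarrow> 'v::real_vector" and \<pi> :: "nat \<Rightarrow> real"
  assumes strict: "\<And>j. j < m \<Longrightarrow> \<pi> j < \<pi> (Suc j)" and v: "\<pi> m = v"
    and \<tau>: "\<And>i. i < n \<Longrightarrow> \<tau> i \<le> \<tau> (Suc i)" "\<And>i. i \<le> n \<Longrightarrow> min v (\<tau> i) \<in> \<pi> ` {..m}"
  shows "(\<Sum>i<n. (min v (\<tau> (Suc i)) - min v (\<tau> i)) *\<^sub>R \<beta> i)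
    = (\<Sum>j<m. (\<pi> (Suc j) - \<pi> j) *\<^sub>R (\<Sum>i<n. indicat_real {\<tau> i<..\<tau> (Suc i)} (\<pi> (Suc j)) *\<^sub>R \<beta> i))"
proof -
  have "(min v (\<tau> (Suc i)) - min v (\<tau> i)) *\<^sub>R \<beta> i
    = (\<Sum>j<m. (\<pi> (Suc j) - \<pi> j) *\<^sub>R indicat_real {\<tau> i<..\<tau> (Suc i)} (\<pi> (Suc j)) *\<^sub>R \<beta> i)" if "i < n" for i
  proof -
    have "min v (\<tau> (Suc i)) - min v (\<tau> i) =
      (\<Sum>j<m. indicat_real {\<tau> i<..\<tau> (Suc i)} (\<pi> (Suc j)) *\<^sub>R (\<pi> (Suc j) - \<pi> j))"
      using that by (intro partition_telescope[where f = "\<lambda>x. x", symmetric] strict v \<tau>) auto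
    then show ?thesis by (simp only: scaleR_sum_left real_scaleR_def scaleR_scaleR mult.commute)
  qed
  then have "(\<Sum>i<n. (min v (\<tau> (Suc i)) - min v (\<tau> i)) *\<^sub>R \<beta> i)
    = (\<Sum>i<n. \<Sum>j<m. (\<pi> (Suc j) - \<pi> j) *\<^sub>R indicat_real {\<tau> i<..\<tau> (Suc i)} (\<pi> (Suc j)) *\<^sub>R \<beta> i)"
    by (intro sum.cong) auto
  also have "\<dots> = (\<Sum>j<m. \<Sum>i<n. (\<pi> (Suc j) - \<pi> j) *\<^sub>R indicat_real {\<tau> i<..\<tau> (Suc i)} (\<pi> (Suc j)) *\<^sub>R \<beta> i)"
    by (rule sum.swap)
  finally show ?thesis by (simp only: scaleR_sum_right)
qed

lemma partition_interval_exists: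
  fixes a :: "nat \<Rightarrow> real"
  assumes "a 0 < x" "x \<le> a n"
  obtains i where "i < n" "a i < x" "x \<le> a (Suc i)"
  using assms
proof (induction n arbitrary: thesis)
  case (Suc n)
  show ?case
  proof (cases "x \<le> a n")
    case True
    with Suc show ?thesis by (metis less_Suc_eq)
  next
    case False
    with Suc.prems show ?thesis by (intro Suc.prems(1)[of n]) auto
  qed
qed simp

lemma sum_indicator_partition:
  fixes a :: "nat \<Rightarrow> real" and f :: "nat \<Rightarrow> 'v::real_vector"
  assumes mono: "\<And>i. i < n \<Longrightarrow> a i \<le> a (Suc i)" and i: "i < n" "a i < x" "x \<le> a (Suc i)"
  shows "(\<Sum>k<n. indicat_real {a k<..a (Suc k)} x *\<^sub>R f k) = f i"
proof -
  have "indicat_real {a k<..a (Suc k)} x *\<^sub>R f k = (if k = i then f k else 0)" if "k < n" for k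
  proof -
    consider "k < i" | "k = i" | "i < k" by linarith
    then show ?thesis
    proof cases
      case 1
      then have "a (Suc k) \<le> a i" using partition_mono[of n a "Suc k" i, OF mono] i(1) by simp
      then show ?thesis using i 1 by auto
    next
      case 3
      then have "a (Suc i) \<le> a k" using partition_mono[of n a "Suc i" k, OF mono] that by simp
      then show ?thesis using i 3 by auto
    qed (use i in auto)
  qed
  then have "(\<Sum>k<n. indicat_real {a k<..a (Suc k)} x *\<^sub>R f k) = (\<Sum>k<n. if k = i then f k else 0)"
    by (intro sum.cong) auto
  then show ?thesis using i(1) by simp
qed

text \<open>Bounds the error at grid points, which enters discrete integrals, by the distance in
  \<open>L^2\<close> that the definition of the integral controls. On a cell \<open>g\<close> is
  constant and \<open>h\<close> moves by at most \<open>w\<close>, so the squared error is at most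
  \<open>2 * |g - h|^2 + 2 * w^2\<close> at every time of the cell, and the cells are
  disjoint.\<close>

lemma partition_L2_bound:
  fixes g h :: "real \<Rightarrow> 'v::euclidean_space" and \<pi> :: "nat \<Rightarrow> real"
  assumes strict: "\<And>j. j < m \<Longrightarrow> \<pi> j < \<pi> (Suc j)" and ends: "\<pi> 0 = 0" "\<pi> m = v" "v \<le> T"
    and g: "g \<in> borel_measurable borel" "\<And>j s. j < m \<Longrightarrow> s \<in> {\<pi> j<..\<pi> (Suc j)} \<Longrightarrow> g s = g (\<pi> (Suc j))"
    and h: "continuous_on {0..T} h" "\<And>j s. j < m \<Longrightarrow> s \<in> {\<pi> j<..\<pi> (Suc j)} \<Longrightarrow> norm (h s - h (\<pi> j)) \<le> w"
    and w: "0 \<le> w"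
  shows "ennreal (\<Sum>j<m. (\<pi> (Suc j) - \<pi> j) * (norm (h (\<pi> j) - g (\<pi> (Suc j))))\<^sup>2)
     \<le> 2 * (\<integral>\<^sup>+s\<in>{0..T}. ennreal ((norm (g s - h s))\<^sup>2) \<partial>lborel) + ennreal (2 * w\<^sup>2 * v)"
proof -
  have mono: "\<pi> i \<le> \<pi> k" if "i \<le> k" "k \<le> m" for i k
    by (rule partition_mono[of m \<pi> i k, OF less_imp_le[OF strict] that])
  let ?I = "\<lambda>j. {\<pi> j<..\<pi> (Suc j)}"
  \<comment> \<open>Continuity of \<open>h\<close> is given on \<open>[0,T]\<close>; the function
    cut off outside is measurable on the whole line.\<close>
  define H where "H = (\<lambda>s. indicat_real {0..T} s *\<^sub>R h s)"
  have [measurable]: "H \<in> borel_measurable borel"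
    unfolding H_def by (rule borel_measurable_continuous_on_indicator) (use h in auto)
  note [measurable] = g(1)
  define f where "f = (\<lambda>s. ennreal ((norm (g s - H s))\<^sup>2) * indicator {0..T} s)"
  have fm[measurable]: "f \<in> borel_measurable borel" unfolding f_def by measurable
  have feq: "(\<integral>\<^sup>+s\<in>{0..T}. ennreal ((norm (g s - h s))\<^sup>2) \<partial>lborel) = (\<integral>\<^sup>+s. f s \<partial>lborel)"
    by (rule nn_integral_cong) (auto simp: f_def H_def indicator_def)
  have sub: "?I j \<subseteq> {0..T}" if "j < m" for j
    using mono[of 0 j] mono[of "Suc j" m] that ends by (auto simp: less_imp_le)
  have one: "ennreal ((\<pi> (Suc j) - \<pi> j) * (norm (h (\<pi> j) - g (\<pi> (Suc j))))\<^sup>2)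
      \<le> 2 * (\<integral>\<^sup>+s. f s * indicator (?I j) s \<partial>lborel) + ennreal (2 * w\<^sup>2 * (\<pi> (Suc j) - \<pi> j))" if j: "j < m" for j
  proof -
    have "ennreal ((\<pi> (Suc j) - \<pi> j) * (norm (h (\<pi> j) - g (\<pi> (Suc j))))\<^sup>2)
      = (\<integral>\<^sup>+s. ennreal ((norm (h (\<pi> j) - g (\<pi> (Suc j))))\<^sup>2) * indicator (?I j) s \<partial>lborel)"
      using strict[OF j] by (subst nn_integral_cmult_indicator) (auto simp: ennreal_mult mult.commute)
    also have "\<dots> \<le> (\<integral>\<^sup>+s. 2 * (f s * indicator (?I j) s) + ennreal (2 * w\<^sup>2) * indicator (?I j) s \<partial>lborel)"
    proof (rule nn_integral_mono)
      fix s
      show "ennreal ((norm (h (\<pi> j) - g (\<pi> (Suc j))))\<^sup>2) * indicator (?I j) s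
         \<le> 2 * (f s * indicator (?I j) s) + ennreal (2 * w\<^sup>2) * indicator (?I j) s"
      proof (cases "s \<in> ?I j")
        case True
        then have sT: "s \<in> {0..T}" using sub[OF j] by blast
        have n1: "norm (h (\<pi> j) - g (\<pi> (Suc j))) \<le> norm (g s - h s) + w"
        proof -
          have "h (\<pi> j) - g (\<pi> (Suc j)) = - ((g s - h s) + (h s - h (\<pi> j)))" using g(2)[OF j True] by simp
          then show ?thesis
            using norm_triangle_ineq[of "g s - h s" "h s - h (\<pi> j)"] h(2)[OF j True] by (simp only: norm_minus_cancel)
        qed
        have "(norm (h (\<pi> j) - g (\<pi> (Suc j))))\<^sup>2 \<le> (norm (g s - h s) + w)\<^sup>2"
          by (rule power_mono[OF n1]) simp
        also have "\<dots> \<le> 2 * (norm (g s - h s))\<^sup>2 + 2 * w\<^sup>2"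
          using sum_squares_bound[of "norm (g s - h s)" w] by (simp add: power2_sum)
        finally have "ennreal ((norm (h (\<pi> j) - g (\<pi> (Suc j))))\<^sup>2) \<le> ennreal (2 * (norm (g s - h s))\<^sup>2 + 2 * w\<^sup>2)"
          by (rule ennreal_leI)
        also have "\<dots> = 2 * ennreal ((norm (g s - h s))\<^sup>2) + ennreal (2 * w\<^sup>2)"
          by (simp add: ennreal_plus ennreal_mult)
        finally show ?thesis using True sT by (simp add: f_def H_def)
      qed simp
    qed
    also have "\<dots> = 2 * (\<integral>\<^sup>+s. f s * indicator (?I j) s \<partial>lborel) + ennreal (2 * w\<^sup>2) * emeasure lborel (?I j)"
      by (subst nn_integral_add) (auto simp: nn_integral_cmult)
    also have "ennreal (2 * w\<^sup>2) * emeasure lborel (?I j) = ennreal (2 * w\<^sup>2 * (\<pi> (Suc j) - \<pi> j))"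
      using strict[OF j] by (simp add: ennreal_mult)
    finally show ?thesis .
  qed
  have "ennreal (\<Sum>j<m. (\<pi> (Suc j) - \<pi> j) * (norm (h (\<pi> j) - g (\<pi> (Suc j))))\<^sup>2)
    = (\<Sum>j<m. ennreal ((\<pi> (Suc j) - \<pi> j) * (norm (h (\<pi> j) - g (\<pi> (Suc j))))\<^sup>2))"
    by (intro sum_ennreal[symmetric] mult_nonneg_nonneg) (use strict in \<open>auto intro: less_imp_le\<close>)
  also have "\<dots> \<le> (\<Sum>j<m. 2 * (\<integral>\<^sup>+s. f s * indicator (?I j) s \<partial>lborel) + ennreal (2 * w\<^sup>2 * (\<pi> (Suc j) - \<pi> j)))"
    by (intro sum_mono one) simp
  also have "\<dots> = 2 * (\<Sum>j<m. \<integral>\<^sup>+s. f s * indicator (?I j) s \<partial>lborel) + (\<Sum>j<m. ennreal (2 * w\<^sup>2 * (\<pi> (Suc j) - \<pi> j)))"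
    by (simp add: sum.distrib sum_distrib_left)
  also have "(\<Sum>j<m. \<integral>\<^sup>+s. f s * indicator (?I j) s \<partial>lborel) = (\<integral>\<^sup>+s. (\<Sum>j<m. f s * indicator (?I j) s) \<partial>lborel)"
    by (rule nn_integral_sum[symmetric]) simp
  also have "\<dots> \<le> (\<integral>\<^sup>+s. f s \<partial>lborel)"
  proof (rule nn_integral_mono)
    fix s
    have "(\<Sum>j<m. indicator (?I j) s :: ennreal) \<le> 1"
    proof (cases "\<exists>j<m. s \<in> ?I j")
      case True
      then obtain i where i: "i < m" "\<pi> i < s" "s \<le> \<pi> (Suc i)" by auto
      have "(\<Sum>j<m. indicat_real (?I j) s *\<^sub>R (1::real)) = 1"
        by (rule sum_indicator_partition[OF less_imp_le[OF strict] i])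
      then have "ennreal (\<Sum>j<m. indicat_real (?I j) s) = 1" by simp
      moreover have "(\<Sum>j<m. indicator (?I j) s :: ennreal) = ennreal (\<Sum>j<m. indicat_real (?I j) s)"
        by (subst sum_ennreal[symmetric]) (auto simp: ennreal_indicator)
      ultimately show ?thesis by simp
    next
      case False
      then have "(\<Sum>j<m. indicator (?I j) s :: ennreal) = 0" by (intro sum.neutral) (auto simp: indicator_def)
      then show ?thesis by simp
    qed
    then have "f s * (\<Sum>j<m. indicator (?I j) s) \<le> f s * 1" by (rule mult_left_mono) simp
    then show "(\<Sum>j<m. f s * indicator (?I j) s) \<le> f s" by (simp add: sum_distrib_left)
  qed
  also have "(\<Sum>j<m. ennreal (2 * w\<^sup>2 * (\<pi> (Suc j) - \<pi> j))) = ennreal (2 * w\<^sup>2 * v)"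
    using strict ends
    by (subst sum_ennreal) (auto simp: sum_lessThan_telescope less_imp_le simp flip: sum_distrib_left)
  finally show ?thesis unfolding feq by (simp add: mult_left_mono add_right_mono)
qed

lemma riemann_sum_bound:
  fixes h :: "real \<Rightarrow> 'v::euclidean_space" and \<pi> :: "nat \<Rightarrow> real"
  assumes strict: "\<And>j. j < m \<Longrightarrow> \<pi> j < \<pi> (Suc j)" and ends: "\<pi> 0 = 0" "\<pi> m = v" "v \<le> T"
    and h: "continuous_on {0..T} h" "\<And>j s. j < m \<Longrightarrow> s \<in> {\<pi> j..\<pi> (Suc j)} \<Longrightarrow> norm (h s - h (\<pi> j)) \<le> w"
  shows "norm ((LINT s:{0..v}|lborel. h s) - (\<Sum>j<m. (\<pi> (Suc j) - \<pi> j) *\<^sub>R h (\<pi> j))) \<le> w * v"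
proof -
  have mono: "\<pi> i \<le> \<pi> k" if "i \<le> k" "k \<le> m" for i k
    by (rule partition_mono[of m \<pi> i k, OF less_imp_le[OF strict] that])
  have "norm (integral {0..\<pi> n} h - (\<Sum>j<n. (\<pi> (Suc j) - \<pi> j) *\<^sub>R h (\<pi> j))) \<le> w * \<pi> n" if "n \<le> m" for n
    using that
  proof (induction n)
    case 0
    then show ?case using ends by simp
  next
    case (Suc n)
    have n: "n < m" using Suc.prems by simp
    have pos: "0 \<le> \<pi> n" "\<pi> n \<le> \<pi> (Suc n)" "\<pi> (Suc n) \<le> T"
      using mono[of 0 n] mono[of n "Suc n"] mono[of "Suc n" m] Suc.prems ends by auto
    have c1: "continuous_on {0..\<pi> (Suc n)} h" by (rule continuous_on_subset[OF h(1)]) (use pos in auto)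
    have c2: "continuous_on {\<pi> n..\<pi> (Suc n)} h" by (rule continuous_on_subset[OF h(1)]) (use pos in auto)
    have comb: "integral {0..\<pi> (Suc n)} h = integral {0..\<pi> n} h + integral {\<pi> n..\<pi> (Suc n)} h"
      by (rule Henstock_Kurzweil_Integration.integral_combine[symmetric])
         (use pos c1 in \<open>auto intro: integrable_continuous_interval\<close>)
    have "norm (integral {\<pi> n..\<pi> (Suc n)} h - (\<pi> (Suc n) - \<pi> n) *\<^sub>R h (\<pi> n)) \<le> w * (\<pi> (Suc n) - \<pi> n)"
    proof -
      have hi: "((\<lambda>s. h s - h (\<pi> n)) has_integral integral {\<pi> n..\<pi> (Suc n)} h - (\<pi> (Suc n) - \<pi> n) *\<^sub>R h (\<pi> n)) {\<pi> n..\<pi> (Suc n)}"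
        using pos c2 by (intro has_integral_diff integrable_integral integrable_continuous_interval)
          (use has_integral_const_real[of "h (\<pi> n)" "\<pi> n" "\<pi> (Suc n)"] in auto)
      have w0: "0 \<le> w" using h(2)[OF n, of "\<pi> n"] pos by simp
      have "norm (integral {\<pi> n..\<pi> (Suc n)} h - (\<pi> (Suc n) - \<pi> n) *\<^sub>R h (\<pi> n)) \<le> w * measure lborel {\<pi> n..\<pi> (Suc n)}"
        by (rule has_integral_bound_real[OF w0 finite.emptyI hi]) (use h(2)[OF n] in simp)
      then show ?thesis using pos by simp
    qed
    then have "norm ((integral {0..\<pi> n} h - (\<Sum>j<n. (\<pi> (Suc j) - \<pi> j) *\<^sub>R h (\<pi> j)))
       + (integral {\<pi> n..\<pi> (Suc n)} h - (\<pi> (Suc n) - \<pi> n) *\<^sub>R h (\<pi> n))) \<le> w * \<pi> n + w * (\<pi> (Suc n) - \<pi> n)"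
      using Suc.IH n by (intro norm_triangle_le add_mono) auto
    then show ?case by (simp add: comb algebra_simps)
  qed
  from this[of m] have b: "norm (integral {0..v} h - (\<Sum>j<m. (\<pi> (Suc j) - \<pi> j) *\<^sub>R h (\<pi> j))) \<le> w * v" using ends by simp
  have "set_integrable lborel {0..v} h"
    by (intro borel_integrable_atLeastAtMost' continuous_on_subset[OF h(1)]) (use ends in auto)
  then have "(LINT s:{0..v}|lborel. h s) = integral {0..v} h" by (rule set_borel_integral_eq_integral(2))
  then show ?thesis using b by simp
qed

context brownian_filtration
begin

text \<open>Cutting the integrand off once its accumulated square norm exceeds \<open>\<delta>\<close> leaves the sum unchanged
  outside the second event and makes the second moment at most a multiple of \<open>\<delta>\<close>.\<close>

lemma ito_sum_tail:
  fixes T :: real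
  assumes T: "0 \<le> T"
  obtains C where "0 \<le> C"
    "\<And>m \<pi> (G :: nat \<Rightarrow> 'a \<Rightarrow> real^'q^'d) \<epsilon> \<delta>. \<lbrakk>0 \<le> \<pi> 0; \<And>j. j < m \<Longrightarrow> \<pi> j \<le> \<pi> (Suc j); \<pi> m \<le> \<pi> 0 + T;
       \<And>j. j < m \<Longrightarrow> G j \<in> borel_measurable (F (\<pi> j)); 0 < \<epsilon>; 0 < \<delta>\<rbrakk> \<Longrightarrow>
       prob {\<omega>\<in>space M. \<epsilon> < norm (ito_sum \<pi> (\<lambda>_ _. 0) G m \<omega>)}
       \<le> C * \<delta> / \<epsilon>\<^sup>2 + prob {\<omega>\<in>space M. \<delta> < (\<Sum>j<m. (\<pi> (Suc j) - \<pi> j) * (norm (G j \<omega>))\<^sup>2)}"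
proof -
  obtain K where K: "0 \<le> K"
    "\<And>m \<pi> (\<beta> :: nat \<Rightarrow> 'a \<Rightarrow> real^'d) G. \<lbrakk>0 \<le> \<pi> 0; \<And>j. j < m \<Longrightarrow> \<pi> j \<le> \<pi> (Suc j); \<pi> m \<le> \<pi> 0 + T;
       \<And>j. j < m \<Longrightarrow> \<beta> j \<in> borel_measurable (F (\<pi> j)); \<And>j. j < m \<Longrightarrow> G j \<in> borel_measurable (F (\<pi> j));
       \<And>j. j < m \<Longrightarrow> integrable M (\<lambda>\<omega>. norm (\<beta> j \<omega>) powr 2); \<And>j. j < m \<Longrightarrow> integrable M (\<lambda>\<omega>. norm (G j \<omega>) powr 2)\<rbrakk> \<Longrightarrow>
       integrable M (\<lambda>\<omega>. norm (ito_sum \<pi> \<beta> G m \<omega>) powr 2) \<and>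
       (\<integral>\<omega>. norm (ito_sum \<pi> \<beta> G m \<omega>) powr 2 \<partial>M)
       \<le> K * (\<Sum>j<m. (\<pi> (Suc j) - \<pi> j) * ((\<integral>\<omega>. norm (\<beta> j \<omega>) powr 2 \<partial>M) + (\<integral>\<omega>. norm (G j \<omega>) powr 2 \<partial>M)))"
    by (rule ito_sum_moment[of 2, OF _ T]) auto
  show thesis
  proof (rule that[OF K(1)])
    fix m \<pi> and G :: "nat \<Rightarrow> 'a \<Rightarrow> real^'q^'d" and \<epsilon> \<delta> :: real
    assume mono: "0 \<le> \<pi> 0" "\<And>j. j < m \<Longrightarrow> \<pi> j \<le> \<pi> (Suc j)" "\<pi> m \<le> \<pi> 0 + T"
      and G: "\<And>j. j < m \<Longrightarrow> G j \<in> borel_measurable (F (\<pi> j))" and pos: "0 < \<epsilon>" "0 < \<delta>"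
    let ?\<Delta> = "\<lambda>j. \<pi> (Suc j) - \<pi> j"
    let ?Q = "\<lambda>n \<omega>. \<Sum>j<n. ?\<Delta> j * (norm (G j \<omega>))\<^sup>2"
    \<comment> \<open>The sum up to \<open>Suc j\<close> includes the present term
      \<open>G j\<close>, which is known at time \<open>\<pi> j\<close>. So the cut off integrand is
      still adapted, and its accumulated square norm never exceeds \<open>\<delta>\<close>. Cells of
      length 0 are set to 0, which makes \<open>\<delta> / ?\<Delta> j\<close> a valid bound in
      every case.\<close>
    define G' where "G' = (\<lambda>j \<omega>. if \<pi> j < \<pi> (Suc j) \<and> ?Q (Suc j) \<omega> \<le> \<delta> then G j \<omega> else 0)"
    have mon: "\<pi> i \<le> \<pi> k" if "i \<le> k" "k \<le> m" for i k
      by (rule partition_mono[of m \<pi> i k, OF mono(2) that])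
    have p0: "0 \<le> \<pi> j" if "j \<le> m" for j using mon[of 0 j] mono(1) that by simp
    have GF: "G i \<in> borel_measurable (F (\<pi> j))" if "i \<le> j" "j < m" for i j
      using measurable_F_mono[OF p0[of i] mon[of i j] G[of i]] that by simp
    have QF: "?Q n \<in> borel_measurable (F (\<pi> j))" if "n \<le> Suc j" "j < m" for n j
      by (intro borel_measurable_sum borel_measurable_times borel_measurable_const borel_measurable_power
          measurable_compose[OF _ borel_measurable_norm] GF) (use that in auto)
    have G'F: "G' j \<in> borel_measurable (F (\<pi> j))" if "j < m" for j
    proof -
      note [measurable] = QF[OF le_refl that] GF[OF le_refl that]
      show ?thesis unfolding G'_def by measurable
    qed
    have GM: "G j \<in> borel_measurable M" if "j < m" for j
      using measurable_F[OF p0[of j] G[of j]] that by simp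
    have G'M: "G' j \<in> borel_measurable M" if "j < m" for j
      using measurable_F[OF p0[of j] G'F[of j]] that by simp
    have \<Delta>: "0 \<le> ?\<Delta> j" if "j < m" for j using mono(2)[OF that] by simp
    have sumG': "(\<Sum>j<n. ?\<Delta> j * (norm (G' j \<omega>))\<^sup>2) \<le> \<delta>" if "n \<le> m" for n \<omega>
      using that
    proof (induction n)
      case 0
      then show ?case using pos by simp
    next
      case (Suc n)
      show ?case
      proof (cases "?Q (Suc n) \<omega> \<le> \<delta>")
        case True
        have "(\<Sum>j<Suc n. ?\<Delta> j * (norm (G' j \<omega>))\<^sup>2) \<le> ?Q (Suc n) \<omega>"
          using Suc.prems by (intro sum_mono mult_left_mono \<Delta>) (auto simp: G'_def)
        with True show ?thesis by simp
      next
        case False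
        then have "G' n \<omega> = 0" by (auto simp: G'_def)
        with Suc show ?thesis by simp
      qed
    qed
    have G'i: "integrable M (\<lambda>\<omega>. norm (G' j \<omega>) powr 2)" if j: "j < m" for j
    proof (rule integrable_if_bounded)
      show "integrable M (\<lambda>\<omega>. \<delta> / ?\<Delta> j)" by simp
      show "(\<lambda>\<omega>. norm (G' j \<omega>) powr 2) \<in> borel_measurable M" using G'M[OF j] by measurable
      fix \<omega>
      show "\<bar>norm (G' j \<omega>) powr 2\<bar> \<le> \<delta> / ?\<Delta> j"
      proof (cases "\<pi> j < \<pi> (Suc j)")
        case True
        have "?\<Delta> j * (norm (G' j \<omega>))\<^sup>2 \<le> (\<Sum>j<Suc j. ?\<Delta> j * (norm (G' j \<omega>))\<^sup>2)"
          using j by (intro member_le_sum[of j "{..<Suc j}" "\<lambda>j. ?\<Delta> j * (norm (G' j \<omega>))\<^sup>2"]) (auto intro!: mult_nonneg_nonneg \<Delta>)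
        also have "\<dots> \<le> \<delta>" using sumG'[of "Suc j"] j by simp
        finally show ?thesis using True by (simp add: powr_numeral field_simps)
      next
        case False
        then show ?thesis using \<Delta>[OF j] by (simp add: G'_def)
      qed
    qed
    have mom: "integrable M (\<lambda>\<omega>. norm (ito_sum \<pi> (\<lambda>_ _. 0 :: real^'d) G' m \<omega>) powr 2)"
       "(\<integral>\<omega>. norm (ito_sum \<pi> (\<lambda>_ _. 0 :: real^'d) G' m \<omega>) powr 2 \<partial>M) \<le> K * (\<Sum>j<m. ?\<Delta> j * (\<integral>\<omega>. norm (G' j \<omega>) powr 2 \<partial>M))"
      using K(2)[of \<pi> m "\<lambda>_ _. 0" G'] mono G'F G'i by auto
    have "(\<Sum>j<m. ?\<Delta> j * (\<integral>\<omega>. norm (G' j \<omega>) powr 2 \<partial>M)) = (\<integral>\<omega>. (\<Sum>j<m. ?\<Delta> j * (norm (G' j \<omega>)) powr 2) \<partial>M)"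
      using G'i by (subst Bochner_Integration.integral_sum) auto
    also have "\<dots> \<le> (\<integral>\<omega>. \<delta> \<partial>M)"
      using G'i sumG'[OF le_refl] by (intro integral_mono Bochner_Integration.integrable_sum integrable_mult_right) auto
    finally have "(\<Sum>j<m. ?\<Delta> j * (\<integral>\<omega>. norm (G' j \<omega>) powr 2 \<partial>M)) \<le> \<delta>" by (simp add: prob_space)
    then have le: "(\<integral>\<omega>. norm (ito_sum \<pi> (\<lambda>_ _. 0 :: real^'d) G' m \<omega>) powr 2 \<partial>M) \<le> K * \<delta>"
      using mom(2) K(1) by (meson mult_left_mono order_trans)
    have im: "ito_sum \<pi> (\<lambda>_ _. 0 :: real^'d) G' m \<in> borel_measurable M"
      using measurable_F[OF p0[of m] ito_sum_measurable_F[OF mono(1,2) _ G'F, of m]] by simp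
    have QM: "?Q m \<in> borel_measurable M"
      by (intro borel_measurable_sum borel_measurable_times borel_measurable_const borel_measurable_power
          measurable_compose[OF _ borel_measurable_norm] GM) auto
    have agree: "ito_sum \<pi> (\<lambda>_ _. 0 :: real^'d) G m \<omega> = ito_sum \<pi> (\<lambda>_ _. 0) G' m \<omega>" if "?Q m \<omega> \<le> \<delta>" for \<omega>
      unfolding ito_sum_def
    proof (rule sum.cong[OF refl])
      fix j assume "j \<in> {..<m}"
      then have j: "j < m" by simp
      have "?Q (Suc j) \<omega> \<le> ?Q m \<omega>"
        using j by (intro sum_mono2) (auto intro!: mult_nonneg_nonneg \<Delta>)
      then have "G' j \<omega> = (if \<pi> j < \<pi> (Suc j) then G j \<omega> else 0)" using that by (auto simp: G'_def)
      then show "?\<Delta> j *\<^sub>R (0 :: real^'d) + G j \<omega> *v (B (\<pi> (Suc j)) \<omega> - B (\<pi> j) \<omega>)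
        = ?\<Delta> j *\<^sub>R 0 + G' j \<omega> *v (B (\<pi> (Suc j)) \<omega> - B (\<pi> j) \<omega>)"
        using mono(2)[OF j] by (cases "\<pi> j = \<pi> (Suc j)") auto
    qed
    let ?E = "{\<omega>\<in>space M. \<epsilon>\<^sup>2 \<le> norm (ito_sum \<pi> (\<lambda>_ _. 0 :: real^'d) G' m \<omega>) powr 2}"
    let ?E2 = "{\<omega>\<in>space M. \<delta> < ?Q m \<omega>}"
    have "prob {\<omega>\<in>space M. \<epsilon> < norm (ito_sum \<pi> (\<lambda>_ _. 0 :: real^'d) G m \<omega>)} \<le> prob (?E \<union> ?E2)"
    proof (rule finite_measure_mono)
      show "{\<omega>\<in>space M. \<epsilon> < norm (ito_sum \<pi> (\<lambda>_ _. 0 :: real^'d) G m \<omega>)} \<subseteq> ?E \<union> ?E2"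
      proof safe
        fix \<omega> assume \<omega>: "\<omega> \<in> space M" "\<epsilon> < norm (ito_sum \<pi> (\<lambda>_ _. 0 :: real^'d) G m \<omega>)"
          and "\<not> \<delta> < ?Q m \<omega>"
        then have "\<epsilon> < norm (ito_sum \<pi> (\<lambda>_ _. 0 :: real^'d) G' m \<omega>)" using agree by simp
        then show "\<epsilon>\<^sup>2 \<le> norm (ito_sum \<pi> (\<lambda>_ _. 0 :: real^'d) G' m \<omega>) powr 2"
          using pos by (simp add: powr_numeral power_mono)
      qed
      show "?E \<union> ?E2 \<in> sets M" using im QM by measurable
    qed
    also have "\<dots> \<le> prob ?E + prob ?E2"
      by (rule measure_Un_le) (use im QM in measurable)
    also have "prob ?E \<le> (\<integral>\<omega>. norm (ito_sum \<pi> (\<lambda>_ _. 0 :: real^'d) G' m \<omega>) powr 2 \<partial>M) / \<epsilon>\<^sup>2"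
      by (rule integral_Markov_inequality_measure[OF mom(1) sets.empty_sets]) (use pos in auto)
    also have "\<dots> \<le> K * \<delta> / \<epsilon>\<^sup>2" by (rule divide_right_mono[OF le]) simp
    finally show "prob {\<omega>\<in>space M. \<epsilon> < norm (ito_sum \<pi> (\<lambda>_ _. 0 :: real^'d) G m \<omega>)}
       \<le> K * \<delta> / \<epsilon>\<^sup>2 + prob ?E2" by simp
  qed
qed

end

section \<open>The Ito integral as a limit of Riemann sums\<close>

lemma uniform_modulus:
  fixes h :: "real \<Rightarrow> 'v::euclidean_space"
  assumes "continuous_on {0..T} h" "0 < e"
  obtains d where "0 < d" "\<And>s t. s \<in> {0..T} \<Longrightarrow> t \<in> {0..T} \<Longrightarrow> \<bar>s - t\<bar> < d \<Longrightarrow> norm (h s - h t) \<le> e"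
proof -
  have "uniformly_continuous_on {0..T} h" using assms(1) by (rule compact_uniformly_continuous) simp
  then obtain d where "0 < d" "\<And>x x'. x \<in> {0..T} \<Longrightarrow> x' \<in> {0..T} \<Longrightarrow> dist x' x < d \<Longrightarrow> dist (h x') (h x) < e"
    using assms(2) unfolding uniformly_continuous_on_def by metis
  then show thesis by (intro that[of d]) (auto simp: dist_norm dist_real_def less_imp_le)
qed

context brownian_filtration
begin

text \<open>On a cell from \<open>s\<close> to \<open>u\<close> without jump times inside, the value
  at \<open>u\<close> was fixed at a time not after \<open>s\<close>. This makes the simple process
  admissible as a coefficient at the left end of the cell.\<close>

lemma simple_process_measurable:
  fixes \<eta> :: "nat \<Rightarrow> 'a \<Rightarrow> real^'q^'d"
  assumes sd: "simple_data F T n \<tau> \<eta>"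
  shows "i \<le> n \<Longrightarrow> 0 \<le> \<tau> i"
    and "0 \<le> s \<Longrightarrow> (\<And>i. i < n \<Longrightarrow> \<tau> i < u \<Longrightarrow> \<tau> i \<le> s) \<Longrightarrow> simple_process n \<tau> \<eta> u \<in> borel_measurable (F s)"
    and "(\<lambda>u. simple_process n \<tau> \<eta> u \<omega>) \<in> borel_measurable borel"
proof -
  have mono: "\<tau> j \<le> \<tau> (Suc j)" if "j < n" for j using sd that by (auto simp: simple_data_def less_imp_le)
  show t0: "i \<le> n \<Longrightarrow> 0 \<le> \<tau> i" for i
    using partition_mono[of n \<tau> 0 i, OF mono] sd by (auto simp: simple_data_def)
  show "(\<lambda>u. simple_process n \<tau> \<eta> u \<omega>) \<in> borel_measurable borel"
    unfolding simple_process_def by measurable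
  assume s: "0 \<le> s" "\<And>i. i < n \<Longrightarrow> \<tau> i < u \<Longrightarrow> \<tau> i \<le> s"
  have "(\<lambda>\<omega>. indicat_real {\<tau> i<..\<tau> (Suc i)} u *\<^sub>R \<eta> i \<omega>) \<in> borel_measurable (F s)" if i: "i < n" for i
  proof (cases "\<tau> i < u")
    case True
    have "\<eta> i \<in> borel_measurable (F (\<tau> i))" using sd i by (auto simp: simple_data_def)
    from measurable_F_mono[OF t0[of i] s(2)[OF i True] this] i
    have [measurable]: "\<eta> i \<in> borel_measurable (F s)" by simp
    show ?thesis by measurable
  next
    case False
    then have "indicat_real {\<tau> i<..\<tau> (Suc i)} u = 0" by simp
    then show ?thesis by simp
  qed
  then have "(\<lambda>\<omega>. \<Sum>i<n. indicat_real {\<tau> i<..\<tau> (Suc i)} u *\<^sub>R \<eta> i \<omega>) \<in> borel_measurable (F s)"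
    by (intro borel_measurable_sum) auto
  then show "simple_process n \<tau> \<eta> u \<in> borel_measurable (F s)"
    by (simp add: simple_process_def[abs_def])
qed

text \<open>The partitions refine the jump times of the simple processes from the definition, so
  that the simple integral is an exact Ito sum along them. Its difference to the Riemann sum of
  \<open>H\<close> is again an Ito sum, whose accumulated square norm tends to 0 almost surely;
  \<open>ito_sum_tail\<close> turns this into convergence in probability, and a subsequence
  converges almost surely. The set \<open>A\<close> allows any given coarse partition to be
  refined.\<close>

lemma ito_integral_riemann:
  fixes H :: "real \<Rightarrow> 'a \<Rightarrow> real^'q^'d"
  assumes ito: "is_ito_integral M F B T H J"
    and H: "\<And>s. s \<in> {0..T} \<Longrightarrow> H s \<in> borel_measurable (F s)" "\<And>\<omega>. \<omega> \<in> space M \<Longrightarrow> continuous_on {0..T} (\<lambda>s. H s \<omega>)"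
    and v: "v \<in> {0..T}" and A: "finite A" "A \<subseteq> {0..v}"
  obtains m \<pi> where "\<And>k. \<pi> k 0 = 0" "\<And>k. \<pi> k (m k) = v" "\<And>k j. j < m k \<Longrightarrow> \<pi> k j < \<pi> k (Suc j)"
    "\<And>k. A \<subseteq> \<pi> k ` {..m k}" "\<And>k j. j < m k \<Longrightarrow> \<pi> k (Suc j) - \<pi> k j \<le> v / real (Suc k)"
    "AE \<omega> in M. (\<lambda>k. ito_sum (\<pi> k) (\<lambda>_ _. 0) (\<lambda>j. H (\<pi> k j)) (m k) \<omega>) \<longlonglongrightarrow> J v \<omega>"
proof -
  have v': "0 \<le> v" "v \<le> T" "0 \<le> T" using v by auto
  from ito obtain n0 \<tau>0 \<eta>0 where sd0: "\<And>k. simple_data F T (n0 k) (\<tau>0 k) (\<eta>0 k)"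
    and nul1: "null_in_probability M (\<lambda>k \<omega>.
          \<integral>\<^sup>+s\<in>{0..T}. ennreal ((norm (simple_process (n0 k) (\<tau>0 k) (\<eta>0 k) s \<omega> - H s \<omega>))\<^sup>2) \<partial>lborel)"
    and nul2: "null_in_probability M (\<lambda>k \<omega>.
          SUP t\<in>{0..T}. ennreal (norm (simple_integral B (n0 k) (\<tau>0 k) (\<eta>0 k) t \<omega> - J t \<omega>)))"
    unfolding is_ito_integral_def by blast
  let ?Z1 = "\<lambda>k \<omega>. \<integral>\<^sup>+s\<in>{0..T}. ennreal ((norm (simple_process (n0 k) (\<tau>0 k) (\<eta>0 k) s \<omega> - H s \<omega>))\<^sup>2) \<partial>lborel"
  let ?Z2 = "\<lambda>k \<omega>. SUP t\<in>{0..T}. ennreal (norm (simple_integral B (n0 k) (\<tau>0 k) (\<eta>0 k) t \<omega> - J t \<omega>))"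
  obtain r1 where r1: "strict_mono r1" "AE \<omega> in M. (\<lambda>k. ?Z1 (r1 k) \<omega>) \<longlonglongrightarrow> 0"
    by (rule null_in_probability_AE_subseq[OF nul1]) (rule that)
  \<comment> \<open>A second subsequence inside the first makes both convergences almost sure at
    once.\<close>
  obtain r2 where r2: "strict_mono r2" "AE \<omega> in M. (\<lambda>k. ?Z2 (r1 (r2 k)) \<omega>) \<longlonglongrightarrow> 0"
    by (rule null_in_probability_AE_subseq[OF null_in_probability_subseq[OF nul2 r1(1)]]) (rule that)
  define n where "n = (\<lambda>k. n0 (r1 (r2 k)))"
  define \<tau> where "\<tau> = (\<lambda>k. \<tau>0 (r1 (r2 k)))"
  define \<eta> where "\<eta> = (\<lambda>k. \<eta>0 (r1 (r2 k)))"
  have sd: "simple_data F T (n k) (\<tau> k) (\<eta> k)" for k using sd0 by (simp add: n_def \<tau>_def \<eta>_def)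
  let ?S = "\<lambda>k s \<omega>. simple_process (n k) (\<tau> k) (\<eta> k) s \<omega>"
  have Z1: "AE \<omega> in M. (\<lambda>k. \<integral>\<^sup>+s\<in>{0..T}. ennreal ((norm (?S k s \<omega> - H s \<omega>))\<^sup>2) \<partial>lborel) \<longlonglongrightarrow> 0"
    using r1(2)
  proof eventually_elim
    case (elim \<omega>)
    from LIMSEQ_subseq_LIMSEQ[OF elim r2(1)] show ?case by (simp add: comp_def n_def \<tau>_def \<eta>_def)
  qed
  have Z2: "AE \<omega> in M. (\<lambda>k. simple_integral B (n k) (\<tau> k) (\<eta> k) v \<omega>) \<longlonglongrightarrow> J v \<omega>"
    using r2(2)
  proof eventually_elim
    case (elim \<omega>)
    have "(\<lambda>k. ennreal (norm (simple_integral B (n k) (\<tau> k) (\<eta> k) v \<omega> - J v \<omega>))) \<longlonglongrightarrow> 0"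
    proof (rule tendsto_sandwich[OF _ _ tendsto_const elim])
      show "\<forall>\<^sub>F k in sequentially. ennreal (norm (simple_integral B (n k) (\<tau> k) (\<eta> k) v \<omega> - J v \<omega>)) \<le> ?Z2 (r1 (r2 k)) \<omega>"
        using v by (intro always_eventually allI SUP_upper2[of v]) (auto simp: n_def \<tau>_def \<eta>_def)
    qed simp
    then have "(\<lambda>k. ennreal (norm (simple_integral B (n k) (\<tau> k) (\<eta> k) v \<omega> - J v \<omega>))) \<longlonglongrightarrow> ennreal 0" by simp
    then have "(\<lambda>k. norm (simple_integral B (n k) (\<tau> k) (\<eta> k) v \<omega> - J v \<omega>)) \<longlonglongrightarrow> 0"
      by (subst (asm) tendsto_ennreal_iff) auto
    then show ?case by (rule Lim_null[THEN iffD2, OF tendsto_norm_zero_cancel])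
  qed
  define R :: "nat \<Rightarrow> nat \<Rightarrow> (nat \<Rightarrow> real) \<Rightarrow> bool" where
    "R = (\<lambda>k m \<pi>. \<pi> 0 = 0 \<and> \<pi> m = v \<and> (\<forall>j<m. \<pi> j < \<pi> (Suc j)) \<and> A \<subseteq> \<pi> ` {..m} \<and>
      (\<forall>i\<le>n k. min v (\<tau> k i) \<in> \<pi> ` {..m}) \<and> (\<forall>j<m. \<pi> (Suc j) - \<pi> j \<le> v / real (Suc k)))"
  have "\<exists>m \<pi>. R k m \<pi>" for k
  proof -
    \<comment> \<open>The jump times, cut off at \<open>v\<close>, make the simple integral an exact
      sum; the multiples of \<open>v / (k + 1)\<close> bound the mesh.\<close>
    let ?P = "A \<union> {0, v} \<union> (\<lambda>i. min v (\<tau> k i)) ` {..n k} \<union> (\<lambda>i. v * real i / real (Suc k)) ` {..Suc k}"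
    have sub: "?P \<subseteq> {0..v}"
    proof (intro Un_least image_subsetI)
      show "min v (\<tau> k i) \<in> {0..v}" if "i \<in> {..n k}" for i
        using v' simple_process_measurable(1)[OF sd[of k], of i] that by simp
      show "v * real i / real (Suc k) \<in> {0..v}" if "i \<in> {..Suc k}" for i
      proof -
        have "v * real i \<le> v * real (Suc k)" using that v' by (intro mult_left_mono) auto
        then show ?thesis using v' by (simp add: divide_le_eq)
      qed
    qed (use A v' in auto)
    have fin: "finite ?P" using A(1) by simp
    have mem: "0 \<in> ?P" "v \<in> ?P" by simp_all
    obtain m \<pi> where mp: "\<pi> 0 = 0" "\<pi> m = v" "\<And>j. j < m \<Longrightarrow> \<pi> j < \<pi> (Suc j)" "\<pi> ` {..m} = ?P"
      by (rule strict_partition_exists[OF fin sub mem]) (rule that)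
    have grid: "v * real i / real (Suc k) \<in> \<pi> ` {..m}" if "i \<le> Suc k" for i
      unfolding mp(4) using that by (intro UnI2 imageI) simp
    have "\<pi> (Suc j) - \<pi> j \<le> v / real (Suc k)" if "j < m" for j
      by (rule partition_mesh_le[OF mp(3,1,2) zero_less_Suc grid that])
    moreover have "A \<subseteq> \<pi> ` {..m}" unfolding mp(4) by (intro Un_upper1 le_supI1)
    moreover have "min v (\<tau> k i) \<in> \<pi> ` {..m}" if "i \<le> n k" for i
      unfolding mp(4) using that by (intro UnI1[OF UnI2] imageI) simp
    ultimately have "R k m \<pi>" unfolding R_def using mp(1-3) by (intro conjI allI impI)
    then show ?thesis by (intro exI)
  qed
  then obtain m \<pi> where "\<And>k. R k (m k) (\<pi> k)" by metis
  note Rk = this[unfolded R_def]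
  have P: "\<And>k. \<pi> k 0 = 0" "\<And>k. \<pi> k (m k) = v" "\<And>k j. j < m k \<Longrightarrow> \<pi> k j < \<pi> k (Suc j)"
    "\<And>k. A \<subseteq> \<pi> k ` {..m k}" "\<And>k i. i \<le> n k \<Longrightarrow> min v (\<tau> k i) \<in> \<pi> k ` {..m k}"
    "\<And>k j. j < m k \<Longrightarrow> \<pi> k (Suc j) - \<pi> k j \<le> v / real (Suc k)"
    subgoal for k using Rk[of k] by (elim conjE)
    subgoal for k using Rk[of k] by (elim conjE)
    subgoal for k j using conjunct1[OF conjunct2[OF conjunct2[OF Rk[of k]]]] by (elim allE[of _ j] impE)
    subgoal for k using Rk[of k] by (elim conjE)
    subgoal for k i using conjunct1[OF conjunct2[OF conjunct2[OF conjunct2[OF conjunct2[OF Rk[of k]]]]]] by (elim allE[of _ i] impE)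
    subgoal for k j using conjunct2[OF conjunct2[OF conjunct2[OF conjunct2[OF conjunct2[OF Rk[of k]]]]]] by (elim allE[of _ j] impE)
    done
  have le: "\<pi> k i \<le> \<pi> k j" if "i \<le> j" "j \<le> m k" for k i j
    by (rule partition_mono[of "m k" "\<pi> k" i j, OF less_imp_le[OF P(3)] that])
  have pT: "\<pi> k j \<in> {0..T}" if "j \<le> m k" for k j
    using le[of 0 j k] le[of j "m k" k] that P(1)[of k] P(2)[of k] v' by auto
  \<comment> \<open>The simple process is read at the right end of the cell, its intervals being
    open on the left, while \<open>H\<close> is taken at the left end. Both are
    \<open>F (\<pi> k j)\<close>-measurable, as no jump time lies inside the cell.\<close>
  define D where "D = (\<lambda>k j \<omega>. H (\<pi> k j) \<omega> - ?S k (\<pi> k (Suc j)) \<omega>)"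
  have \<tau>_le: "\<tau> k i \<le> \<pi> k j" if "j < m k" "i \<le> n k" "\<tau> k i < \<pi> k (Suc j)" for k i j
  proof -
    have "\<pi> k (Suc j) \<le> v" using le[of "Suc j" "m k" k] that P(2)[of k] by simp
    then have mv: "min v (\<tau> k i) = \<tau> k i" using that by simp
    show ?thesis
      using partition_point_le(1)[of "m k" "\<pi> k", OF P(3) P(5)[OF that(2)] that(1)] that(3) unfolding mv by simp
  qed
  have DF: "D k j \<in> borel_measurable (F (\<pi> k j))" if "j < m k" for k j
  proof -
    have [measurable]: "H (\<pi> k j) \<in> borel_measurable (F (\<pi> k j))" using pT[of j k] that by (intro H) auto
    have [measurable]: "?S k (\<pi> k (Suc j)) \<in> borel_measurable (F (\<pi> k j))"
      using pT[of j k] that by (intro simple_process_measurable(2)[OF sd]) (auto intro!: \<tau>_le)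
    show ?thesis unfolding D_def by measurable
  qed
  have diff: "ito_sum (\<pi> k) (\<lambda>_ _. 0) (\<lambda>j. H (\<pi> k j)) (m k) \<omega> =
      ito_sum (\<pi> k) (\<lambda>_ _. 0) (D k) (m k) \<omega> + simple_integral B (n k) (\<tau> k) (\<eta> k) v \<omega>" for k \<omega>
  proof -
    have "simple_integral B (n k) (\<tau> k) (\<eta> k) v \<omega> = (\<Sum>j<m k. ?S k (\<pi> k (Suc j)) \<omega> *v (B (\<pi> k (Suc j)) \<omega> - B (\<pi> k j) \<omega>))"
      unfolding simple_integral_def simple_process_def
      by (rule partition_refine_matrix[OF P(3) P(2) _ P(5)])
         (use sd[of k] in \<open>auto simp: simple_data_def less_imp_le\<close>)
    then show ?thesis
      by (simp add: ito_sum_def D_def matrix_vector_mult_diff_rdistrib sum_subtractf)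
  qed
  define Q where "Q = (\<lambda>k \<omega>. \<Sum>j<m k. (\<pi> k (Suc j) - \<pi> k j) * (norm (D k j \<omega>))\<^sup>2)"
  have DM: "D k j \<in> borel_measurable M" if "j < m k" for k j
    using measurable_F[OF _ DF[OF that]] pT[of j k] that by simp
  have QM: "Q k \<in> borel_measurable M" for k
    unfolding Q_def by (intro borel_measurable_sum borel_measurable_times borel_measurable_const borel_measurable_power
          measurable_compose[OF _ borel_measurable_norm] DM) auto
  have Q0: "0 \<le> Q k \<omega>" for k \<omega>
    unfolding Q_def using P(3) by (intro sum_nonneg mult_nonneg_nonneg) (auto intro: less_imp_le)
  have "AE \<omega> in M. (\<lambda>k. Q k \<omega>) \<longlonglongrightarrow> 0"
    using Z1 AE_space
  proof eventually_elim
    case (elim \<omega>)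
    note \<omega> = elim(2)
    have "(\<lambda>k. ennreal (Q k \<omega>)) \<longlonglongrightarrow> 0"
    proof (rule order_tendstoI)
      fix x :: ennreal assume "0 < x"
      then obtain y where y: "0 < y" "y < x" using dense by blast
      then obtain e where "y = ennreal e" by (cases y) auto
      with y have e: "0 < e" "ennreal e < x" by auto
      \<comment> \<open>Half of \<open>e\<close> is reserved for the oscillation of \<open>H\<close>
        and half for its distance to the simple process; \<open>v + 1\<close> keeps the quotient
        defined for \<open>v = 0\<close>.\<close>
      obtain w where w: "0 < w" "2 * w\<^sup>2 * v < e / 2"
      proof (rule that)
        have "0 < e / (8 * (v + 1))" using e v' by simp
        then show "0 < sqrt (e / (8 * (v + 1)))" by simp
        have "2 * (e / (8 * (v + 1))) * v < e / 2" using e v' by (simp add: field_simps add_pos_nonneg)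
        then show "2 * (sqrt (e / (8 * (v + 1))))\<^sup>2 * v < e / 2" using e v' by simp
      qed
      obtain d where d: "0 < d" "\<And>s t. s \<in> {0..T} \<Longrightarrow> t \<in> {0..T} \<Longrightarrow> \<bar>s - t\<bar> < d \<Longrightarrow> norm (H s \<omega> - H t \<omega>) \<le> w"
        using uniform_modulus[OF H(2)[OF \<omega>] w(1)] by metis
      have "(\<lambda>k. v / real (Suc k)) \<longlonglongrightarrow> 0"
        by (rule LIMSEQ_Suc[OF lim_const_over_n])
      then have ev1: "\<forall>\<^sub>F k in sequentially. v / real (Suc k) < d" using d(1) by (rule order_tendstoD)
      have ev2: "\<forall>\<^sub>F k in sequentially. (\<integral>\<^sup>+s\<in>{0..T}. ennreal ((norm (?S k s \<omega> - H s \<omega>))\<^sup>2) \<partial>lborel) < ennreal (e / 4)"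
        using elim(1) by (rule order_tendstoD) (use e in simp)
      show "\<forall>\<^sub>F k in sequentially. ennreal (Q k \<omega>) < x"
        using ev1 ev2
      proof eventually_elim
        case (elim k)
        have "ennreal (Q k \<omega>) \<le> 2 * (\<integral>\<^sup>+s\<in>{0..T}. ennreal ((norm (?S k s \<omega> - H s \<omega>))\<^sup>2) \<partial>lborel) + ennreal (2 * w\<^sup>2 * v)"
          unfolding Q_def D_def
        proof (rule partition_L2_bound[OF P(3,1,2) v'(2) simple_process_measurable(3)[OF sd] _ H(2)[OF \<omega>]])
          show "?S k s \<omega> = ?S k (\<pi> k (Suc j)) \<omega>" if j: "j < m k" and s: "s \<in> {\<pi> k j<..\<pi> k (Suc j)}" for j s
          proof -
            have eq: "\<tau> k i < s \<longleftrightarrow> \<tau> k i < \<pi> k (Suc j)" if "i \<le> n k" for i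
              using \<tau>_le[OF j that] s by auto
            have "indicat_real {\<tau> k i<..\<tau> k (Suc i)} s = indicat_real {\<tau> k i<..\<tau> k (Suc i)} (\<pi> k (Suc j))" if "i < n k" for i
              using eq[of i] eq[of "Suc i"] that by (auto simp: indicator_def not_less[symmetric])
            then show ?thesis by (simp add: simple_process_def)
          qed
          show "norm (H s \<omega> - H (\<pi> k j) \<omega>) \<le> w" if j: "j < m k" and s: "s \<in> {\<pi> k j<..\<pi> k (Suc j)}" for j s
            using s P(6)[OF j] elim(1) pT[of j k] pT[of "Suc j" k] j by (intro d(2)) auto
        qed (use w in auto)
        also have "\<dots> \<le> 2 * ennreal (e / 4) + ennreal (e / 2)"
          using elim(2) w(2) by (intro add_mono mult_left_mono ennreal_leI) auto
        also have "\<dots> = ennreal e"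
        proof -
          have "2 * ennreal (e / 4) = ennreal (2 * (e / 4))" using e(1) by (simp only: ennreal_mult' ennreal_numeral[symmetric] zero_le_numeral)
          then show ?thesis using e(1) by (simp add: ennreal_plus[symmetric] del: ennreal_plus)
        qed
        also have "\<dots> < x" by (rule e)
        finally show ?case .
      qed
    qed simp
    then have "(\<lambda>k. ennreal (Q k \<omega>)) \<longlonglongrightarrow> ennreal 0" by simp
    then show ?case by (subst (asm) tendsto_ennreal_iff) (auto simp: Q0)
  qed
  note Qlim = AE_tendsto_0_imp_prob[OF QM this]
  obtain C where C: "0 \<le> C"
    "\<And>m \<pi> (G :: nat \<Rightarrow> 'a \<Rightarrow> real^'q^'d) \<epsilon> \<delta>. \<lbrakk>0 \<le> \<pi> 0; \<And>j. j < m \<Longrightarrow> \<pi> j \<le> \<pi> (Suc j); \<pi> m \<le> \<pi> 0 + T;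
       \<And>j. j < m \<Longrightarrow> G j \<in> borel_measurable (F (\<pi> j)); 0 < \<epsilon>; 0 < \<delta>\<rbrakk> \<Longrightarrow>
       prob {\<omega>\<in>space M. \<epsilon> < norm (ito_sum \<pi> (\<lambda>_ _. 0) G m \<omega>)}
       \<le> C * \<delta> / \<epsilon>\<^sup>2 + prob {\<omega>\<in>space M. \<delta> < (\<Sum>j<m. (\<pi> (Suc j) - \<pi> j) * (norm (G j \<omega>))\<^sup>2)}"
    by (rule ito_sum_tail[OF v'(3)]) blast
  let ?I = "\<lambda>k. ito_sum (\<pi> k) (\<lambda>_ _. 0) (D k) (m k) :: 'a \<Rightarrow> real^'d"
  have IM: "?I k \<in> borel_measurable M" for k
  proof -
    have "?I k \<in> borel_measurable (F (\<pi> k (m k)))"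
      by (rule ito_sum_measurable_F[where m = "m k"]) (auto simp: P(1) intro!: less_imp_le P(3) DF)
    then show ?thesis using measurable_F[of "\<pi> k (m k)"] pT[of "m k" k] by simp
  qed
  have Inull: "null_in_probability M (\<lambda>k \<omega>. ennreal (norm (?I k \<omega>)))"
    unfolding null_in_probability_def
  proof (intro conjI allI impI)
    show "(\<lambda>\<omega>. ennreal (norm (?I k \<omega>))) \<in> borel_measurable M" for k using IM[of k] by measurable
    fix \<epsilon> :: real assume \<epsilon>: "0 < \<epsilon>"
    show "(\<lambda>k. prob {\<omega> \<in> space M. ennreal \<epsilon> < ennreal (norm (?I k \<omega>))}) \<longlonglongrightarrow> 0"
    proof (rule LIMSEQ_I)
      fix e :: real assume e: "0 < e"
      \<comment> \<open>Chosen so that the Chebyshev term \<open>C * \<delta> / \<epsilon>^2\<close>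
        is at most \<open>e / 2\<close>; the second event is small for large \<open>k\<close> with
        this fixed \<open>\<delta>\<close>.\<close>
      define \<delta> where "\<delta> = e * \<epsilon>\<^sup>2 / (2 * (C + 1))"
      have \<delta>: "0 < \<delta>" using e \<epsilon> C(1) by (simp add: \<delta>_def)
      have C\<delta>: "C * \<delta> / \<epsilon>\<^sup>2 \<le> e / 2"
      proof -
        have "C * \<delta> / \<epsilon>\<^sup>2 = e / 2 * (C / (C + 1))" using \<epsilon> by (simp add: \<delta>_def)
        also have "\<dots> \<le> e / 2 * 1" using e C(1) by (intro mult_left_mono) auto
        finally show ?thesis by simp
      qed
      obtain N where N: "\<And>k. N \<le> k \<Longrightarrow> prob {\<omega>\<in>space M. \<delta> < Q k \<omega>} < e / 2"
        using LIMSEQ_D[OF Qlim[OF \<delta>], of "e / 2"] e by force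
      have "prob {\<omega> \<in> space M. ennreal \<epsilon> < ennreal (norm (?I k \<omega>))} < e" if "N \<le> k" for k
      proof -
        have "{\<omega> \<in> space M. ennreal \<epsilon> < ennreal (norm (?I k \<omega>))} = {\<omega> \<in> space M. \<epsilon> < norm (?I k \<omega>)}"
          using \<epsilon> by (auto simp: ennreal_less_iff)
        then have "prob {\<omega> \<in> space M. ennreal \<epsilon> < ennreal (norm (?I k \<omega>))} = prob {\<omega> \<in> space M. \<epsilon> < norm (?I k \<omega>)}"
          by (rule arg_cong)
        moreover have "prob {\<omega> \<in> space M. \<epsilon> < norm (?I k \<omega>)} \<le> C * \<delta> / \<epsilon>\<^sup>2 + prob {\<omega>\<in>space M. \<delta> < Q k \<omega>}"
          using C(2)[of "\<pi> k" "m k" "D k" \<epsilon> \<delta>] P(1)[of k] P(2)[of k] v' DF less_imp_le[OF P(3)] \<epsilon> \<delta>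
          by (simp add: Q_def)
        ultimately show ?thesis using C\<delta> N[OF that] by linarith
      qed
      then show "\<exists>N. \<forall>k\<ge>N. norm (prob {\<omega> \<in> space M. ennreal \<epsilon> < ennreal (norm (?I k \<omega>))} - 0) < e"
        by (intro exI[of _ N]) auto
    qed
  qed
  obtain r where r: "strict_mono r" "AE \<omega> in M. (\<lambda>k. ennreal (norm (?I (r k) \<omega>))) \<longlonglongrightarrow> 0"
    by (rule null_in_probability_AE_subseq[OF Inull]) (rule that)
  show thesis
  proof (rule that[of "\<lambda>k. \<pi> (r k)" "\<lambda>k. m (r k)"])
    show "AE \<omega> in M. (\<lambda>k. ito_sum (\<pi> (r k)) (\<lambda>_ _. 0) (\<lambda>j. H (\<pi> (r k) j)) (m (r k)) \<omega>) \<longlonglongrightarrow> J v \<omega>"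
      using r(2) Z2
    proof eventually_elim
      case (elim \<omega>)
      then have "(\<lambda>k. ennreal (norm (?I (r k) \<omega>))) \<longlonglongrightarrow> ennreal 0" by simp
      then have "(\<lambda>k. norm (?I (r k) \<omega>)) \<longlonglongrightarrow> 0" by (subst (asm) tendsto_ennreal_iff) auto
      then have "(\<lambda>k. ?I (r k) \<omega>) \<longlonglongrightarrow> 0" by (rule tendsto_norm_zero_cancel)
      moreover have "(\<lambda>k. simple_integral B (n (r k)) (\<tau> (r k)) (\<eta> (r k)) v \<omega>) \<longlonglongrightarrow> J v \<omega>"
        using LIMSEQ_subseq_LIMSEQ[OF elim(2) r(1)] by (simp add: comp_def)
      ultimately show ?case unfolding diff using tendsto_add by fastforce
    qed
    \<comment> \<open>The mesh bound passes to the subsequence because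
      \<open>k \<le> r k\<close>.\<close>
    fix k j assume "j < m (r k)"
    then have "\<pi> (r k) (Suc j) - \<pi> (r k) j \<le> v / real (Suc (r k))" by (rule P)
    also have "\<dots> \<le> v / real (Suc k)" using seq_suble[OF r(1), of k] v' by (intro divide_left_mono) auto
    finally show "\<pi> (r k) (Suc j) - \<pi> (r k) j \<le> v / real (Suc k)" .
  qed (use P in auto)
qed

text \<open>The Ito process is an almost sure limit of sums along refinements of the partition
  \<open>a\<close>. On a refinement, the difference to the sum over \<open>a\<close> is an Ito sum
  whose coefficients are increments of \<open>H\<close> and \<open>\<beta>\<close> within a cell of
  \<open>a\<close>, hence of \<open>p\<close>-th moment at most \<open>\<epsilon>\<close>. The
  moment bound is uniform in the refinement and passes to the limit; two coefficients over a length
  of at most \<open>T\<close> give the constant \<open>2 * K * T\<close>.\<close>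

lemma ito_process_discretization:
  fixes p T :: real
  assumes p: "2 \<le> p" and T: "0 \<le> T"
  obtains K where "0 \<le> K"
    "\<And>(H :: real \<Rightarrow> 'a \<Rightarrow> real^'q^'d) J \<beta> V a n v \<epsilon>. \<lbrakk>is_ito_integral M F B T H J;
      \<And>s. s \<in> {0..T} \<Longrightarrow> H s \<in> borel_measurable (F s); \<And>\<omega>. \<omega> \<in> space M \<Longrightarrow> continuous_on {0..T} (\<lambda>s. H s \<omega>);
      \<And>s. s \<in> {0..T} \<Longrightarrow> \<beta> s \<in> borel_measurable (F s); \<And>\<omega>. \<omega> \<in> space M \<Longrightarrow> continuous_on {0..T} (\<lambda>s. \<beta> s \<omega>);
      \<And>s. s \<in> {0..T} \<Longrightarrow> integrable M (\<lambda>\<omega>. norm (H s \<omega>) powr p);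
      \<And>s. s \<in> {0..T} \<Longrightarrow> integrable M (\<lambda>\<omega>. norm (\<beta> s \<omega>) powr p);
      v \<in> {0..T}; a 0 = 0; a n = v; \<And>i. i < n \<Longrightarrow> a i \<le> a (Suc i); 0 \<le> \<epsilon>;
      \<And>i s. i < n \<Longrightarrow> s \<in> {a i..a (Suc i)} \<Longrightarrow> (\<integral>\<omega>. norm (H s \<omega> - H (a i) \<omega>) powr p \<partial>M) \<le> \<epsilon>;
      \<And>i s. i < n \<Longrightarrow> s \<in> {a i..a (Suc i)} \<Longrightarrow> (\<integral>\<omega>. norm (\<beta> s \<omega> - \<beta> (a i) \<omega>) powr p \<partial>M) \<le> \<epsilon>;
      V \<in> borel_measurable M; AE \<omega> in M. V \<omega> = (LINT s:{0..v}|lborel. \<beta> s \<omega>) + J v \<omega>\<rbrakk> \<Longrightarrow>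
      integrable M (\<lambda>\<omega>. norm (V \<omega> - ito_sum a (\<lambda>i. \<beta> (a i)) (\<lambda>i. H (a i)) n \<omega>) powr p) \<and>
      (\<integral>\<omega>. norm (V \<omega> - ito_sum a (\<lambda>i. \<beta> (a i)) (\<lambda>i. H (a i)) n \<omega>) powr p \<partial>M) \<le> K * \<epsilon>"
proof -
  obtain K where K: "0 \<le> K"
    "\<And>m \<pi> (\<beta> :: nat \<Rightarrow> 'a \<Rightarrow> real^'d) G. \<lbrakk>0 \<le> \<pi> 0; \<And>j. j < m \<Longrightarrow> \<pi> j \<le> \<pi> (Suc j); \<pi> m \<le> \<pi> 0 + T;
       \<And>j. j < m \<Longrightarrow> \<beta> j \<in> borel_measurable (F (\<pi> j)); \<And>j. j < m \<Longrightarrow> G j \<in> borel_measurable (F (\<pi> j));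
       \<And>j. j < m \<Longrightarrow> integrable M (\<lambda>\<omega>. norm (\<beta> j \<omega>) powr p); \<And>j. j < m \<Longrightarrow> integrable M (\<lambda>\<omega>. norm (G j \<omega>) powr p)\<rbrakk> \<Longrightarrow>
       integrable M (\<lambda>\<omega>. norm (ito_sum \<pi> \<beta> G m \<omega>) powr p) \<and>
       (\<integral>\<omega>. norm (ito_sum \<pi> \<beta> G m \<omega>) powr p \<partial>M)
       \<le> K * (\<Sum>j<m. (\<pi> (Suc j) - \<pi> j) * ((\<integral>\<omega>. norm (\<beta> j \<omega>) powr p \<partial>M) + (\<integral>\<omega>. norm (G j \<omega>) powr p \<partial>M)))"
    by (rule ito_sum_moment[OF p T]) blast
  show thesis
  proof (rule that)
    show "0 \<le> 2 * K * T" using K T by simp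
    fix H :: "real \<Rightarrow> 'a \<Rightarrow> real^'q^'d" and J \<beta> V a n v \<epsilon>
    assume ito: "is_ito_integral M F B T H J"
      and H: "\<And>s. s \<in> {0..T} \<Longrightarrow> H s \<in> borel_measurable (F s)" "\<And>\<omega>. \<omega> \<in> space M \<Longrightarrow> continuous_on {0..T} (\<lambda>s. H s \<omega>)"
      and \<beta>: "\<And>s. s \<in> {0..T} \<Longrightarrow> \<beta> s \<in> borel_measurable (F s)" "\<And>\<omega>. \<omega> \<in> space M \<Longrightarrow> continuous_on {0..T} (\<lambda>s. \<beta> s \<omega>)"
      and Hi: "\<And>s. s \<in> {0..T} \<Longrightarrow> integrable M (\<lambda>\<omega>. norm (H s \<omega>) powr p)"
      and \<beta>i: "\<And>s. s \<in> {0..T} \<Longrightarrow> integrable M (\<lambda>\<omega>. norm (\<beta> s \<omega>) powr p)"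
      and v: "v \<in> {0..T}" and a: "a 0 = 0" "a n = v" "\<And>i. i < n \<Longrightarrow> a i \<le> a (Suc i)" and \<epsilon>: "0 \<le> \<epsilon>"
      and H\<epsilon>: "\<And>i s. i < n \<Longrightarrow> s \<in> {a i..a (Suc i)} \<Longrightarrow> (\<integral>\<omega>. norm (H s \<omega> - H (a i) \<omega>) powr p \<partial>M) \<le> \<epsilon>"
      and \<beta>\<epsilon>: "\<And>i s. i < n \<Longrightarrow> s \<in> {a i..a (Suc i)} \<Longrightarrow> (\<integral>\<omega>. norm (\<beta> s \<omega> - \<beta> (a i) \<omega>) powr p \<partial>M) \<le> \<epsilon>"
      and V: "V \<in> borel_measurable M" "AE \<omega> in M. V \<omega> = (LINT s:{0..v}|lborel. \<beta> s \<omega>) + J v \<omega>"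
    have v': "0 \<le> v" "v \<le> T" using v by auto
    have ale: "a i \<le> a j" if "i \<le> j" "j \<le> n" for i j
      by (rule partition_mono[of n a i j, OF a(3) that])
    have aT: "a i \<in> {0..v}" if "i \<le> n" for i using ale[of 0 i] ale[of i n] a that by auto
    have A: "finite (a ` {..n})" "a ` {..n} \<subseteq> {0..v}" using aT by auto
    obtain m \<pi> where P: "\<And>k. \<pi> k 0 = 0" "\<And>k. \<pi> k (m k) = v" "\<And>k j. j < m k \<Longrightarrow> \<pi> k j < \<pi> k (Suc j)"
      "\<And>k. a ` {..n} \<subseteq> \<pi> k ` {..m k}" "\<And>k j. j < m k \<Longrightarrow> \<pi> k (Suc j) - \<pi> k j \<le> v / real (Suc k)"
      "AE \<omega> in M. (\<lambda>k. ito_sum (\<pi> k) (\<lambda>_ _. 0) (\<lambda>j. H (\<pi> k j)) (m k) \<omega>) \<longlonglongrightarrow> J v \<omega>"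
      by (rule ito_integral_riemann[OF ito H v A]) (assumption | rule that)+
    have le: "\<pi> k i \<le> \<pi> k j" if "i \<le> j" "j \<le> m k" for k i j
      by (rule partition_mono[of "m k" "\<pi> k" i j, OF less_imp_le[OF P(3)] that])
    have pv: "\<pi> k j \<in> {0..v}" if "j \<le> m k" for k j
      using le[of 0 j k] le[of j "m k" k] that P(1)[of k] P(2)[of k] by auto
    have pT: "\<pi> k j \<in> {0..T}" if "j \<le> m k" for k j using pv[OF that] v' by auto
    define W where "W = (\<lambda>k. ito_sum (\<pi> k) (\<lambda>j. \<beta> (\<pi> k j)) (\<lambda>j. H (\<pi> k j)) (m k))"
    define S where "S = ito_sum a (\<lambda>i. \<beta> (a i)) (\<lambda>i. H (a i)) n"
    have Wlim: "AE \<omega> in M. (\<lambda>k. W k \<omega>) \<longlonglongrightarrow> V \<omega>"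
      using P(6) V(2) AE_space
    proof eventually_elim
      case (elim \<omega>)
      have "(\<lambda>k. (LINT s:{0..v}|lborel. \<beta> s \<omega>) - (\<Sum>j<m k. (\<pi> k (Suc j) - \<pi> k j) *\<^sub>R \<beta> (\<pi> k j) \<omega>)) \<longlonglongrightarrow> 0"
      proof (rule LIMSEQ_I)
        fix e :: real assume e: "0 < e"
        have w: "0 < e / (v + 1)" "e / (v + 1) * v < e" using e v' by (auto simp: field_simps)
        obtain d where d: "0 < d" "\<And>s t. s \<in> {0..T} \<Longrightarrow> t \<in> {0..T} \<Longrightarrow> \<bar>s - t\<bar> < d \<Longrightarrow> norm (\<beta> s \<omega> - \<beta> t \<omega>) \<le> e / (v + 1)"
          by (rule uniform_modulus[OF \<beta>(2)[OF elim(3)] w(1)]) (rule that)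
        have "(\<lambda>k. v / real (Suc k)) \<longlonglongrightarrow> 0" by (rule LIMSEQ_Suc[OF lim_const_over_n])
        then have "\<forall>\<^sub>F k in sequentially. v / real (Suc k) < d" using d(1) by (rule order_tendstoD)
        then obtain N where N: "\<And>k. N \<le> k \<Longrightarrow> v / real (Suc k) < d" unfolding eventually_sequentially by blast
        show "\<exists>N. \<forall>k\<ge>N. norm ((LINT s:{0..v}|lborel. \<beta> s \<omega>) - (\<Sum>j<m k. (\<pi> k (Suc j) - \<pi> k j) *\<^sub>R \<beta> (\<pi> k j) \<omega>) - 0) < e"
        proof (intro exI[of _ N] allI impI)
          fix k assume k: "N \<le> k"
          have "norm ((LINT s:{0..v}|lborel. \<beta> s \<omega>) - (\<Sum>j<m k. (\<pi> k (Suc j) - \<pi> k j) *\<^sub>R \<beta> (\<pi> k j) \<omega>)) \<le> e / (v + 1) * v"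
          proof (rule riemann_sum_bound[OF P(3,1,2) v'(2) \<beta>(2)[OF elim(3)]])
            show "norm (\<beta> s \<omega> - \<beta> (\<pi> k j) \<omega>) \<le> e / (v + 1)" if "j < m k" "s \<in> {\<pi> k j..\<pi> k (Suc j)}" for j s
              using that P(5)[OF that(1)] N[OF k] pT[of j k] pT[of "Suc j" k] by (intro d(2)) auto
          qed
          then show "norm ((LINT s:{0..v}|lborel. \<beta> s \<omega>) - (\<Sum>j<m k. (\<pi> k (Suc j) - \<pi> k j) *\<^sub>R \<beta> (\<pi> k j) \<omega>) - 0) < e"
            using w(2) by simp
        qed
      qed
      then have "(\<lambda>k. (LINT s:{0..v}|lborel. \<beta> s \<omega>) - ((LINT s:{0..v}|lborel. \<beta> s \<omega>) - (\<Sum>j<m k. (\<pi> k (Suc j) - \<pi> k j) *\<^sub>R \<beta> (\<pi> k j) \<omega>))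
         + ito_sum (\<pi> k) (\<lambda>_ _. 0) (\<lambda>j. H (\<pi> k j)) (m k) \<omega>) \<longlonglongrightarrow> (LINT s:{0..v}|lborel. \<beta> s \<omega>) - 0 + J v \<omega>"
        using elim(1) by (intro tendsto_add tendsto_diff tendsto_const)
      moreover have "W k \<omega> = (LINT s:{0..v}|lborel. \<beta> s \<omega>) - ((LINT s:{0..v}|lborel. \<beta> s \<omega>) - (\<Sum>j<m k. (\<pi> k (Suc j) - \<pi> k j) *\<^sub>R \<beta> (\<pi> k j) \<omega>))
         + ito_sum (\<pi> k) (\<lambda>_ _. 0) (\<lambda>j. H (\<pi> k j)) (m k) \<omega>" for k
        by (simp add: W_def ito_sum_def sum.distrib)
      ultimately show ?case using elim(2) by simp
    qed
    have WM: "W k \<in> borel_measurable M" for k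
    proof -
      have "W k \<in> borel_measurable (F (\<pi> k (m k)))"
        unfolding W_def by (rule ito_sum_measurable_F[where m = "m k"])
          (use pT in \<open>auto simp: P(1) intro!: less_imp_le P(3) H \<beta>\<close>)
      then show ?thesis using measurable_F[of "\<pi> k (m k)"] pT[of "m k" k] by simp
    qed
    have SM: "S \<in> borel_measurable M"
    proof -
      have "a i \<in> {0..T}" if "i \<le> n" for i using aT[OF that] v' by auto
      then have "S \<in> borel_measurable (F (a n))"
        unfolding S_def by (intro ito_sum_measurable_F[where m = n] a H \<beta>) (auto simp: a(1))
      then show ?thesis using measurable_F[of "a n"] v' a(2) by simp
    qed
    have WS: "integrable M (\<lambda>\<omega>. norm (W k \<omega> - S \<omega>) powr p) \<and> (\<integral>\<omega>. norm (W k \<omega> - S \<omega>) powr p \<partial>M) \<le> 2 * K * T * \<epsilon>" for k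
    proof -
      \<comment> \<open>The coefficients of the coarse partition, transported to the cells of the
        fine one.\<close>
      define \<beta>' where "\<beta>' = (\<lambda>j \<omega>. \<Sum>i<n. indicat_real {a i<..a (Suc i)} (\<pi> k (Suc j)) *\<^sub>R \<beta> (a i) \<omega>)"
      define H' where "H' = (\<lambda>j \<omega>. \<Sum>i<n. indicat_real {a i<..a (Suc i)} (\<pi> k (Suc j)) *\<^sub>R H (a i) \<omega>)"
      have cell: "\<exists>i<n. a i \<le> \<pi> k j \<and> \<pi> k j \<le> a (Suc i) \<and> \<beta>' j = \<beta> (a i) \<and> H' j = H (a i)" if j: "j < m k" for j
      proof -
        have "0 < \<pi> k (Suc j)" using P(3)[OF j] pv[of j k] j by auto
        then have "a 0 < \<pi> k (Suc j)" "\<pi> k (Suc j) \<le> a n" using pv[of "Suc j" k] j a by auto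
        then obtain i where i: "i < n" "a i < \<pi> k (Suc j)" "\<pi> k (Suc j) \<le> a (Suc i)"
          by (rule partition_interval_exists) (rule that)
        have "a i \<in> \<pi> k ` {..m k}" using P(4)[of k] i(1) by (simp add: image_subset_iff)
        then have "a i \<le> \<pi> k j" using partition_point_le(1)[of "m k" "\<pi> k", OF P(3) _ j i(2)] by simp
        moreover have "\<beta>' j = \<beta> (a i)" "H' j = H (a i)"
          unfolding \<beta>'_def H'_def using sum_indicator_partition[of n a, OF a(3) i] by auto
        ultimately show ?thesis using i P(3)[OF j] by (intro exI[of _ i]) auto
      qed
      have mv: "min v (a i) = a i" if "i \<le> n" for i using aT[OF that] by simp
      have mem: "min v (a i) \<in> \<pi> k ` {..m k}" if "i \<le> n" for i
        unfolding mv[OF that] using P(4)[of k] that by auto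
      have "S \<omega> = ito_sum (\<pi> k) \<beta>' H' (m k) \<omega>" for \<omega>
      proof -
        have "S \<omega> = (\<Sum>i<n. (min v (a (Suc i)) - min v (a i)) *\<^sub>R \<beta> (a i) \<omega>) + (\<Sum>i<n. H (a i) \<omega> *v (B (min v (a (Suc i))) \<omega> - B (min v (a i)) \<omega>))"
          unfolding S_def ito_sum_def sum.distrib by (intro arg_cong2[where f = "(+)"] sum.cong) (auto simp: mv)
        also have "(\<Sum>i<n. (min v (a (Suc i)) - min v (a i)) *\<^sub>R \<beta> (a i) \<omega>) = (\<Sum>j<m k. (\<pi> k (Suc j) - \<pi> k j) *\<^sub>R \<beta>' j \<omega>)"
          unfolding \<beta>'_def
          by (rule partition_refine_scaleR, rule P(3), assumption, rule P(2), rule a(3), assumption, rule mem, assumption)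
        also have "(\<Sum>i<n. H (a i) \<omega> *v (B (min v (a (Suc i))) \<omega> - B (min v (a i)) \<omega>)) = (\<Sum>j<m k. H' j \<omega> *v (B (\<pi> k (Suc j)) \<omega> - B (\<pi> k j) \<omega>))"
          unfolding H'_def
          by (rule partition_refine_matrix[where f = "\<lambda>s. B s \<omega>"], rule P(3), assumption, rule P(2), rule a(3), assumption, rule mem, assumption)
        finally show ?thesis by (simp only: ito_sum_def sum.distrib)
      qed
      then have eq: "W k \<omega> - S \<omega> = ito_sum (\<pi> k) (\<lambda>j \<omega>. \<beta> (\<pi> k j) \<omega> - \<beta>' j \<omega>) (\<lambda>j \<omega>. H (\<pi> k j) \<omega> - H' j \<omega>) (m k) \<omega>" for \<omega>
        by (simp add: W_def ito_sum_def sum_subtractf[symmetric] matrix_vector_mult_diff_rdistrib algebra_simps)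
      have props: "(\<lambda>\<omega>. \<beta> (\<pi> k j) \<omega> - \<beta>' j \<omega>) \<in> borel_measurable (F (\<pi> k j)) \<and> (\<lambda>\<omega>. H (\<pi> k j) \<omega> - H' j \<omega>) \<in> borel_measurable (F (\<pi> k j))
         \<and> integrable M (\<lambda>\<omega>. norm (\<beta> (\<pi> k j) \<omega> - \<beta>' j \<omega>) powr p) \<and> integrable M (\<lambda>\<omega>. norm (H (\<pi> k j) \<omega> - H' j \<omega>) powr p)
         \<and> (\<integral>\<omega>. norm (\<beta> (\<pi> k j) \<omega> - \<beta>' j \<omega>) powr p \<partial>M) \<le> \<epsilon> \<and> (\<integral>\<omega>. norm (H (\<pi> k j) \<omega> - H' j \<omega>) powr p \<partial>M) \<le> \<epsilon>" if j: "j < m k" for j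
      proof -
        obtain i where i: "i < n" "a i \<le> \<pi> k j" "\<pi> k j \<le> a (Suc i)" and e: "\<beta>' j = \<beta> (a i)" "H' j = H (a i)"
          using cell[OF j] by blast
        have ai: "a i \<in> {0..T}" using aT[of i] i v' by auto
        have pj: "\<pi> k j \<in> {0..T}" using pT[of j k] j by simp
        have m1: "\<beta> (a i) \<in> borel_measurable (F (\<pi> k j))" "H (a i) \<in> borel_measurable (F (\<pi> k j))"
          using measurable_F_mono[OF _ i(2)] \<beta>(1)[OF ai] H(1)[OF ai] ai by auto
        have m2: "\<beta> s \<in> borel_measurable M" "H s \<in> borel_measurable M" if "s \<in> {0..T}" for s
          using measurable_F[of s] \<beta>(1)[OF that] H(1)[OF that] that by auto
        show ?thesis unfolding e
          using p m1 m2 \<beta>(1)[OF pj] H(1)[OF pj] \<beta>i[OF pj] \<beta>i[OF ai] Hi[OF pj] Hi[OF ai] H\<epsilon>[OF i(1)] \<beta>\<epsilon>[OF i(1)] i ai pj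
          by (intro conjI borel_measurable_diff integrable_add_powr(2)) auto
      qed
      have bd: "integrable M (\<lambda>\<omega>. norm (W k \<omega> - S \<omega>) powr p) \<and> (\<integral>\<omega>. norm (W k \<omega> - S \<omega>) powr p \<partial>M)
        \<le> K * (\<Sum>j<m k. (\<pi> k (Suc j) - \<pi> k j) * ((\<integral>\<omega>. norm (\<beta> (\<pi> k j) \<omega> - \<beta>' j \<omega>) powr p \<partial>M) + (\<integral>\<omega>. norm (H (\<pi> k j) \<omega> - H' j \<omega>) powr p \<partial>M)))"
        unfolding eq by (rule K(2)) (use props P(1)[of k] P(2)[of k] v' in \<open>auto intro: less_imp_le P(3)\<close>)
      have "(\<Sum>j<m k. (\<pi> k (Suc j) - \<pi> k j) * ((\<integral>\<omega>. norm (\<beta> (\<pi> k j) \<omega> - \<beta>' j \<omega>) powr p \<partial>M) + (\<integral>\<omega>. norm (H (\<pi> k j) \<omega> - H' j \<omega>) powr p \<partial>M)))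
        \<le> (\<Sum>j<m k. (\<pi> k (Suc j) - \<pi> k j) * (\<epsilon> + \<epsilon>))"
        using P(3)[of _ k] props by (intro sum_mono mult_left_mono add_mono) (auto intro: less_imp_le)
      also have "\<dots> = v * (\<epsilon> + \<epsilon>)"
        unfolding sum_distrib_right[symmetric] sum_lessThan_telescope using P(1)[of k] P(2)[of k] by simp
      also have "\<dots> \<le> T * (\<epsilon> + \<epsilon>)" using v' \<epsilon> by (intro mult_right_mono) auto
      finally have "K * (\<Sum>j<m k. (\<pi> k (Suc j) - \<pi> k j) * ((\<integral>\<omega>. norm (\<beta> (\<pi> k j) \<omega> - \<beta>' j \<omega>) powr p \<partial>M) + (\<integral>\<omega>. norm (H (\<pi> k j) \<omega> - H' j \<omega>) powr p \<partial>M)))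
        \<le> K * (T * (\<epsilon> + \<epsilon>))" using K(1) by (rule mult_left_mono)
      then show ?thesis using bd by (auto intro: order_trans)
    qed
    have [measurable]: "V \<in> borel_measurable M" "S \<in> borel_measurable M" "\<And>k. W k \<in> borel_measurable M"
      using V(1) SM WM by auto
    have "(\<integral>\<^sup>+\<omega>. ennreal (norm (V \<omega> - S \<omega>) powr p) \<partial>M) = (\<integral>\<^sup>+\<omega>. liminf (\<lambda>k. ennreal (norm (W k \<omega> - S \<omega>) powr p)) \<partial>M)"
      using Wlim
    proof (intro nn_integral_cong_AE, eventually_elim)
      case (elim \<omega>)
      have "(\<lambda>k. ennreal (norm (W k \<omega> - S \<omega>) powr p)) \<longlonglongrightarrow> ennreal (norm (V \<omega> - S \<omega>) powr p)"
        using elim p by (intro tendsto_ennrealI tendsto_powr2 tendsto_norm tendsto_diff tendsto_const) auto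
      then show ?case by (rule lim_imp_Liminf[symmetric, OF sequentially_bot])
    qed
    \<comment> \<open>Fatou's lemma: almost sure convergence of the sums suffices, and integrability
      of the limit is obtained along the way.\<close>
    also have "\<dots> \<le> liminf (\<lambda>k. \<integral>\<^sup>+\<omega>. ennreal (norm (W k \<omega> - S \<omega>) powr p) \<partial>M)"
      by (rule nn_integral_liminf) measurable
    also have "\<dots> \<le> ennreal (2 * K * T * \<epsilon>)"
    proof -
      have "(\<integral>\<^sup>+\<omega>. ennreal (norm (W k \<omega> - S \<omega>) powr p) \<partial>M) \<le> ennreal (2 * K * T * \<epsilon>)" for k
        using WS[of k] by (subst nn_integral_eq_integral) (auto intro: ennreal_leI)
      then show ?thesis
        by (intro order_trans[OF Liminf_le_Limsup Limsup_bounded]) auto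
    qed
    finally have nn: "(\<integral>\<^sup>+\<omega>. ennreal (norm (V \<omega> - S \<omega>) powr p) \<partial>M) \<le> ennreal (2 * K * T * \<epsilon>)" .
    have int: "integrable M (\<lambda>\<omega>. norm (V \<omega> - S \<omega>) powr p)"
      using nn by (intro integrableI_bounded) (auto intro: le_less_trans)
    moreover have "(\<integral>\<omega>. norm (V \<omega> - S \<omega>) powr p \<partial>M) \<le> 2 * K * T * \<epsilon>"
      using nn nn_integral_eq_integral[OF int] K(1) T \<epsilon> by (simp add: ennreal_le_iff)
    ultimately show "integrable M (\<lambda>\<omega>. norm (V \<omega> - ito_sum a (\<lambda>i. \<beta> (a i)) (\<lambda>i. H (a i)) n \<omega>) powr p) \<and>
      (\<integral>\<omega>. norm (V \<omega> - ito_sum a (\<lambda>i. \<beta> (a i)) (\<lambda>i. H (a i)) n \<omega>) powr p \<partial>M) \<le> 2 * K * T * \<epsilon>"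
      unfolding S_def by blast
  qed
qed

end

section \<open>Coefficients\<close>

lemma powr_mono_sum2:
  fixes a b c :: real
  assumes "0 \<le> p" "0 \<le> a" "a \<le> b + c" "0 \<le> b" "0 \<le> c"
  shows "a powr p \<le> 2 powr p * (b powr p + c powr p)"
  using powr_mono2[OF assms(1,2,3)] powr_add_le[OF assms(4,5,1)] by linarith

lemma (in prob_space) law_prob_dists:
  assumes [measurable]: "U \<in> borel_measurable M" and "integrable M (\<lambda>\<omega>. norm (U \<omega>) powr p)"
  shows "law M (U :: 'a \<Rightarrow> 'v::euclidean_space) \<in> prob_dists p"
  unfolding prob_dists_def using assms prob_space_distr[OF assms(1)]
  by (simp add: integrable_distr_eq)

text \<open>The joint law of \<open>U\<close> and \<open>V\<close> is one of the couplings over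
  which the infimum is taken.\<close>

lemma (in prob_space) wasserstein_law_le:
  fixes U V :: "'a \<Rightarrow> 'v::euclidean_space"
  assumes p: "1 \<le> p" and [measurable]: "U \<in> borel_measurable M" "V \<in> borel_measurable M"
    and int: "integrable M (\<lambda>\<omega>. norm (U \<omega> - V \<omega>) powr p)"
  shows "wasserstein p (law M U) (law M V) powr p \<le> (\<integral>\<omega>. norm (U \<omega> - V \<omega>) powr p \<partial>M)"
proof -
  let ?\<pi> = "distr M (borel \<Otimes>\<^sub>M borel) (\<lambda>\<omega>. (U \<omega>, V \<omega>))"
  let ?E = "\<integral>\<omega>. norm (U \<omega> - V \<omega>) powr p \<partial>M"
  have E0: "0 \<le> ?E" by (simp add: integral_nonneg_AE)
  have "?\<pi> \<in> couplings (law M U) (law M V)"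
    by (auto simp: couplings_def distr_distr comp_def)
  then have "(INF \<pi>\<in>couplings (law M U) (law M V). \<integral>\<^sup>+z. ennreal (dist (fst z) (snd z) powr p) \<partial>\<pi>)
     \<le> (\<integral>\<^sup>+z. ennreal (dist (fst z) (snd z) powr p) \<partial>?\<pi>)" by (rule INF_lower)
  also have "\<dots> = (\<integral>\<^sup>+\<omega>. ennreal (norm (U \<omega> - V \<omega>) powr p) \<partial>M)"
    by (subst nn_integral_distr) (auto simp: dist_norm)
  also have "\<dots> = ennreal ?E" using int by (intro nn_integral_eq_integral) auto
  finally have "enn2real (INF \<pi>\<in>couplings (law M U) (law M V). \<integral>\<^sup>+z. ennreal (dist (fst z) (snd z) powr p) \<partial>\<pi>) \<le> ?E"
    using E0 by (intro enn2real_leI) auto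
  then show ?thesis
    unfolding wasserstein_def using p by (simp add: powr_powr)
qed

lemma wasserstein_nonneg: "0 \<le> wasserstein p \<mu> \<nu>"
  by (simp add: wasserstein_def)

lemma wasserstein_self:
  assumes p: "1 \<le> p" and \<mu>: "\<mu> \<in> prob_dists p"
  shows "wasserstein p \<mu> \<mu> = 0"
proof -
  interpret prob_space \<mu> using \<mu> by (simp add: prob_dists_def)
  have sets: "sets \<mu> = sets borel" using \<mu> by (simp add: prob_dists_def)
  have m: "(\<lambda>x. x) \<in> borel_measurable \<mu>" unfolding measurable_cong_sets[OF sets refl] by simp
  have "law \<mu> (\<lambda>x. x) = \<mu>" using sets by (simp add: distr_id2)
  then have "wasserstein p \<mu> \<mu> powr p \<le> 0" using wasserstein_law_le[OF p m m] by simp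
  then show ?thesis by (metis not_le powr_gt_zero)
qed

lemma coeff_regular_onorm:
  fixes f :: "real \<Rightarrow> 'v::euclidean_space \<Rightarrow> 'v measure \<Rightarrow> real^'q^'d"
  assumes "coeff_regular matrix_onorm T p \<rho> L L' f"
  shows "coeff_regular norm T p \<rho> (real (CARD('d) * CARD('q)) * L) (real (CARD('d) * CARD('q)) * L') f"
proof -
  let ?c = "real (CARD('d) * CARD('q))"
  have "norm A \<le> ?c * b" if "matrix_onorm A \<le> b" for A :: "real^'q^'d" and b
    using norm_le_matrix_onorm[of A] mult_left_mono[OF that, of ?c] by linarith
  then show ?thesis
    using assms unfolding coeff_regular_def mult.assoc by blast
qed

lemma affine_map_combination:
  assumes "affine_map f"
  shows "f (u *\<^sub>R x + (1 - u) *\<^sub>R y) = u *\<^sub>R f x + (1 - u) *\<^sub>R f y"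
proof -
  obtain g c where g: "linear g" "\<And>x. f x = g x + c" using assms by (auto simp: affine_map_def)
  show ?thesis
    by (simp only: g(2) linear_add[OF g(1)] linear_scale[OF g(1)]) (simp add: algebra_simps)
qed

text \<open>A common interface for \<open>b\<close>, \<open>\<sigma>\<close> and
  \<open>\<theta>\<close>: values in any Euclidean space, and the type class norm, to which matrix
  coefficients are brought by \<open>coeff_regular_onorm\<close>.\<close>

locale regular_coeff =
  fixes T p \<rho> L L' :: real and f :: "real \<Rightarrow> 'v::euclidean_space \<Rightarrow> 'v measure \<Rightarrow> 'c::euclidean_space"
  assumes p: "1 \<le> p" and \<rho>: "0 < \<rho>" and L: "0 \<le> L" "0 \<le> L'"
    and regular: "coeff_regular norm T p \<rho> L L' f"
begin

lemma lipschitz: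
  assumes "t \<in> {0..T}" "\<mu> \<in> prob_dists p" "\<nu> \<in> prob_dists p"
  shows "norm (f t x \<mu> - f t y \<nu>) \<le> L * (norm (x - y) + wasserstein p \<mu> \<nu>)"
proof -
  from regular assms(2,3)
  have "0 \<le> t \<and> t \<le> t \<and> t \<le> T \<longrightarrow>
        norm (f t x \<mu> - f t x \<mu>) \<le> L' * (1 + norm x + wasserstein p \<mu> (return borel 0)) * (t - t) powr \<rho> \<and>
        norm (f t x \<mu> - f t y \<nu>) \<le> L * (norm (x - y) + wasserstein p \<mu> \<nu>)"
    unfolding coeff_regular_def by blast
  then show ?thesis using assms(1) by simp
qed

lemma holder:
  assumes "s \<in> {0..T}" "t \<in> {0..T}" "\<mu> \<in> prob_dists p"
  shows "norm (f t x \<mu> - f s x \<mu>) \<le> L' * (1 + norm x + wasserstein p \<mu> (return borel 0)) * \<bar>t - s\<bar> powr \<rho>"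
proof -
  have *: "norm (f t x \<mu> - f s x \<mu>) \<le> L' * (1 + norm x + wasserstein p \<mu> (return borel 0)) * (t - s) powr \<rho>"
    if "0 \<le> s" "s \<le> t" "t \<le> T" for s t
  proof -
    from regular assms(3)
    have "0 \<le> s \<and> s \<le> t \<and> t \<le> T \<longrightarrow>
        norm (f t x \<mu> - f s x \<mu>) \<le> L' * (1 + norm x + wasserstein p \<mu> (return borel 0)) * (t - s) powr \<rho> \<and>
        norm (f t x \<mu> - f t x \<mu>) \<le> L * (norm (x - x) + wasserstein p \<mu> \<mu>)"
      unfolding coeff_regular_def by blast
    then show ?thesis using that by simp
  qed
  show ?thesis
    using *[of s t] *[of t s] assms by (cases "s \<le> t") (auto simp: norm_minus_commute)
qed

lemma continuous_space: 
  assumes "t \<in> {0..T}" "\<mu> \<in> prob_dists p"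
  shows "continuous_on UNIV (\<lambda>x. f t x \<mu>)"
proof (rule lipschitz_on_continuous_on[where L = L], rule lipschitz_onI)
  show "dist (f t x \<mu>) (f t y \<mu>) \<le> L * dist x y" for x y
    using lipschitz[OF assms assms(2), of x y] wasserstein_self[OF p assms(2)] by (simp add: dist_norm)
qed (rule L)

lemma measurable_comp:
  assumes "t \<in> {0..T}" "\<mu> \<in> prob_dists p" "U \<in> borel_measurable N"
  shows "(\<lambda>\<omega>. f t (U \<omega>) \<mu>) \<in> borel_measurable N"
  using measurable_compose[OF assms(3) borel_measurable_continuous_onI[OF continuous_space[OF assms(1,2)]]] .

end

context prob_space
begin

lemma regular_coeff_integrable:
  fixes f :: "real \<Rightarrow> 'v::euclidean_space \<Rightarrow> 'v measure \<Rightarrow> 'c::euclidean_space"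
  assumes rc: "regular_coeff T p \<rho> L L' f" and t: "t \<in> {0..T}" and \<mu>: "\<mu> \<in> prob_dists p"
    and U: "U \<in> borel_measurable M" "integrable M (\<lambda>\<omega>. norm (U \<omega>) powr p)"
  shows "integrable M (\<lambda>\<omega>. norm (f t (U \<omega>) \<mu>) powr p)"
proof -
  interpret regular_coeff T p \<rho> L L' f by fact
  have [measurable]: "(\<lambda>\<omega>. f t (U \<omega>) \<mu>) \<in> borel_measurable M" by (rule measurable_comp[OF t \<mu> U(1)])
  have bound: "norm (f t (U \<omega>) \<mu>) powr p \<le> 2 powr p * ((L * norm (U \<omega>)) powr p + norm (f t 0 \<mu>) powr p)" for \<omega>
  proof (rule powr_mono_sum2)
    have "norm (f t (U \<omega>) \<mu>) \<le> norm (f t (U \<omega>) \<mu> - f t 0 \<mu>) + norm (f t 0 \<mu>)"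
      using norm_triangle_ineq[of "f t (U \<omega>) \<mu> - f t 0 \<mu>" "f t 0 \<mu>"] by simp
    then show "norm (f t (U \<omega>) \<mu>) \<le> L * norm (U \<omega>) + norm (f t 0 \<mu>)"
      using lipschitz[OF t \<mu> \<mu>, of "U \<omega>" 0] wasserstein_self[OF p \<mu>] by simp
  qed (use p L in auto)
  show ?thesis
  proof (rule Bochner_Integration.integrable_bound)
    show "integrable M (\<lambda>\<omega>. 2 powr p * ((L * norm (U \<omega>)) powr p + norm (f t 0 \<mu>) powr p))"
      using U(2) by (simp add: powr_mult L)
    show "AE \<omega> in M. norm (norm (f t (U \<omega>) \<mu>) powr p) \<le> norm (2 powr p * ((L * norm (U \<omega>)) powr p + norm (f t 0 \<mu>) powr p))"
      using bound by (auto intro!: AE_I2 order_trans[OF _ abs_ge_self])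
  qed simp
qed

text \<open>The distance of the laws is at most the \<open>L^p\<close> distance of the variables, so
  a coefficient remains Lipschitz in \<open>L^p\<close> when each variable brings its own law. This
  lets an ordinary Gronwall argument handle the dependence on the law. Splitting the
  \<open>p\<close>-th power of a sum gives \<open>(2 * L) powr p\<close>, and the law contributes a
  second copy of the error.\<close>

lemma regular_coeff_law_lipschitz:
  fixes f :: "real \<Rightarrow> 'v::euclidean_space \<Rightarrow> 'v measure \<Rightarrow> 'c::euclidean_space"
  assumes rc: "regular_coeff T p \<rho> L L' f" and t: "t \<in> {0..T}"
    and U: "U \<in> borel_measurable M" "integrable M (\<lambda>\<omega>. norm (U \<omega>) powr p)"
    and V: "V \<in> borel_measurable M" "integrable M (\<lambda>\<omega>. norm (V \<omega>) powr p)"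
    and UV: "integrable M (\<lambda>\<omega>. norm (U \<omega> - V \<omega>) powr p)"
  shows "(\<integral>\<omega>. norm (f t (U \<omega>) (law M U) - f t (V \<omega>) (law M V)) powr p \<partial>M)
     \<le> 2 * (2 * L) powr p * (\<integral>\<omega>. norm (U \<omega> - V \<omega>) powr p \<partial>M)"
proof -
  interpret regular_coeff T p \<rho> L L' f by fact
  let ?E = "\<integral>\<omega>. norm (U \<omega> - V \<omega>) powr p \<partial>M"
  let ?W = "wasserstein p (law M U) (law M V)"
  have \<mu>: "law M U \<in> prob_dists p" "law M V \<in> prob_dists p" using law_prob_dists U V by auto
  have [measurable]: "(\<lambda>\<omega>. f t (U \<omega>) (law M U)) \<in> borel_measurable M" "(\<lambda>\<omega>. f t (V \<omega>) (law M V)) \<in> borel_measurable M"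
    by (rule measurable_comp[OF t \<mu>(1) U(1)], rule measurable_comp[OF t \<mu>(2) V(1)])
  have bound: "norm (f t (U \<omega>) (law M U) - f t (V \<omega>) (law M V)) powr p \<le> (2 * L) powr p * (norm (U \<omega> - V \<omega>) powr p + ?W powr p)" for \<omega>
  proof -
    have "norm (f t (U \<omega>) (law M U) - f t (V \<omega>) (law M V)) powr p \<le> 2 powr p * ((L * norm (U \<omega> - V \<omega>)) powr p + (L * ?W) powr p)"
      using lipschitz[OF t \<mu>, of "U \<omega>" "V \<omega>"] p L mult_nonneg_nonneg[OF L(1) wasserstein_nonneg]
      by (intro powr_mono_sum2) (auto simp: distrib_left)
    then show ?thesis using L wasserstein_nonneg by (simp add: powr_mult distrib_left mult.assoc)
  qed
  have i2: "integrable M (\<lambda>\<omega>. (2 * L) powr p * (norm (U \<omega> - V \<omega>) powr p + ?W powr p))" using UV by simp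
  have "(\<integral>\<omega>. norm (f t (U \<omega>) (law M U) - f t (V \<omega>) (law M V)) powr p \<partial>M)
    \<le> (\<integral>\<omega>. (2 * L) powr p * (norm (U \<omega> - V \<omega>) powr p + ?W powr p) \<partial>M)"
  proof (rule integral_mono[OF _ i2 bound])
    show "integrable M (\<lambda>\<omega>. norm (f t (U \<omega>) (law M U) - f t (V \<omega>) (law M V)) powr p)"
      by (rule Bochner_Integration.integrable_bound[OF i2])
         (use bound in \<open>auto intro!: AE_I2 order_trans[OF _ abs_ge_self]\<close>)
  qed
  also have "\<dots> = (2 * L) powr p * (?E + ?W powr p)" using UV by (simp add: prob_space)
  also have "\<dots> \<le> (2 * L) powr p * (?E + ?E)"
    using wasserstein_law_le[OF p U(1) V(1) UV] by (intro mult_left_mono add_left_mono) auto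
  finally show ?thesis by (simp add: mult.commute mult.left_commute)
qed

section \<open>From \<open>L^p\<close> estimates to integrals of test functions, and moduli of
  continuity in \<open>L^p\<close>\<close>

lemma integrable_powr_imp_integrable:
  fixes U :: "'a \<Rightarrow> 'v::euclidean_space"
  assumes p: "1 \<le> p" and U: "U \<in> borel_measurable M" "integrable M (\<lambda>\<omega>. norm (U \<omega>) powr p)"
  shows "integrable M U"
proof (rule Bochner_Integration.integrable_bound)
  show "integrable M (\<lambda>\<omega>. 1 + norm (U \<omega>) powr p)" using U(2) by simp
  show "AE \<omega> in M. norm (U \<omega>) \<le> norm (1 + norm (U \<omega>) powr p)"
    using le_add_powr[of "norm (U _)" 1 p] p by (intro AE_I2) simp
qed (rule U(1))

lemma law_prob_dists_1:
  fixes U :: "'a \<Rightarrow> 'v::euclidean_space"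
  assumes "1 \<le> p" "U \<in> borel_measurable M" "integrable M (\<lambda>\<omega>. norm (U \<omega>) powr p)"
  shows "law M U \<in> prob_dists 1"
  using law_prob_dists[OF assms(2), of 1] integrable_norm[OF integrable_powr_imp_integrable[OF assms]] by simp

text \<open>With \<open>\<eta>\<close> as the parameter of \<open>le_add_powr\<close>, a
  \<open>p\<close>-th moment of at most \<open>\<eta> powr p\<close> bounds the first moment of the
  difference by \<open>2 * \<eta>\<close>.\<close>

lemma integral_lipschitz_diff_le:
  fixes U V :: "'a \<Rightarrow> 'v::euclidean_space"
  assumes p: "1 \<le> p" and U: "integrable M U" and V: "integrable M V" and \<phi>: "C-lipschitz_on UNIV \<phi>"
    and UV: "integrable M (\<lambda>\<omega>. norm (U \<omega> - V \<omega>) powr p)" "(\<integral>\<omega>. norm (U \<omega> - V \<omega>) powr p \<partial>M) \<le> \<eta> powr p"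
    and \<eta>: "0 < \<eta>"
  shows "\<bar>(\<integral>\<omega>. \<phi> (U \<omega>) \<partial>M) - (\<integral>\<omega>. \<phi> (V \<omega>) \<partial>M)\<bar> \<le> C * (2 * \<eta>)"
proof -
  have fm: "finite_measure M" by unfold_locales
  note i = integrable_lipschitz_comp[OF fm \<phi> U] integrable_lipschitz_comp[OF fm \<phi> V]
  have C: "0 \<le> C" using \<phi> by (rule lipschitz_on_nonneg)
  have "\<bar>(\<integral>\<omega>. \<phi> (U \<omega>) \<partial>M) - (\<integral>\<omega>. \<phi> (V \<omega>) \<partial>M)\<bar> = \<bar>\<integral>\<omega>. \<phi> (U \<omega>) - \<phi> (V \<omega>) \<partial>M\<bar>" using i by simp
  also have "\<dots> \<le> (\<integral>\<omega>. \<bar>\<phi> (U \<omega>) - \<phi> (V \<omega>)\<bar> \<partial>M)" by (rule integral_abs_bound)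
  also have "\<dots> \<le> (\<integral>\<omega>. C * (\<eta> + \<eta> powr (1 - p) * norm (U \<omega> - V \<omega>) powr p) \<partial>M)"
  proof (rule integral_mono)
    show "integrable M (\<lambda>\<omega>. \<bar>\<phi> (U \<omega>) - \<phi> (V \<omega>)\<bar>)" using i by simp
    show "integrable M (\<lambda>\<omega>. C * (\<eta> + \<eta> powr (1 - p) * norm (U \<omega> - V \<omega>) powr p))" using UV(1) by simp
    fix \<omega>
    have "\<bar>\<phi> (U \<omega>) - \<phi> (V \<omega>)\<bar> \<le> C * norm (U \<omega> - V \<omega>)"
      using lipschitz_onD[OF \<phi>, of "U \<omega>" "V \<omega>"] by (simp add: dist_norm)
    also have "\<dots> \<le> C * (\<eta> + \<eta> powr (1 - p) * norm (U \<omega> - V \<omega>) powr p)"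
      using C \<eta> p by (intro mult_left_mono le_add_powr) auto
    finally show "\<bar>\<phi> (U \<omega>) - \<phi> (V \<omega>)\<bar> \<le> C * (\<eta> + \<eta> powr (1 - p) * norm (U \<omega> - V \<omega>) powr p)" .
  qed
  also have "\<dots> = C * (\<eta> + \<eta> powr (1 - p) * (\<integral>\<omega>. norm (U \<omega> - V \<omega>) powr p \<partial>M))"
    using UV(1) by (simp add: prob_space)
  also have "\<dots> \<le> C * (\<eta> + \<eta> powr (1 - p) * \<eta> powr p)"
    using C UV(2) by (intro mult_left_mono add_left_mono) auto
  also have "\<eta> powr (1 - p) * \<eta> powr p = \<eta>" using \<eta> by (simp flip: powr_add)
  finally show ?thesis by simp
qed

text \<open>Every path is uniformly continuous with a random modulus; the common majorant
  \<open>G\<close> allows dominated convergence, which yields a deterministic one. The argument runs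
  along a sequence of violating pairs at distance below \<open>1 / (n + 1)\<close>.\<close>

lemma Lp_modulus:
  fixes Z :: "real \<Rightarrow> 'a \<Rightarrow> 'v::euclidean_space"
  assumes p: "0 < p" and Zm: "\<And>t. t \<in> {0..T} \<Longrightarrow> Z t \<in> borel_measurable M"
    and cont: "\<And>\<omega>. \<omega> \<in> space M \<Longrightarrow> continuous_on {0..T} (\<lambda>t. Z t \<omega>)"
    and G: "integrable M G" "AE \<omega> in M. \<forall>t\<in>{0..T}. norm (Z t \<omega>) powr p \<le> G \<omega>" and e: "0 < e"
  obtains d where "0 < d" "\<And>s t. s \<in> {0..T} \<Longrightarrow> t \<in> {0..T} \<Longrightarrow> \<bar>s - t\<bar> < d \<Longrightarrow>
     (\<integral>\<omega>. norm (Z s \<omega> - Z t \<omega>) powr p \<partial>M) \<le> e"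
proof (rule ccontr)
  assume neg: "\<not> thesis"
  have "\<exists>s t. s \<in> {0..T} \<and> t \<in> {0..T} \<and> \<bar>s - t\<bar> < 1 / real (Suc n) \<and> e < (\<integral>\<omega>. norm (Z s \<omega> - Z t \<omega>) powr p \<partial>M)" for n
  proof (rule ccontr)
    assume "\<not> ?thesis"
    then have "(\<integral>\<omega>. norm (Z s \<omega> - Z t \<omega>) powr p \<partial>M) \<le> e" if "s \<in> {0..T}" "t \<in> {0..T}" "\<bar>s - t\<bar> < 1 / real (Suc n)" for s t
      using that not_le by blast
    then show False using neg that[of "1 / real (Suc n)"] by simp
  qed
  then obtain s t where st: "\<And>n. s n \<in> {0..T}" "\<And>n. t n \<in> {0..T}" "\<And>n. \<bar>s n - t n\<bar> < 1 / real (Suc n)"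
    "\<And>n. e < (\<integral>\<omega>. norm (Z (s n) \<omega> - Z (t n) \<omega>) powr p \<partial>M)" by metis
  have [measurable]: "Z (s n) \<in> borel_measurable M" "Z (t n) \<in> borel_measurable M" for n using Zm st by auto
  have "(\<lambda>n. \<integral>\<omega>. norm (Z (s n) \<omega> - Z (t n) \<omega>) powr p \<partial>M) \<longlonglongrightarrow> (\<integral>\<omega>. 0 \<partial>M)"
  proof (rule integral_dominated_convergence[where w = "\<lambda>\<omega>. 2 powr p * (G \<omega> + G \<omega>)"])
    show "integrable M (\<lambda>\<omega>. 2 powr p * (G \<omega> + G \<omega>))" using G(1) by simp
    show "AE \<omega> in M. (\<lambda>n. norm (Z (s n) \<omega> - Z (t n) \<omega>) powr p) \<longlonglongrightarrow> 0"
      using AE_space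
    proof eventually_elim
      case (elim \<omega>)
      have uc: "uniformly_continuous_on {0..T} (\<lambda>t. Z t \<omega>)"
        using cont[OF elim] by (rule compact_uniformly_continuous) simp
      have inv: "(\<lambda>n. inverse (real (Suc n))) \<longlonglongrightarrow> 0" by (rule LIMSEQ_inverse_real_of_nat)
      have "(\<lambda>n. s n - t n) \<longlonglongrightarrow> 0"
        by (rule Lim_null_comparison[OF _ inv])
           (use st(3) in \<open>auto intro!: always_eventually less_imp_le simp: inverse_eq_divide\<close>)
      then have "(\<lambda>n. dist (s n) (t n)) \<longlonglongrightarrow> 0"
        using tendsto_rabs_zero by (simp add: dist_real_def)
      then have "(\<lambda>n. dist (Z (s n) \<omega>) (Z (t n) \<omega>)) \<longlonglongrightarrow> 0"
        using uc st(1,2) unfolding uniformly_continuous_on_sequentially by blast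
      then have "(\<lambda>n. norm (Z (s n) \<omega> - Z (t n) \<omega>) powr p) \<longlonglongrightarrow> 0 powr p"
        using p by (intro tendsto_powr2) (auto simp: dist_norm)
      then show ?case by simp
    qed
    fix n
    show "AE \<omega> in M. norm (norm (Z (s n) \<omega> - Z (t n) \<omega>) powr p) \<le> 2 powr p * (G \<omega> + G \<omega>)"
      using G(2)
    proof eventually_elim
      case (elim \<omega>)
      have "norm (Z (s n) \<omega> - Z (t n) \<omega>) powr p \<le> 2 powr p * (norm (Z (s n) \<omega>) powr p + norm (Z (t n) \<omega>) powr p)"
        using p by (intro norm_diff_powr_le) simp
      also have "\<dots> \<le> 2 powr p * (G \<omega> + G \<omega>)"
        using elim st(1,2) by (intro mult_left_mono add_mono) auto
      finally show ?case by simp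
    qed
  qed simp_all
  then have "\<forall>\<^sub>F n in sequentially. (\<integral>\<omega>. norm (Z (s n) \<omega> - Z (t n) \<omega>) powr p \<partial>M) < e"
    using e by (intro order_tendstoD(2)) auto
  then obtain n where "(\<integral>\<omega>. norm (Z (s n) \<omega> - Z (t n) \<omega>) powr p \<partial>M) < e"
    by (meson eventually_sequentially order_refl)
  with st(4)[of n] show False by simp
qed

text \<open>By continuity of paths the supremum may be taken over a countable set, which makes it measurable.\<close>

lemma sup_dominated:
  fixes X :: "real \<Rightarrow> 'a \<Rightarrow> 'v::euclidean_space"
  assumes T: "0 < T" and p: "0 < p" and Xm: "\<And>t. t \<in> {0..T} \<Longrightarrow> X t \<in> borel_measurable M"
    and cont: "\<And>\<omega>. \<omega> \<in> space M \<Longrightarrow> continuous_on {0..T} (\<lambda>t. X t \<omega>)"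
    and fin: "(\<integral>\<^sup>+\<omega>. (SUP t\<in>{0..T}. ennreal (norm (X t \<omega>) powr p)) \<partial>M) < \<infinity>"
  obtains G where "integrable M G" "AE \<omega> in M. \<forall>t\<in>{0..T}. norm (X t \<omega>) powr p \<le> G \<omega>"
proof -
  obtain D :: "real set" where D: "countable D" "\<And>S. open S \<Longrightarrow> S \<noteq> {} \<Longrightarrow> \<exists>d\<in>D. d \<in> S"
    using countable_dense_exists by blast
  \<comment> \<open>The open interval is used because the closure of an open set met with a dense
    set is the closure of the open set; here it is all of \<open>[0,T]\<close>.\<close>
  define Q where "Q = {0<..<T} \<inter> D"
  have Q: "countable Q" "Q \<subseteq> {0..T}" using D(1) by (auto simp: Q_def)
  have "x \<in> closure D" for x
    unfolding closure_approachable
  proof (intro allI impI)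
    fix e :: real assume "0 < e"
    then show "\<exists>y\<in>D. dist y x < e" using D(2)[of "ball x e"] by (auto simp: dist_commute)
  qed
  then have clQ: "closure Q = {0..T}"
    unfolding Q_def using T by (subst closure_open_Int_superset) auto
  define D' where "D' = (\<lambda>\<omega>. SUP q\<in>Q. ennreal (norm (X q \<omega>) powr p))"
  have [measurable]: "D' \<in> borel_measurable M"
    unfolding D'_def
  proof (rule borel_measurable_SUP[OF Q(1)])
    fix q assume "q \<in> Q"
    then have [measurable]: "X q \<in> borel_measurable M" using Xm Q(2) by blast
    show "(\<lambda>\<omega>. ennreal (norm (X q \<omega>) powr p)) \<in> borel_measurable M" by measurable
  qed
  have "(\<integral>\<^sup>+\<omega>. D' \<omega> \<partial>M) \<le> (\<integral>\<^sup>+\<omega>. (SUP t\<in>{0..T}. ennreal (norm (X t \<omega>) powr p)) \<partial>M)"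
    unfolding D'_def using Q(2) by (intro nn_integral_mono SUP_subset_mono) auto
  then have fin': "(\<integral>\<^sup>+\<omega>. D' \<omega> \<partial>M) < \<infinity>" using fin by (rule le_less_trans)
  have AEfin: "AE \<omega> in M. D' \<omega> \<noteq> \<infinity>" using fin' by (intro nn_integral_noteq_infinite) auto
  show thesis
  proof (rule that[of "\<lambda>\<omega>. enn2real (D' \<omega>)"])
    show "integrable M (\<lambda>\<omega>. enn2real (D' \<omega>))"
    proof (rule integrableI_nonneg)
      have "(\<integral>\<^sup>+\<omega>. ennreal (enn2real (D' \<omega>)) \<partial>M) \<le> (\<integral>\<^sup>+\<omega>. D' \<omega> \<partial>M)"
        by (intro nn_integral_mono) (simp add: ennreal_enn2real_if)
      then show "(\<integral>\<^sup>+\<omega>. ennreal (enn2real (D' \<omega>)) \<partial>M) < \<infinity>" using fin' by (rule le_less_trans)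
    qed auto
    show "AE \<omega> in M. \<forall>t\<in>{0..T}. norm (X t \<omega>) powr p \<le> enn2real (D' \<omega>)"
      using AEfin AE_space
    proof eventually_elim
      case (elim \<omega>)
      have "norm (X q \<omega>) powr p \<le> enn2real (D' \<omega>)" if "q \<in> Q" for q
      proof -
        have "ennreal (norm (X q \<omega>) powr p) \<le> D' \<omega>" unfolding D'_def using that by (rule SUP_upper)
        then have "ennreal (norm (X q \<omega>) powr p) \<le> ennreal (enn2real (D' \<omega>))" using elim(1) by (simp add: less_top)
        then show ?thesis by (subst (asm) ennreal_le_iff) auto
      qed
      moreover have "continuous_on (closure Q) (\<lambda>t. norm (X t \<omega>) powr p)"
        unfolding clQ using cont[OF elim(2)] p by (intro continuous_on_powr' continuous_intros) auto
      ultimately show ?case using continuous_le_on_closure[of Q "\<lambda>t. norm (X t \<omega>) powr p"] clQ by blast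
    qed
  qed
qed

text \<open>Continuity of \<open>X\<close> in \<open>L^p\<close> makes its law continuous in the
  Wasserstein distance. Together with the regularity in time and space this gives continuous paths
  of \<open>Z\<close>, and linear growth gives a majorant, so that \<open>Lp_modulus\<close> applies
  to \<open>Z\<close> as it does to \<open>X\<close>.\<close>

lemma regular_coeff_process:
  fixes X :: "real \<Rightarrow> 'a \<Rightarrow> 'v::euclidean_space" and f :: "real \<Rightarrow> 'v \<Rightarrow> 'v measure \<Rightarrow> 'c::euclidean_space"
  assumes rc: "regular_coeff T p \<rho> L L' f" and T: "0 < T" and Xm: "\<And>t. t \<in> {0..T} \<Longrightarrow> X t \<in> borel_measurable M"
    and cont: "\<And>\<omega>. \<omega> \<in> space M \<Longrightarrow> continuous_on {0..T} (\<lambda>t. X t \<omega>)"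
    and fin: "(\<integral>\<^sup>+\<omega>. (SUP t\<in>{0..T}. ennreal (norm (X t \<omega>) powr p)) \<partial>M) < \<infinity>"
  defines "Z \<equiv> \<lambda>t \<omega>. f t (X t \<omega>) (law M (X t))"
  shows "t \<in> {0..T} \<Longrightarrow> integrable M (\<lambda>\<omega>. norm (X t \<omega>) powr p)"
    and "t \<in> {0..T} \<Longrightarrow> integrable M (\<lambda>\<omega>. norm (Z t \<omega>) powr p)"
    and "\<omega> \<in> space M \<Longrightarrow> continuous_on {0..T} (\<lambda>t. Z t \<omega>)"
    and "0 < e \<Longrightarrow> \<exists>d>0. \<forall>s\<in>{0..T}. \<forall>t\<in>{0..T}. \<bar>s - t\<bar> < d \<longrightarrow> (\<integral>\<omega>. norm (Z s \<omega> - Z t \<omega>) powr p \<partial>M) \<le> e"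
proof -
  interpret regular_coeff T p \<rho> L L' f by fact
  have p0: "0 < p" using p by simp
  obtain G where G: "integrable M G" "AE \<omega> in M. \<forall>t\<in>{0..T}. norm (X t \<omega>) powr p \<le> G \<omega>"
    by (rule sup_dominated[OF T p0 Xm cont fin]) (assumption | rule that)+
  have Xi: "integrable M (\<lambda>\<omega>. norm (X t \<omega>) powr p)" if t: "t \<in> {0..T}" for t
  proof (rule Bochner_Integration.integrable_bound[OF G(1)])
    show "(\<lambda>\<omega>. norm (X t \<omega>) powr p) \<in> borel_measurable M" using Xm[OF t] by measurable
    show "AE \<omega> in M. norm (norm (X t \<omega>) powr p) \<le> norm (G \<omega>)" using G(2) by eventually_elim (use t in force)
  qed
  then show "t \<in> {0..T} \<Longrightarrow> integrable M (\<lambda>\<omega>. norm (X t \<omega>) powr p)" for t .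
  have XX: "integrable M (\<lambda>\<omega>. norm (X s \<omega> - X t \<omega>) powr p)" if "s \<in> {0..T}" "t \<in> {0..T}" for s t
  proof (rule Bochner_Integration.integrable_bound)
    show "integrable M (\<lambda>\<omega>. 2 powr p * (norm (X s \<omega>) powr p + norm (X t \<omega>) powr p))" using Xi that by simp
    show "(\<lambda>\<omega>. norm (X s \<omega> - X t \<omega>) powr p) \<in> borel_measurable M" using Xm[OF that(1)] Xm[OF that(2)] by measurable
    show "AE \<omega> in M. norm (norm (X s \<omega> - X t \<omega>) powr p) \<le> norm (2 powr p * (norm (X s \<omega>) powr p + norm (X t \<omega>) powr p))"
      using norm_diff_powr_le[of p] p by (auto intro!: AE_I2)
  qed
  have \<mu>: "law M (X t) \<in> prob_dists p" if "t \<in> {0..T}" for t using law_prob_dists Xm[OF that] Xi[OF that] .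
  show Zi: "t \<in> {0..T} \<Longrightarrow> integrable M (\<lambda>\<omega>. norm (Z t \<omega>) powr p)" for t
    unfolding Z_def using regular_coeff_integrable[OF rc _ \<mu> Xm Xi] by simp
  have Zm: "Z t \<in> borel_measurable M" if "t \<in> {0..T}" for t
    unfolding Z_def by (rule measurable_comp[OF that \<mu>[OF that] Xm[OF that]])
  let ?W = "\<lambda>s t. wasserstein p (law M (X s)) (law M (X t))"
  have Wle: "?W s t powr p \<le> (\<integral>\<omega>. norm (X s \<omega> - X t \<omega>) powr p \<partial>M)" if "s \<in> {0..T}" "t \<in> {0..T}" for s t
    by (rule wasserstein_law_le[OF p Xm[OF that(1)] Xm[OF that(2)] XX[OF that]])
  have incr: "norm (Z s \<omega> - Z t \<omega>) \<le> L' * (1 + norm (X t \<omega>) + wasserstein p (law M (X t)) (return borel 0)) * \<bar>s - t\<bar> powr \<rho>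
     + L * (norm (X s \<omega> - X t \<omega>) + ?W s t)" if "s \<in> {0..T}" "t \<in> {0..T}" for s t \<omega>
  proof -
    have "norm (Z s \<omega> - Z t \<omega>) \<le> norm (f s (X t \<omega>) (law M (X t)) - f t (X t \<omega>) (law M (X t)))
        + norm (f s (X s \<omega>) (law M (X s)) - f s (X t \<omega>) (law M (X t)))"
      unfolding Z_def using norm_triangle_ineq[of "f s (X t \<omega>) (law M (X t)) - f t (X t \<omega>) (law M (X t))"
         "f s (X s \<omega>) (law M (X s)) - f s (X t \<omega>) (law M (X t))"] by simp
    also have "\<dots> \<le> L' * (1 + norm (X t \<omega>) + wasserstein p (law M (X t)) (return borel 0)) * \<bar>s - t\<bar> powr \<rho>
     + L * (norm (X s \<omega> - X t \<omega>) + ?W s t)"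
      using that by (intro add_mono holder lipschitz \<mu>)
    finally show ?thesis .
  qed
  \<comment> \<open>The modulus of \<open>X\<close> is taken at the level
    \<open>(e / 2) powr p\<close>, so that the comparison of \<open>p\<close>-th powers leaves a
    strict inequality.\<close>
  have Wlim: "((\<lambda>s. ?W s t) \<longlongrightarrow> 0) (at t within {0..T})" if t: "t \<in> {0..T}" for t
  proof (rule tendstoI)
    fix e :: real assume e: "0 < e"
    obtain d where d: "0 < d" "\<And>s t. s \<in> {0..T} \<Longrightarrow> t \<in> {0..T} \<Longrightarrow> \<bar>s - t\<bar> < d \<Longrightarrow>
     (\<integral>\<omega>. norm (X s \<omega> - X t \<omega>) powr p \<partial>M) \<le> (e / 2) powr p"
      by (rule Lp_modulus[OF p0 Xm cont G, of "(e / 2) powr p"]) (use e in auto)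
    have "?W s t < e" if "s \<in> {0..T}" "\<bar>s - t\<bar> < d" for s
    proof (rule ccontr)
      assume "\<not> ?W s t < e"
      then have "(e / 2) powr p < ?W s t powr p" using e p0 by (intro powr_less_mono2) auto
      with Wle[OF that(1) t] d(2)[OF that(1) t that(2)] show False by simp
    qed
    then show "\<forall>\<^sub>F s in at t within {0..T}. dist (?W s t) 0 < e"
      unfolding eventually_at using d(1) by (intro exI[of _ d]) (auto simp: dist_real_def wasserstein_nonneg)
  qed
  show Zc: "continuous_on {0..T} (\<lambda>t. Z t \<omega>)" if \<omega>: "\<omega> \<in> space M" for \<omega>
    unfolding continuous_on_def
  proof
    fix t assume t: "t \<in> {0..T}"
    let ?c = "L' * (1 + norm (X t \<omega>) + wasserstein p (law M (X t)) (return borel 0))"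
    have Xlim: "((\<lambda>s. X s \<omega>) \<longlongrightarrow> X t \<omega>) (at t within {0..T})"
      using cont[OF \<omega>] t by (auto simp: continuous_on_def)
    have pw: "((\<lambda>s. \<bar>s - t\<bar> powr \<rho>) \<longlongrightarrow> 0 powr \<rho>) (at t within {0..T})"
      using \<rho> by (intro tendsto_powr2 tendsto_rabs_zero LIM_zero tendsto_ident_at) auto
    have "((\<lambda>s. ?c * \<bar>s - t\<bar> powr \<rho> + L * (norm (X s \<omega> - X t \<omega>) + ?W s t)) \<longlongrightarrow> ?c * 0 powr \<rho> + L * (norm (X t \<omega> - X t \<omega>) + 0)) (at t within {0..T})"
      by (intro tendsto_intros pw Xlim Wlim[OF t])
    then have g: "((\<lambda>s. ?c * \<bar>s - t\<bar> powr \<rho> + L * (norm (X s \<omega> - X t \<omega>) + ?W s t)) \<longlongrightarrow> 0) (at t within {0..T})" by simp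
    have "((\<lambda>s. Z s \<omega> - Z t \<omega>) \<longlongrightarrow> 0) (at t within {0..T})"
    proof (rule Lim_null_comparison[OF _ g])
      show "\<forall>\<^sub>F s in at t within {0..T}. norm (Z s \<omega> - Z t \<omega>) \<le> ?c * \<bar>s - t\<bar> powr \<rho> + L * (norm (X s \<omega> - X t \<omega>) + ?W s t)"
        unfolding eventually_at using incr[OF _ t] by (intro exI[of _ 1]) auto
    qed
    then show "((\<lambda>s. Z s \<omega>) \<longlongrightarrow> Z t \<omega>) (at t within {0..T})" by (rule LIM_zero_cancel)
  qed
  let ?K = "\<integral>\<omega>. G \<omega> \<partial>M"
  have z: "0 \<in> {0..T}" using T by simp
  \<comment> \<open>\<open>w\<close> bounds the Wasserstein distance of every
    \<open>law M (X t)\<close> to the initial one, through the integral of the majorant. With the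
    values at time 0 as reference, \<open>c + L * |X t|\<close> then bounds \<open>|Z t|\<close>
    uniformly in \<open>t\<close>.\<close>
  define w where "w = (2 powr p * (?K + ?K)) powr (1 / p)"
  define c where "c = norm (f 0 0 (law M (X 0))) + L' * (1 + wasserstein p (law M (X 0)) (return borel 0)) * T powr \<rho> + L * w"
  have EX: "(\<integral>\<omega>. norm (X t \<omega>) powr p \<partial>M) \<le> ?K" if "t \<in> {0..T}" for t
    using Xi[OF that] G(1) by (rule integral_mono_AE) (use G(2) that in \<open>auto elim: AE_mp\<close>)
  have Wb: "?W t 0 \<le> w" if t: "t \<in> {0..T}" for t
  proof -
    have "(\<integral>\<omega>. norm (X t \<omega> - X 0 \<omega>) powr p \<partial>M) \<le> (\<integral>\<omega>. 2 powr p * (norm (X t \<omega>) powr p + norm (X 0 \<omega>) powr p) \<partial>M)"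
      using XX[OF t z] Xi[OF t] Xi[OF z] p by (intro integral_mono norm_diff_powr_le) auto
    also have "\<dots> = 2 powr p * ((\<integral>\<omega>. norm (X t \<omega>) powr p \<partial>M) + (\<integral>\<omega>. norm (X 0 \<omega>) powr p \<partial>M))"
      using Xi[OF t] Xi[OF z] by simp
    also have "\<dots> \<le> 2 powr p * (?K + ?K)" using EX[OF t] EX[OF z] by (intro mult_left_mono add_mono) auto
    finally have "?W t 0 powr p \<le> 2 powr p * (?K + ?K)" using Wle[OF t z] by simp
    then have "(?W t 0 powr p) powr (1 / p) \<le> w" unfolding w_def using p by (intro powr_mono2) auto
    then show ?thesis using p wasserstein_nonneg by (simp add: powr_powr)
  qed
  have Zb: "norm (Z t \<omega>) \<le> c + L * norm (X t \<omega>)" if t: "t \<in> {0..T}" for t \<omega>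
  proof -
    have "norm (Z t \<omega>) \<le> norm (f 0 0 (law M (X 0))) + norm (f t 0 (law M (X 0)) - f 0 0 (law M (X 0)))
        + norm (f t (X t \<omega>) (law M (X t)) - f t 0 (law M (X 0)))"
    proof -
      have "norm (a + b + c) \<le> norm a + norm b + norm c" for a b c :: 'c
        using norm_triangle_ineq[of "a + b" c] norm_triangle_ineq[of a b] by linarith
      from this[of "f 0 0 (law M (X 0))" "f t 0 (law M (X 0)) - f 0 0 (law M (X 0))" "f t (X t \<omega>) (law M (X t)) - f t 0 (law M (X 0))"]
      show ?thesis by (simp add: Z_def)
    qed
    also have "\<dots> \<le> norm (f 0 0 (law M (X 0))) + L' * (1 + norm (0 :: 'v) + wasserstein p (law M (X 0)) (return borel 0)) * \<bar>t - 0\<bar> powr \<rho>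
        + L * (norm (X t \<omega> - 0) + ?W t 0)"
      using t z by (intro add_mono holder lipschitz \<mu> order_refl)
    also have "\<dots> \<le> norm (f 0 0 (law M (X 0))) + L' * (1 + norm (0 :: 'v) + wasserstein p (law M (X 0)) (return borel 0)) * T powr \<rho>
        + L * (norm (X t \<omega> - 0) + w)"
      using t Wb[OF t] L \<rho> wasserstein_nonneg[of p "law M (X 0)" "return borel 0"]
      by (intro add_mono mult_left_mono powr_mono2 order_refl mult_nonneg_nonneg) auto
    finally show ?thesis by (simp add: c_def algebra_simps)
  qed
  have c0: "0 \<le> c" unfolding c_def w_def using L wasserstein_nonneg[of p "law M (X 0)" "return borel 0"] by simp
  have ZG: "AE \<omega> in M. \<forall>t\<in>{0..T}. norm (Z t \<omega>) powr p \<le> 2 powr p * (c powr p + L powr p * G \<omega>)"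
    using G(2)
  proof eventually_elim
    case (elim \<omega>)
    show ?case
    proof
      fix t assume t: "t \<in> {0..T}"
      have "norm (Z t \<omega>) powr p \<le> 2 powr p * (c powr p + (L * norm (X t \<omega>)) powr p)"
        by (rule powr_mono_sum2[OF _ _ Zb[OF t]]) (use p c0 L in auto)
      also have "\<dots> \<le> 2 powr p * (c powr p + L powr p * G \<omega>)"
        using elim t L by (intro mult_left_mono add_left_mono) (auto simp: powr_mult intro!: mult_left_mono)
      finally show "norm (Z t \<omega>) powr p \<le> 2 powr p * (c powr p + L powr p * G \<omega>)" .
    qed
  qed
  have Gi: "integrable M (\<lambda>\<omega>. 2 powr p * (c powr p + L powr p * G \<omega>))" using G(1) by simp
  show "\<exists>d>0. \<forall>s\<in>{0..T}. \<forall>t\<in>{0..T}. \<bar>s - t\<bar> < d \<longrightarrow> (\<integral>\<omega>. norm (Z s \<omega> - Z t \<omega>) powr p \<partial>M) \<le> e" if "0 < e"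
    by (rule Lp_modulus[OF p0 Zm Zc Gi ZG that]) auto
qed

end

section \<open>The Euler scheme\<close>

context brownian_filtration
begin

text \<open>Each step uses the law of the scheme itself. Its length is written as a difference of
  grid points rather than as \<open>h\<close>, so that the scheme is literally the initial value
  plus an \<open>ito_sum\<close>.\<close>

primrec euler :: "(real \<Rightarrow> real^'d \<Rightarrow> (real^'d) measure \<Rightarrow> real^'d) \<Rightarrow> (real \<Rightarrow> real^'d \<Rightarrow> (real^'d) measure \<Rightarrow> real^'q^'d) \<Rightarrow>
    real \<Rightarrow> ('a \<Rightarrow> real^'d) \<Rightarrow> nat \<Rightarrow> 'a \<Rightarrow> real^'d" where
  "euler b \<sigma> h X0 0 = X0"
| "euler b \<sigma> h X0 (Suc k) = (\<lambda>\<omega>. euler b \<sigma> h X0 k \<omega> +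
     ((real (Suc k) * h - real k * h) *\<^sub>R b (real k * h) (euler b \<sigma> h X0 k \<omega>) (law M (euler b \<sigma> h X0 k)) +
      \<sigma> (real k * h) (euler b \<sigma> h X0 k \<omega>) (law M (euler b \<sigma> h X0 k)) *v (B (real (Suc k) * h) \<omega> - B (real k * h) \<omega>)))"

lemma euler_eq_ito_sum:
  "euler b \<sigma> h X0 k \<omega> = X0 \<omega> + ito_sum (\<lambda>i. real i * h)
     (\<lambda>i \<omega>. b (real i * h) (euler b \<sigma> h X0 i \<omega>) (law M (euler b \<sigma> h X0 i)))
     (\<lambda>i \<omega>. \<sigma> (real i * h) (euler b \<sigma> h X0 i \<omega>) (law M (euler b \<sigma> h X0 i))) k \<omega>"
  by (induction k) (simp_all add: ito_sum_Suc ito_sum_def)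

lemma euler_measurable_integrable:
  assumes b: "regular_coeff T p \<rho> L L' b" and \<sigma>: "regular_coeff T p \<rho> K K' \<sigma>" and h: "0 \<le> h"
    and X0: "X0 \<in> borel_measurable (F 0)" "integrable M (\<lambda>\<omega>. norm (X0 \<omega>) powr p)"
  shows "real k * h \<le> T \<Longrightarrow> euler b \<sigma> h X0 k \<in> borel_measurable (F (real k * h)) \<and>
    integrable M (\<lambda>\<omega>. norm (euler b \<sigma> h X0 k \<omega>) powr p)"
proof (induction k)
  case 0
  then show ?case using X0 by simp
next
  case (Suc k)
  interpret b: regular_coeff T p \<rho> L L' b by fact
  interpret \<sigma>: regular_coeff T p \<rho> K K' \<sigma> by fact
  have le: "real k * h \<le> real (Suc k) * h" using h by (simp add: algebra_simps)
  have t: "real k * h \<in> {0..T}" using le Suc.prems h by auto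
  let ?X = "euler b \<sigma> h X0 k"
  have IH: "?X \<in> borel_measurable (F (real k * h))" "integrable M (\<lambda>\<omega>. norm (?X \<omega>) powr p)" using Suc le by auto
  have XM: "?X \<in> borel_measurable M" using measurable_F[OF _ IH(1)] t by simp
  have \<mu>: "law M ?X \<in> prob_dists p" using law_prob_dists[OF XM IH(2)] .
  have m: "(\<lambda>\<omega>. b (real k * h) (?X \<omega>) (law M ?X)) \<in> borel_measurable (F (real k * h))"
    "(\<lambda>\<omega>. \<sigma> (real k * h) (?X \<omega>) (law M ?X)) \<in> borel_measurable (F (real k * h))"
    by (rule b.measurable_comp[OF t \<mu> IH(1)], rule \<sigma>.measurable_comp[OF t \<mu> IH(1)])
  have i: "integrable M (\<lambda>\<omega>. norm (b (real k * h) (?X \<omega>) (law M ?X)) powr p)"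
    "integrable M (\<lambda>\<omega>. norm (\<sigma> (real k * h) (?X \<omega>) (law M ?X)) powr p)"
    by (rule regular_coeff_integrable[OF b t \<mu> XM IH(2)], rule regular_coeff_integrable[OF \<sigma> t \<mu> XM IH(2)])
  show ?case
    unfolding euler.simps
    using t b.p by (intro conjI step_measurable_F integrable_step_powr IH m i le) auto
qed

text \<open>The error has two parts. One is the discretisation error of the solution, small because
  its coefficients along the path are uniformly continuous in time in \<open>L^p\<close>. The other
  is an Ito sum of the differences between the coefficients at the solution and at the scheme,
  bounded by the earlier errors. Gronwall's inequality closes the estimate.\<close>

lemma euler_convergence:
  fixes X0 :: "'a \<Rightarrow> real^'d"
  assumes p: "2 \<le> p" and T: "0 < T"
    and b: "regular_coeff T p \<rho> L L' b" and \<sigma>: "regular_coeff T p \<rho> K K' \<sigma>"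
    and X0: "X0 \<in> borel_measurable (F 0)" "integrable M (\<lambda>\<omega>. norm (X0 \<omega>) powr p)"
    and sol: "mckean_vlasov_solution M F B T p b \<sigma> X0 X"
    and t: "t \<in> {0..T}" and e: "0 < e"
  obtains N0 where "\<And>N. N0 \<le> N \<Longrightarrow> 0 < N \<Longrightarrow>
    integrable M (\<lambda>\<omega>. norm (X t \<omega> - euler b \<sigma> (t / real N) X0 N \<omega>) powr p) \<and>
    (\<integral>\<omega>. norm (X t \<omega> - euler b \<sigma> (t / real N) X0 N \<omega>) powr p \<partial>M) \<le> e"
proof -
  interpret b: regular_coeff T p \<rho> L L' b by fact
  interpret \<sigma>: regular_coeff T p \<rho> K K' \<sigma> by fact
  define H where "H = (\<lambda>s \<omega>. \<sigma> s (X s \<omega>) (law M (X s)))"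
  define \<beta> where "\<beta> = (\<lambda>s \<omega>. b s (X s \<omega>) (law M (X s)))"
  have ca: "\<And>s. s \<in> {0..T} \<Longrightarrow> X s \<in> borel_measurable (F s)" "\<And>\<omega>. \<omega> \<in> space M \<Longrightarrow> continuous_on {0..T} (\<lambda>s. X s \<omega>)"
    and fin: "(\<integral>\<^sup>+\<omega>. (SUP t\<in>{0..T}. ennreal (norm (X t \<omega>) powr p)) \<partial>M) < \<infinity>"
    using sol by (auto simp: mckean_vlasov_solution_def continuous_adapted_def)
  obtain J where J: "is_ito_integral M F B T H J"
    "AE \<omega> in M. \<forall>t\<in>{0..T}. X t \<omega> = X0 \<omega> + (LINT s:{0..t}|lborel. \<beta> s \<omega>) + J t \<omega>"
    using sol unfolding mckean_vlasov_solution_def H_def \<beta>_def by blast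
  have XM: "X s \<in> borel_measurable M" if "s \<in> {0..T}" for s using measurable_F[OF _ ca(1)[OF that]] that by simp
  note pb = regular_coeff_process[OF b T XM ca(2) fin]
  note ps = regular_coeff_process[OF \<sigma> T XM ca(2) fin]
  have Xi: "integrable M (\<lambda>\<omega>. norm (X s \<omega>) powr p)" if "s \<in> {0..T}" for s by (rule pb(1)[OF _ _ that])
  have \<mu>: "law M (X s) \<in> prob_dists p" if "s \<in> {0..T}" for s using law_prob_dists[OF XM[OF that] Xi[OF that]] .
  have HF: "H s \<in> borel_measurable (F s)" "\<beta> s \<in> borel_measurable (F s)" if "s \<in> {0..T}" for s
    unfolding H_def \<beta>_def
    by (rule \<sigma>.measurable_comp[OF that \<mu>[OF that] ca(1)[OF that]], rule b.measurable_comp[OF that \<mu>[OF that] ca(1)[OF that]])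
  have Hc: "continuous_on {0..T} (\<lambda>s. H s \<omega>)" "continuous_on {0..T} (\<lambda>s. \<beta> s \<omega>)" if "\<omega> \<in> space M" for \<omega>
    unfolding H_def \<beta>_def by (rule ps(3)[OF _ _ that], assumption+) (rule pb(3)[OF _ _ that], assumption+)
  have Hi: "integrable M (\<lambda>\<omega>. norm (H s \<omega>) powr p)" "integrable M (\<lambda>\<omega>. norm (\<beta> s \<omega>) powr p)" if "s \<in> {0..T}" for s
    unfolding H_def \<beta>_def by (rule ps(2)[OF _ _ that], assumption+) (rule pb(2)[OF _ _ that], assumption+)
  obtain K1 where K1: "0 \<le> K1"
    "\<And>(H :: real \<Rightarrow> 'a \<Rightarrow> real^'q^'d) J \<beta> V a n v \<epsilon>. \<lbrakk>is_ito_integral M F B T H J;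
      \<And>s. s \<in> {0..T} \<Longrightarrow> H s \<in> borel_measurable (F s); \<And>\<omega>. \<omega> \<in> space M \<Longrightarrow> continuous_on {0..T} (\<lambda>s. H s \<omega>);
      \<And>s. s \<in> {0..T} \<Longrightarrow> \<beta> s \<in> borel_measurable (F s); \<And>\<omega>. \<omega> \<in> space M \<Longrightarrow> continuous_on {0..T} (\<lambda>s. \<beta> s \<omega>);
      \<And>s. s \<in> {0..T} \<Longrightarrow> integrable M (\<lambda>\<omega>. norm (H s \<omega>) powr p);
      \<And>s. s \<in> {0..T} \<Longrightarrow> integrable M (\<lambda>\<omega>. norm (\<beta> s \<omega>) powr p);
      v \<in> {0..T}; a 0 = 0; a n = v; \<And>i. i < n \<Longrightarrow> a i \<le> a (Suc i); 0 \<le> \<epsilon>;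
      \<And>i s. i < n \<Longrightarrow> s \<in> {a i..a (Suc i)} \<Longrightarrow> (\<integral>\<omega>. norm (H s \<omega> - H (a i) \<omega>) powr p \<partial>M) \<le> \<epsilon>;
      \<And>i s. i < n \<Longrightarrow> s \<in> {a i..a (Suc i)} \<Longrightarrow> (\<integral>\<omega>. norm (\<beta> s \<omega> - \<beta> (a i) \<omega>) powr p \<partial>M) \<le> \<epsilon>;
      V \<in> borel_measurable M; AE \<omega> in M. V \<omega> = (LINT s:{0..v}|lborel. \<beta> s \<omega>) + J v \<omega>\<rbrakk> \<Longrightarrow>
      integrable M (\<lambda>\<omega>. norm (V \<omega> - ito_sum a (\<lambda>i. \<beta> (a i)) (\<lambda>i. H (a i)) n \<omega>) powr p) \<and>
      (\<integral>\<omega>. norm (V \<omega> - ito_sum a (\<lambda>i. \<beta> (a i)) (\<lambda>i. H (a i)) n \<omega>) powr p \<partial>M) \<le> K1 * \<epsilon>"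
    by (rule ito_process_discretization[OF p less_imp_le[OF T]]) blast
  obtain K2 where K2: "0 \<le> K2"
    "\<And>m \<pi> (\<beta> :: nat \<Rightarrow> 'a \<Rightarrow> real^'d) G. \<lbrakk>0 \<le> \<pi> 0; \<And>j. j < m \<Longrightarrow> \<pi> j \<le> \<pi> (Suc j); \<pi> m \<le> \<pi> 0 + T;
       \<And>j. j < m \<Longrightarrow> \<beta> j \<in> borel_measurable (F (\<pi> j)); \<And>j. j < m \<Longrightarrow> G j \<in> borel_measurable (F (\<pi> j));
       \<And>j. j < m \<Longrightarrow> integrable M (\<lambda>\<omega>. norm (\<beta> j \<omega>) powr p); \<And>j. j < m \<Longrightarrow> integrable M (\<lambda>\<omega>. norm (G j \<omega>) powr p)\<rbrakk> \<Longrightarrow>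
       integrable M (\<lambda>\<omega>. norm (ito_sum \<pi> \<beta> G m \<omega>) powr p) \<and>
       (\<integral>\<omega>. norm (ito_sum \<pi> \<beta> G m \<omega>) powr p \<partial>M)
       \<le> K2 * (\<Sum>j<m. (\<pi> (Suc j) - \<pi> j) * ((\<integral>\<omega>. norm (\<beta> j \<omega>) powr p \<partial>M) + (\<integral>\<omega>. norm (G j \<omega>) powr p \<partial>M)))"
    by (rule ito_sum_moment[OF p less_imp_le[OF T]]) blast
  define C where "C = 2 * (2 * L) powr p + 2 * (2 * K) powr p"
  have C0: "0 \<le> C" by (simp add: C_def)
  \<comment> \<open>The rate per unit of time in the recursion \<open>rec\<close>:
    \<open>2 powr p\<close> from splitting the error, \<open>K2\<close> from the moment bound,
    \<open>C\<close> from the Lipschitz bounds of both coefficients.\<close>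
  define \<Lambda> where "\<Lambda> = 2 powr p * K2 * C"
  have \<Lambda>0: "0 \<le> \<Lambda>" using K2(1) C0 by (simp add: \<Lambda>_def)
  \<comment> \<open>Solves for a final bound of at most \<open>e\<close>; \<open>K1 + 1\<close>
    instead of \<open>K1\<close> avoids a division by 0.\<close>
  define \<epsilon> where "\<epsilon> = e / (2 powr p * (K1 + 1) * exp (\<Lambda> * T))"
  have \<epsilon>: "0 < \<epsilon>" using e K1(1) by (simp add: \<epsilon>_def)
  have \<epsilon>e: "2 powr p * (K1 * \<epsilon>) * exp (\<Lambda> * T) \<le> e"
  proof -
    have "2 powr p * (K1 * \<epsilon>) * exp (\<Lambda> * T) = e * (K1 / (K1 + 1))" by (simp add: \<epsilon>_def)
    also have "\<dots> \<le> e * 1" using e K1(1) by (intro mult_left_mono) auto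
    finally show ?thesis by simp
  qed
  obtain d1 where d1: "0 < d1" "\<And>s t. s \<in> {0..T} \<Longrightarrow> t \<in> {0..T} \<Longrightarrow> \<bar>s - t\<bar> < d1 \<Longrightarrow> (\<integral>\<omega>. norm (\<beta> s \<omega> - \<beta> t \<omega>) powr p \<partial>M) \<le> \<epsilon>"
  proof -
    have "\<exists>d>0. \<forall>s\<in>{0..T}. \<forall>t\<in>{0..T}. \<bar>s - t\<bar> < d \<longrightarrow> (\<integral>\<omega>. norm (\<beta> s \<omega> - \<beta> t \<omega>) powr p \<partial>M) \<le> \<epsilon>"
      unfolding \<beta>_def by (rule pb(4)[OF _ _ \<epsilon>])
    then show thesis using that by auto
  qed
  obtain d2 where d2: "0 < d2" "\<And>s t. s \<in> {0..T} \<Longrightarrow> t \<in> {0..T} \<Longrightarrow> \<bar>s - t\<bar> < d2 \<Longrightarrow> (\<integral>\<omega>. norm (H s \<omega> - H t \<omega>) powr p \<partial>M) \<le> \<epsilon>"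
  proof -
    have "\<exists>d>0. \<forall>s\<in>{0..T}. \<forall>t\<in>{0..T}. \<bar>s - t\<bar> < d \<longrightarrow> (\<integral>\<omega>. norm (H s \<omega> - H t \<omega>) powr p \<partial>M) \<le> \<epsilon>"
      unfolding H_def by (rule ps(4)[OF _ _ \<epsilon>])
    then show thesis using that by auto
  qed
  \<comment> \<open>Beyond this quotient the step \<open>t / N\<close> lies below both
    moduli.\<close>
  obtain N0 :: nat where N0: "t / min d1 d2 < real N0" using reals_Archimedean2 by blast
  show thesis
  proof (rule that[of N0])
    fix N assume N: "N0 \<le> N" "0 < N"
    define h where "h = t / real N"
    have t0: "0 \<le> t" "t \<le> T" using t by auto
    have h0: "0 \<le> h" using t0 by (simp add: h_def)
    have "t / min d1 d2 < real N" using N0 N(1) by (meson less_le_trans of_nat_mono)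
    then have "t < real N * min d1 d2" using d1(1) d2(1) by (simp add: pos_divide_less_eq)
    moreover have "real N * min d1 d2 \<le> real N * d1" "real N * min d1 d2 \<le> real N * d2" by (intro mult_left_mono; simp)+
    ultimately have "t < real N * d1" "t < real N * d2" by linarith+
    then have hd: "h < d1" "h < d2" using N(2) by (simp_all add: h_def pos_divide_less_eq mult.commute)
    have Nh: "real N * h = t" using N(2) by (simp add: h_def)
    have kh: "real k * h \<in> {0..T}" if "k \<le> N" for k
    proof -
      have "real k * h \<le> real N * h" using that h0 by (intro mult_right_mono) auto
      then show ?thesis using Nh t0 h0 by simp
    qed
    let ?X = "euler b \<sigma> h X0"
    let ?a = "\<lambda>i. real i * h"
    have XF: "?X k \<in> borel_measurable (F (?a k))" and Xint: "integrable M (\<lambda>\<omega>. norm (?X k \<omega>) powr p)" if "k \<le> N" for k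
      using euler_measurable_integrable[OF b \<sigma> h0 X0, of k] kh[OF that] by auto
    have XMM: "?X k \<in> borel_measurable M" if "k \<le> N" for k using measurable_F[OF _ XF[OF that]] kh[OF that] by simp
    have \<mu>X: "law M (?X k) \<in> prob_dists p" if "k \<le> N" for k using law_prob_dists[OF XMM[OF that] Xint[OF that]] .
    have step: "?a i \<le> ?a (Suc i)" "?a (Suc i) - ?a i = h" for i using h0 by (simp_all add: algebra_simps)
    have X0M: "X0 \<in> borel_measurable M" using measurable_F[OF _ X0(1)] by simp
    have EI: "integrable M (\<lambda>\<omega>. norm (X (?a k) \<omega> - ?X k \<omega>) powr p)" if "k \<le> N" for k
      using p by (intro integrable_add_powr(2) XM XMM Xi Xint kh that) simp
    define err where "err = (\<lambda>k. \<integral>\<omega>. norm (X (?a k) \<omega> - ?X k \<omega>) powr p \<partial>M)"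
    let ?\<beta> = "\<lambda>i \<omega>. \<beta> (?a i) \<omega> - b (?a i) (?X i \<omega>) (law M (?X i))"
    let ?H = "\<lambda>i \<omega>. H (?a i) \<omega> - \<sigma> (?a i) (?X i \<omega>) (law M (?X i))"
    let ?R = "\<lambda>k \<omega>. (X (?a k) \<omega> - X0 \<omega>) - ito_sum ?a (\<lambda>i. \<beta> (?a i)) (\<lambda>i. H (?a i)) k \<omega>"
    \<comment> \<open>Solution and scheme start from the same \<open>X0\<close>, which cancels; the
      sum over the solution's coefficients is subtracted and added.\<close>
    have dec: "X (?a k) \<omega> - ?X k \<omega> = ?R k \<omega> + ito_sum ?a ?\<beta> ?H k \<omega>" for k \<omega>
      unfolding euler_eq_ito_sum[of b \<sigma> h X0 k]
      by (simp add: ito_sum_def sum_subtractf[symmetric] sum.distrib[symmetric] matrix_vector_mult_diff_rdistrib scaleR_diff_right algebra_simps)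
    have R: "integrable M (\<lambda>\<omega>. norm (?R k \<omega>) powr p) \<and> (\<integral>\<omega>. norm (?R k \<omega>) powr p \<partial>M) \<le> K1 * \<epsilon>" if k: "k \<le> N" for k
    proof (rule K1(2)[of H J \<beta> "?a k" ?a k \<epsilon> "\<lambda>\<omega>. X (?a k) \<omega> - X0 \<omega>", OF J(1) HF(1) Hc(1) HF(2) Hc(2) Hi(1) Hi(2) kh[OF k]])
      show "(\<integral>\<omega>. norm (H s \<omega> - H (?a i) \<omega>) powr p \<partial>M) \<le> \<epsilon>" if "i < k" "s \<in> {?a i..?a (Suc i)}" for i s
      proof (rule d2(2))
        have a0: "0 \<le> ?a i" using h0 by simp
        also have "?a i \<le> s" using that by simp
        finally have "0 \<le> s" .
        with a0 show "s \<in> {0..T}" "?a i \<in> {0..T}" "\<bar>s - ?a i\<bar> < d2"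
          using that kh[of i] kh[of "Suc i"] k hd(2) step(2)[of i] by (auto simp del: of_nat_Suc)
      qed
      show "(\<integral>\<omega>. norm (\<beta> s \<omega> - \<beta> (?a i) \<omega>) powr p \<partial>M) \<le> \<epsilon>" if "i < k" "s \<in> {?a i..?a (Suc i)}" for i s
      proof (rule d1(2))
        have a0: "0 \<le> ?a i" using h0 by simp
        also have "?a i \<le> s" using that by simp
        finally have "0 \<le> s" .
        with a0 show "s \<in> {0..T}" "?a i \<in> {0..T}" "\<bar>s - ?a i\<bar> < d1"
          using that kh[of i] kh[of "Suc i"] k hd(1) step(2)[of i] by (auto simp del: of_nat_Suc)
      qed
      show "(\<lambda>\<omega>. X (?a k) \<omega> - X0 \<omega>) \<in> borel_measurable M" using XM[OF kh[OF k]] X0M by measurable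
      show "AE \<omega> in M. X (?a k) \<omega> - X0 \<omega> = (LINT s:{0..?a k}|lborel. \<beta> s \<omega>) + J (?a k) \<omega>"
        using J(2) by eventually_elim (use kh[OF k] in auto)
    qed (use \<epsilon> step(1) in \<open>auto\<close>)
    have D: "?\<beta> i \<in> borel_measurable (F (?a i)) \<and> ?H i \<in> borel_measurable (F (?a i)) \<and>
        integrable M (\<lambda>\<omega>. norm (?\<beta> i \<omega>) powr p) \<and> integrable M (\<lambda>\<omega>. norm (?H i \<omega>) powr p) \<and>
        (\<integral>\<omega>. norm (?\<beta> i \<omega>) powr p \<partial>M) + (\<integral>\<omega>. norm (?H i \<omega>) powr p \<partial>M) \<le> C * err i" if i: "i \<le> N" for i
    proof -
      note k = kh[OF i]
      have m: "(\<lambda>\<omega>. b (?a i) (?X i \<omega>) (law M (?X i))) \<in> borel_measurable (F (?a i))"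
         "(\<lambda>\<omega>. \<sigma> (?a i) (?X i \<omega>) (law M (?X i))) \<in> borel_measurable (F (?a i))"
        by (rule b.measurable_comp[OF k \<mu>X[OF i] XF[OF i]], rule \<sigma>.measurable_comp[OF k \<mu>X[OF i] XF[OF i]])
      have ii: "integrable M (\<lambda>\<omega>. norm (b (?a i) (?X i \<omega>) (law M (?X i))) powr p)"
        "integrable M (\<lambda>\<omega>. norm (\<sigma> (?a i) (?X i \<omega>) (law M (?X i))) powr p)"
        by (rule regular_coeff_integrable[OF b k \<mu>X[OF i] XMM[OF i] Xint[OF i]],
            rule regular_coeff_integrable[OF \<sigma> k \<mu>X[OF i] XMM[OF i] Xint[OF i]])
      have "(\<integral>\<omega>. norm (?\<beta> i \<omega>) powr p \<partial>M) \<le> 2 * (2 * L) powr p * err i"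
        unfolding \<beta>_def err_def by (rule regular_coeff_law_lipschitz[OF b k XM[OF k] Xi[OF k] XMM[OF i] Xint[OF i] EI[OF i]])
      moreover have "(\<integral>\<omega>. norm (?H i \<omega>) powr p \<partial>M) \<le> 2 * (2 * K) powr p * err i"
        unfolding H_def err_def by (rule regular_coeff_law_lipschitz[OF \<sigma> k XM[OF k] Xi[OF k] XMM[OF i] Xint[OF i] EI[OF i]])
      moreover have "0 \<le> ?a i" using k by simp
      ultimately show ?thesis
        using p m ii HF[OF k] Hi[OF k] measurable_F[OF \<open>0 \<le> ?a i\<close> m(1)] measurable_F[OF \<open>0 \<le> ?a i\<close> m(2)]
          measurable_F[OF \<open>0 \<le> ?a i\<close> HF(1)[OF k]] measurable_F[OF \<open>0 \<le> ?a i\<close> HF(2)[OF k]]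
        by (intro conjI borel_measurable_diff integrable_add_powr(2)) (auto simp: C_def distrib_right)
    qed
    have rec: "err k \<le> 2 powr p * (K1 * \<epsilon>) + \<Lambda> * h * (\<Sum>i<k. err i)" if k: "k \<le> N" for k
    proof -
      have I: "integrable M (\<lambda>\<omega>. norm (ito_sum ?a ?\<beta> ?H k \<omega>) powr p) \<and>
         (\<integral>\<omega>. norm (ito_sum ?a ?\<beta> ?H k \<omega>) powr p \<partial>M)
         \<le> K2 * (\<Sum>i<k. (?a (Suc i) - ?a i) * ((\<integral>\<omega>. norm (?\<beta> i \<omega>) powr p \<partial>M) + (\<integral>\<omega>. norm (?H i \<omega>) powr p \<partial>M)))"
        by (rule K2(2)) (use D kh[OF k] k step(1) in auto)
      have "(\<Sum>i<k. (?a (Suc i) - ?a i) * ((\<integral>\<omega>. norm (?\<beta> i \<omega>) powr p \<partial>M) + (\<integral>\<omega>. norm (?H i \<omega>) powr p \<partial>M)))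
         \<le> (\<Sum>i<k. h * (C * err i))"
        unfolding step(2) using D h0 k by (intro sum_mono mult_left_mono) auto
      also have "\<dots> = h * C * (\<Sum>i<k. err i)" by (simp add: sum_distrib_left mult.assoc)
      finally have "(\<integral>\<omega>. norm (ito_sum ?a ?\<beta> ?H k \<omega>) powr p \<partial>M) \<le> K2 * (h * C * (\<Sum>i<k. err i))"
        using I K2(1) by (meson mult_left_mono order_trans)
      moreover have "err k \<le> 2 powr p * ((\<integral>\<omega>. norm (?R k \<omega>) powr p \<partial>M) + (\<integral>\<omega>. norm (ito_sum ?a ?\<beta> ?H k \<omega>) powr p \<partial>M))"
      proof -
        have "err k \<le> (\<integral>\<omega>. 2 powr p * (norm (?R k \<omega>) powr p + norm (ito_sum ?a ?\<beta> ?H k \<omega>) powr p) \<partial>M)"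
          unfolding err_def
        proof (rule integral_mono[OF EI[OF k]])
          show "norm (X (?a k) \<omega> - ?X k \<omega>) powr p \<le> 2 powr p * (norm (?R k \<omega>) powr p + norm (ito_sum ?a ?\<beta> ?H k \<omega>) powr p)" for \<omega>
            unfolding dec using p by (intro norm_add_powr_le) simp
        qed (use R[OF k] I in simp)
        then show ?thesis using R[OF k] I by simp
      qed
      ultimately have "err k \<le> 2 powr p * (K1 * \<epsilon> + K2 * (h * C * (\<Sum>i<k. err i)))"
        using R[OF k] by (meson add_mono mult_left_mono order_trans powr_ge_zero)
      then show ?thesis by (simp add: \<Lambda>_def algebra_simps)
    qed
    have "err N \<le> 2 powr p * (K1 * \<epsilon>) * (1 + \<Lambda> * h) ^ N"
      by (rule discrete_Gronwall_sum[OF _ _ rec]) (use K1(1) \<epsilon> \<Lambda>0 h0 in auto)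
    also have "\<dots> \<le> 2 powr p * (K1 * \<epsilon>) * exp (\<Lambda> * T)"
    proof (rule mult_left_mono)
      have "(1 + \<Lambda> * h) ^ N \<le> exp (\<Lambda> * h) ^ N"
        using \<Lambda>0 h0 by (intro power_mono exp_ge_add_one_self) auto
      also have "\<dots> = exp (\<Lambda> * t)" using Nh by (simp add: exp_of_nat_mult[symmetric] algebra_simps)
      also have "\<dots> \<le> exp (\<Lambda> * T)" using \<Lambda>0 t0 by (simp add: mult_left_mono)
      finally show "(1 + \<Lambda> * h) ^ N \<le> exp (\<Lambda> * T)" .
    qed (use K1(1) \<epsilon> in simp)
    also have "\<dots> \<le> e" by (rule \<epsilon>e)
    finally have "err N \<le> e" .
    then show "integrable M (\<lambda>\<omega>. norm (X t \<omega> - euler b \<sigma> (t / real N) X0 N \<omega>) powr p) \<and>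
      (\<integral>\<omega>. norm (X t \<omega> - euler b \<sigma> (t / real N) X0 N \<omega>) powr p \<partial>M) \<le> e"
      using EI[of N] by (simp only: err_def Nh order_refl h_def[symmetric])
  qed
qed

section \<open>Propagation of the convex order through one Euler step\<close>

lemma integral_step:
  fixes U :: "'a \<Rightarrow> real^'d" and f :: "real^'d \<Rightarrow> real^'d" and A :: "real^'d \<Rightarrow> real^'q^'d" and \<phi> :: "real^'d \<Rightarrow> real"
  assumes st: "0 \<le> s" "s < t" and U: "U \<in> borel_measurable (F s)"
    and f: "continuous_on UNIV f" and A: "continuous_on UNIV A" and \<phi>: "C-lipschitz_on UNIV \<phi>"
    and int: "integrable M (\<lambda>\<omega>. U \<omega> + ((t - s) *\<^sub>R f (U \<omega>) + A (U \<omega>) *v (B t \<omega> - B s \<omega>)))"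
  defines "\<psi> \<equiv> \<lambda>x. \<integral>z. \<phi> ((x + (t - s) *\<^sub>R f x) + A x *v z) \<partial>gaussian (t - s)"
  shows "integrable (law M U) \<psi>"
    and "(\<integral>\<omega>. \<phi> (U \<omega> + ((t - s) *\<^sub>R f (U \<omega>) + A (U \<omega>) *v (B t \<omega> - B s \<omega>))) \<partial>M) = (\<integral>x. \<psi> x \<partial>law M U)"
proof -
  let ?\<gamma> = "gaussian (t - s) :: (real^'q) measure"
  let ?Z = "\<lambda>\<omega>. B t \<omega> - B s \<omega>"
  let ?g = "\<lambda>w. \<phi> ((fst w + (t - s) *\<^sub>R f (fst w)) + A (fst w) *v snd w)"
  have UM[measurable]: "U \<in> borel_measurable M" using measurable_F[OF st(1) U] .
  have [measurable]: "?Z \<in> borel_measurable M" using increment_measurable[of s t] st by simp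
  have [measurable]: "f \<in> borel_measurable borel" "A \<in> borel_measurable borel" "\<phi> \<in> borel_measurable borel"
    using f A lipschitz_on_continuous_on[OF \<phi>] by (auto intro: borel_measurable_continuous_onI)
  have gm: "?g \<in> borel_measurable (borel \<Otimes>\<^sub>M borel)" by measurable
  interpret U: prob_space "law M U" by (rule prob_space_distr) simp
  interpret G: prob_space ?\<gamma> using st by (intro prob_space_gaussian) simp
  interpret P: pair_sigma_finite "law M U" ?\<gamma> by unfold_locales
  \<comment> \<open>The product form turns the expectation into an iterated integral. Its inner part
    \<open>\<psi>\<close> is the transition operator of the step, applied to
    \<open>\<phi>\<close>.\<close>
  have eq: "distr M (borel \<Otimes>\<^sub>M borel) (\<lambda>\<omega>. (U \<omega>, ?Z \<omega>)) = law M U \<Otimes>\<^sub>M ?\<gamma>" by (rule distr_Pair_increment[OF st U])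
  have "finite_measure M" by unfold_locales
  from integrable_lipschitz_comp[OF this \<phi> int]
  have "integrable M (\<lambda>\<omega>. ?g (U \<omega>, ?Z \<omega>))" by (simp add: add.assoc)
  then have gi: "integrable (law M U \<Otimes>\<^sub>M ?\<gamma>) ?g"
    unfolding eq[symmetric] by (subst integrable_distr_eq) (use gm in auto)
  have "integrable (law M U) (\<lambda>x. \<integral>z. ?g (x, z) \<partial>?\<gamma>)" by (rule P.integrable_fst'[OF gi])
  then show "integrable (law M U) \<psi>" by (simp add: \<psi>_def)
  have "(\<integral>\<omega>. ?g (U \<omega>, ?Z \<omega>) \<partial>M) = (\<integral>w. ?g w \<partial>(law M U \<Otimes>\<^sub>M ?\<gamma>))"
    unfolding eq[symmetric] by (subst integral_distr) (use gm in auto)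
  also have "\<dots> = (\<integral>x. \<integral>z. ?g (x, z) \<partial>?\<gamma> \<partial>law M U)" by (rule P.integral_fst'[OF gi, symmetric])
  finally show "(\<integral>\<omega>. \<phi> (U \<omega> + ((t - s) *\<^sub>R f (U \<omega>) + A (U \<omega>) *v ?Z \<omega>)) \<partial>M) = (\<integral>x. \<psi> x \<partial>law M U)"
    by (simp add: \<psi>_def add.assoc)
qed

text \<open>\<open>\<psi> A\<close> and \<open>\<psi> C\<close> are the transition operators of the
  two schemes applied to \<open>\<phi>\<close>. The order of the present laws is used for the convex
  function \<open>\<psi> A\<close>; the passage from \<open>A\<close> to \<open>C\<close> is then
  pointwise, under the law of \<open>V\<close>. The middle coefficient \<open>E\<close> is compared
  with both neighbours at the level of Gaussian integrals, where transitivity is that of real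
  numbers.\<close>

lemma convex_order_step:
  fixes U V :: "'a \<Rightarrow> real^'d" and f :: "real^'d \<Rightarrow> real^'d" and A C E :: "real^'d \<Rightarrow> real^'q^'d"
  assumes st: "0 \<le> s" "s < t" and U: "U \<in> borel_measurable (F s)" and V: "V \<in> borel_measurable (F s)"
    and UV: "law M U \<preceq>cv law M V"
    and f: "Lf-lipschitz_on UNIV f" "\<And>x y u. f (u *\<^sub>R x + (1 - u) *\<^sub>R y) = u *\<^sub>R f x + (1 - u) *\<^sub>R f y"
    and A: "LA-lipschitz_on UNIV A"
      "\<And>x y u. u \<in> {0..1} \<Longrightarrow> A (u *\<^sub>R x + (1 - u) *\<^sub>R y) \<preceq>m u *\<^sub>R A x + (1 - u) *\<^sub>R A y"
    and AE: "\<And>x. A x \<preceq>m E x" "\<And>x. E x \<preceq>m C x" and C: "continuous_on UNIV C"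
    and \<phi>: "convex_on UNIV \<phi>" "K-lipschitz_on UNIV \<phi>"
    and intU: "integrable M (\<lambda>\<omega>. U \<omega> + ((t - s) *\<^sub>R f (U \<omega>) + A (U \<omega>) *v (B t \<omega> - B s \<omega>)))"
    and intV: "integrable M (\<lambda>\<omega>. V \<omega> + ((t - s) *\<^sub>R f (V \<omega>) + C (V \<omega>) *v (B t \<omega> - B s \<omega>)))"
  shows "(\<integral>\<omega>. \<phi> (U \<omega> + ((t - s) *\<^sub>R f (U \<omega>) + A (U \<omega>) *v (B t \<omega> - B s \<omega>))) \<partial>M)
      \<le> (\<integral>\<omega>. \<phi> (V \<omega> + ((t - s) *\<^sub>R f (V \<omega>) + C (V \<omega>) *v (B t \<omega> - B s \<omega>))) \<partial>M)"
proof -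
  define D where "D = t - s"
  have D: "0 < D" using st by (simp add: D_def)
  let ?\<gamma> = "gaussian D :: (real^'q) measure"
  interpret G: prob_space ?\<gamma> using D by (rule prob_space_gaussian)
  define \<psi> where "\<psi> = (\<lambda>(A :: real^'d \<Rightarrow> real^'q^'d) x. \<integral>z. \<phi> ((x + D *\<^sub>R f x) + A x *v z) \<partial>?\<gamma>)"
  have fc: "continuous_on UNIV f" and Ac: "continuous_on UNIV A"
    using lipschitz_on_continuous_on f(1) A(1) by auto
  note stepU = integral_step[OF st U fc Ac \<phi>(2) intU, folded D_def]
  note stepV = integral_step[OF st V fc C \<phi>(2) intV, folded D_def]
  have int: "integrable ?\<gamma> (\<lambda>z. \<phi> (x + Q *v z))" for x and Q :: "real^'q^'d"
    by (rule integrable_gaussian_lipschitz[OF D \<phi>(2)])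
  have nz: "integrable ?\<gamma> (\<lambda>z. norm z)" using integrable_gaussian[OF D] by (rule integrable_norm)
  have K0: "0 \<le> K" "0 \<le> Lf" "0 \<le> LA" using lipschitz_on_nonneg \<phi>(2) f(1) A(1) by auto
  let ?m = "\<integral>z. norm (z :: real^'q) \<partial>?\<gamma>"
  have m0: "0 \<le> ?m" by (simp add: integral_nonneg_AE)
  \<comment> \<open>The three summands of the constant come from \<open>x\<close> itself, from the
    drift, and from the diffusion weighted with the mean norm of the increment. The bound makes
    \<open>\<psi> A\<close> an admissible Lipschitz test function for the order of \<open>U\<close>
    and \<open>V\<close>.\<close>
  have lip: "(K * (1 + D * Lf + LA * ?m))-lipschitz_on UNIV (\<psi> A)"
  proof (rule lipschitz_onI)
    fix x y
    let ?dx = "x + D *\<^sub>R f x" and ?dy = "y + D *\<^sub>R f y"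
    have pt: "\<bar>\<phi> (?dx + A x *v z) - \<phi> (?dy + A y *v z)\<bar> \<le> K * ((1 + D * Lf) * dist x y + LA * dist x y * norm z)" for z
    proof -
      have "\<bar>\<phi> (?dx + A x *v z) - \<phi> (?dy + A y *v z)\<bar> \<le> K * norm ((?dx + A x *v z) - (?dy + A y *v z))"
        using lipschitz_onD[OF \<phi>(2), of "?dx + A x *v z" "?dy + A y *v z"] by (simp add: dist_norm)
      also have "norm ((?dx + A x *v z) - (?dy + A y *v z)) \<le> (1 + D * Lf) * dist x y + LA * dist x y * norm z"
      proof -
        have "(?dx + A x *v z) - (?dy + A y *v z) = ((x - y) + D *\<^sub>R (f x - f y)) + (A x - A y) *v z"
          by (simp add: matrix_vector_mult_diff_rdistrib scaleR_diff_right)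
        moreover have "norm ((A x - A y) *v z) \<le> LA * dist x y * norm z"
          using norm_matrix_vector_mult_le[of "A x - A y" z] mult_right_mono[OF lipschitz_onD[OF A(1), of x y], of "norm z"]
          by (simp add: dist_norm)
        moreover have "norm (D *\<^sub>R (f x - f y)) \<le> D * (Lf * dist x y)"
          using lipschitz_onD[OF f(1), of x y] D by (simp add: dist_norm)
        ultimately show ?thesis
          using norm_triangle_ineq[of "(x - y) + D *\<^sub>R (f x - f y)" "(A x - A y) *v z"]
            norm_triangle_ineq[of "x - y" "D *\<^sub>R (f x - f y)"] by (simp add: dist_norm algebra_simps)
      qed
      then have "K * norm ((?dx + A x *v z) - (?dy + A y *v z)) \<le> K * ((1 + D * Lf) * dist x y + LA * dist x y * norm z)"
        using K0(1) by (rule mult_left_mono)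
      finally show ?thesis .
    qed
    have "dist (\<psi> A x) (\<psi> A y) = \<bar>\<integral>z. \<phi> (?dx + A x *v z) - \<phi> (?dy + A y *v z) \<partial>?\<gamma>\<bar>"
      by (simp add: \<psi>_def dist_real_def int)
    also have "\<dots> \<le> (\<integral>z. \<bar>\<phi> (?dx + A x *v z) - \<phi> (?dy + A y *v z)\<bar> \<partial>?\<gamma>)" by (rule integral_abs_bound)
    also have "\<dots> \<le> (\<integral>z. K * ((1 + D * Lf) * dist x y + LA * dist x y * norm z) \<partial>?\<gamma>)"
    proof (rule integral_mono)
      show "integrable ?\<gamma> (\<lambda>z. \<bar>\<phi> (?dx + A x *v z) - \<phi> (?dy + A y *v z)\<bar>)"
        by (intro integrable_abs Bochner_Integration.integrable_diff int)
      show "integrable ?\<gamma> (\<lambda>z. K * ((1 + D * Lf) * dist x y + LA * dist x y * norm z))" using nz by simp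
    qed (rule pt)
    also have "\<dots> = K * (1 + D * Lf + LA * ?m) * dist x y"
      using nz G.prob_space by (simp add: algebra_simps)
    finally show "dist (\<psi> A x) (\<psi> A y) \<le> K * (1 + D * Lf + LA * ?m) * dist x y" .
  qed (use K0 m0 D in auto)
  \<comment> \<open>The matrix order replaces \<open>A\<close> at a convex combination by the
    combination of its values, which can only raise the integral. After that the argument of
    \<open>\<phi>\<close> is itself a convex combination, because \<open>f\<close> is
    affine.\<close>
  have conv: "convex_on UNIV (\<psi> A)"
    unfolding convex_on_def
  proof (intro conjI ballI allI impI convex_UNIV)
    fix x y :: "real^'d" and u v :: real assume uv: "0 \<le> u" "0 \<le> v" "u + v = 1"
    then have v: "v = 1 - u" by simp
    let ?w = "u *\<^sub>R x + v *\<^sub>R y" and ?dx = "x + D *\<^sub>R f x" and ?dy = "y + D *\<^sub>R f y"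
    have dw: "?w + D *\<^sub>R f ?w = u *\<^sub>R ?dx + v *\<^sub>R ?dy"
      unfolding v f(2) by (simp add: scaleR_add_right mult.commute)
    have "\<psi> A ?w \<le> (\<integral>z. \<phi> ((?w + D *\<^sub>R f ?w) + (u *\<^sub>R A x + v *\<^sub>R A y) *v z) \<partial>?\<gamma>)"
      unfolding \<psi>_def by (rule gaussian_convex_mono[OF D _ \<phi>]) (use A(2)[of u x y] uv v in auto)
    also have "\<dots> \<le> (\<integral>z. u * \<phi> (?dx + A x *v z) + v * \<phi> (?dy + A y *v z) \<partial>?\<gamma>)"
    proof (intro integral_mono int Bochner_Integration.integrable_add integrable_mult_right)
      fix z :: "real^'q"
      have "(?w + D *\<^sub>R f ?w) + (u *\<^sub>R A x + v *\<^sub>R A y) *v z = u *\<^sub>R (?dx + A x *v z) + v *\<^sub>R (?dy + A y *v z)"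
        unfolding dw by (simp only: matrix_vector_mult_add_rdistrib scaleR_matrix_vector_assoc[symmetric] scaleR_add_right add_ac)
      then show "\<phi> ((?w + D *\<^sub>R f ?w) + (u *\<^sub>R A x + v *\<^sub>R A y) *v z) \<le> u * \<phi> (?dx + A x *v z) + v * \<phi> (?dy + A y *v z)"
        using \<phi>(1) uv by (simp add: convex_on_def)
    qed
    also have "\<dots> = u * \<psi> A x + v * \<psi> A y" by (simp add: \<psi>_def int)
    finally show "\<psi> A ?w \<le> u * \<psi> A x + v * \<psi> A y" .
  qed
  have mono: "\<psi> A x \<le> \<psi> C x" for x
    unfolding \<psi>_def using gaussian_convex_mono[OF D AE(1) \<phi>] gaussian_convex_mono[OF D AE(2) \<phi>] by (rule order_trans)
  have "(\<integral>x. \<psi> A x \<partial>law M U) \<le> (\<integral>x. \<psi> A x \<partial>law M V)" by (rule convex_orderD[OF UV conv lip])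
  also have "\<dots> \<le> (\<integral>x. \<psi> C x \<partial>law M V)"
  proof (rule integral_mono)
    show "integrable (law M V) (\<psi> A)"
      using UV by (intro integrable_prob_dists_lipschitz[OF _ lip]) (simp add: convex_order_def)
    show "integrable (law M V) (\<psi> C)" using stepV(1) by (simp add: \<psi>_def)
  qed (rule mono)
  finally show ?thesis using stepU(2) stepV(2) by (simp add: \<psi>_def D_def)
qed

lemma euler_convex_order:
  assumes h: "0 \<le> h" and b: "regular_coeff T p \<rho> L L' b" and \<sigma>: "regular_coeff T p \<rho> K K' \<sigma>"
    and \<theta>: "regular_coeff T p \<rho> K K' \<theta>"
    and X0: "X0 \<in> borel_measurable (F 0)" "integrable M (\<lambda>\<omega>. norm (X0 \<omega>) powr p)"
    and Y0: "Y0 \<in> borel_measurable (F 0)" "integrable M (\<lambda>\<omega>. norm (Y0 \<omega>) powr p)"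
    and affine: "\<And>t \<mu>. t \<in> {0..T} \<Longrightarrow> \<mu> \<in> prob_dists p \<Longrightarrow> affine_map (\<lambda>x. b t x \<mu>)"
    and b_mono: "\<And>\<mu> \<nu> t x. \<mu> \<in> prob_dists p \<Longrightarrow> \<nu> \<in> prob_dists p \<Longrightarrow> \<mu> \<preceq>cv \<nu> \<Longrightarrow> t \<in> {0..T} \<Longrightarrow> b t x \<mu> = b t x \<nu>"
    and \<sigma>_conv: "\<And>t \<mu> x y u. t \<in> {0..T} \<Longrightarrow> \<mu> \<in> prob_dists p \<Longrightarrow> u \<in> {0..1} \<Longrightarrow>
           \<sigma> t (u *\<^sub>R x + (1 - u) *\<^sub>R y) \<mu> \<preceq>m u *\<^sub>R \<sigma> t x \<mu> + (1 - u) *\<^sub>R \<sigma> t y \<mu>"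
    and \<theta>_mono: "\<And>\<mu> \<nu> t x. \<mu> \<in> prob_dists p \<Longrightarrow> \<nu> \<in> prob_dists p \<Longrightarrow> \<mu> \<preceq>cv \<nu> \<Longrightarrow> t \<in> {0..T} \<Longrightarrow> \<theta> t x \<mu> \<preceq>m \<theta> t x \<nu>"
    and \<sigma>\<theta>: "\<And>t x \<mu>. t \<in> {0..T} \<Longrightarrow> \<mu> \<in> prob_dists p \<Longrightarrow> \<sigma> t x \<mu> \<preceq>m \<theta> t x \<mu>"
    and init: "law M X0 \<preceq>cv law M Y0"
  shows "real k * h \<le> T \<Longrightarrow> law M (euler b \<sigma> h X0 k) \<preceq>cv law M (euler b \<theta> h Y0 k)"
proof (induction k)
  case 0
  then show ?case using init by simp
next
  case (Suc k)
  interpret b: regular_coeff T p \<rho> L L' b by fact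
  interpret \<sigma>: regular_coeff T p \<rho> K K' \<sigma> by fact
  interpret \<theta>: regular_coeff T p \<rho> K K' \<theta> by fact
  let ?X = "euler b \<sigma> h X0" and ?Y = "euler b \<theta> h Y0"
  let ?s = "real k * h" and ?t = "real (Suc k) * h"
  have le: "?s \<le> ?t" using h by (simp add: algebra_simps)
  have s: "?s \<in> {0..T}" and t0: "0 \<le> ?t" using le Suc.prems h by auto
  have IH: "law M (?X k) \<preceq>cv law M (?Y k)" using Suc s by simp
  have X: "?X k \<in> borel_measurable (F ?s)" "integrable M (\<lambda>\<omega>. norm (?X k \<omega>) powr p)"
    and Y: "?Y k \<in> borel_measurable (F ?s)" "integrable M (\<lambda>\<omega>. norm (?Y k \<omega>) powr p)"
    using euler_measurable_integrable[OF b \<sigma> h X0, of k] euler_measurable_integrable[OF b \<theta> h Y0, of k] s by auto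
  have X': "?X (Suc k) \<in> borel_measurable M" "integrable M (\<lambda>\<omega>. norm (?X (Suc k) \<omega>) powr p)"
    and Y': "?Y (Suc k) \<in> borel_measurable M" "integrable M (\<lambda>\<omega>. norm (?Y (Suc k) \<omega>) powr p)"
    using euler_measurable_integrable[OF b \<sigma> h X0 Suc.prems] euler_measurable_integrable[OF b \<theta> h Y0 Suc.prems]
      measurable_F[OF t0] by blast+
  have \<mu>: "law M (?X k) \<in> prob_dists p" and \<nu>: "law M (?Y k) \<in> prob_dists p"
    using law_prob_dists measurable_F[of ?s] X Y s by auto
  show ?case
  \<comment> \<open>Steps of length 0 occur for time 0. They do not change the scheme, and are set
    apart because \<open>gaussian\<close> is a probability law for positive variance.\<close>
  proof (cases "h = 0")
    case True
    have "?X (Suc k) = ?X k" "?Y (Suc k) = ?Y k" by (auto simp: True)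
    then show ?thesis using IH by simp
  next
    case False
    then have lt: "?s < ?t" using h by (simp add: algebra_simps)
    have s0: "0 \<le> ?s" using s by simp
    show ?thesis
    proof (rule convex_orderI)
      show "law M (?X (Suc k)) \<in> prob_dists 1" "law M (?Y (Suc k)) \<in> prob_dists 1"
        by (rule law_prob_dists_1[OF b.p X'], rule law_prob_dists_1[OF b.p Y'])
      fix \<phi> :: "real^'b \<Rightarrow> real" and C assume \<phi>: "convex_on UNIV \<phi>" "C-lipschitz_on UNIV \<phi>"
      have \<phi>m: "\<phi> \<in> borel_measurable borel"
        using lipschitz_on_continuous_on[OF \<phi>(2)] by (rule borel_measurable_continuous_onI)
      \<comment> \<open>The induction hypothesis orders the two laws, so both schemes have the same
        drift function in this step.\<close>
      have beq: "b ?s x (law M (?Y k)) = b ?s x (law M (?X k))" for x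
        by (rule b_mono[OF \<mu> \<nu> IH s, symmetric])
      have lipb: "L-lipschitz_on UNIV (\<lambda>x. b ?s x (law M (?X k)))"
        using b.lipschitz[OF s \<mu> \<mu>] wasserstein_self[OF b.p \<mu>] b.L by (intro lipschitz_onI) (auto simp: dist_norm)
      have lips: "K-lipschitz_on UNIV (\<lambda>x. \<sigma> ?s x (law M (?X k)))"
        using \<sigma>.lipschitz[OF s \<mu> \<mu>] wasserstein_self[OF b.p \<mu>] \<sigma>.L by (intro lipschitz_onI) (auto simp: dist_norm)
      have iX: "integrable M (\<lambda>\<omega>. ?X k \<omega> + ((?t - ?s) *\<^sub>R b ?s (?X k \<omega>) (law M (?X k)) + \<sigma> ?s (?X k \<omega>) (law M (?X k)) *v (B ?t \<omega> - B ?s \<omega>)))"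
        using integrable_powr_imp_integrable[OF b.p X'] unfolding euler.simps .
      have iY: "integrable M (\<lambda>\<omega>. ?Y k \<omega> + ((?t - ?s) *\<^sub>R b ?s (?Y k \<omega>) (law M (?X k)) + \<theta> ?s (?Y k \<omega>) (law M (?Y k)) *v (B ?t \<omega> - B ?s \<omega>)))"
        using integrable_powr_imp_integrable[OF b.p Y'] unfolding euler.simps beq .
      \<comment> \<open>The middle coefficient is \<open>\<theta>\<close> at the law of the first
        scheme: it dominates \<open>\<sigma>\<close> at the same law, and is dominated by
        \<open>\<theta>\<close> at the larger one.\<close>
      have "(\<integral>\<omega>. \<phi> (?X (Suc k) \<omega>) \<partial>M) \<le> (\<integral>\<omega>. \<phi> (?Y (Suc k) \<omega>) \<partial>M)"
        unfolding euler.simps beq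
        by (rule convex_order_step[OF s0 lt X(1) Y(1) IH lipb affine_map_combination[OF affine[OF s \<mu>]] lips
              \<sigma>_conv[OF s \<mu>] \<sigma>\<theta>[OF s \<mu>] \<theta>_mono[OF \<mu> \<nu> IH s] \<theta>.continuous_space[OF s \<nu>] \<phi> iX iY])
      then show "(\<integral>x. \<phi> x \<partial>law M (?X (Suc k))) \<le> (\<integral>x. \<phi> x \<partial>law M (?Y (Suc k)))"
        by (subst (1 2) integral_distr) (use X'(1) Y'(1) \<phi>m in auto)
    qed
  qed
qed

end

section \<open>Passage to the limit from the Euler schemes to the solutions\<close>

theorem proposition4p3:
  fixes M :: "'a measure" and F :: "real \<Rightarrow> 'a measure"
    and B :: "real \<Rightarrow> 'a \<Rightarrow> real^'q"
    and T p \<rho> L L' :: real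
    and b :: "real \<Rightarrow> real^'d \<Rightarrow> (real^'d) measure \<Rightarrow> real^'d"
    and \<sigma> \<theta> :: "real \<Rightarrow> real^'d \<Rightarrow> (real^'d) measure \<Rightarrow> real^'q^'d"
    and X0 Y0 :: "'a \<Rightarrow> real^'d"
    and X Y :: "real \<Rightarrow> 'a \<Rightarrow> real^'d"
  assumes "prob_space M" and "usual_filtration M F" and "brownian_motion M F B"
    and "0 < T" and "2 \<le> p"
    and "X0 \<in> borel_measurable (F 0)" and "integrable M (\<lambda>\<omega>. norm (X0 \<omega>) powr p)"
    and "Y0 \<in> borel_measurable (F 0)" and "integrable M (\<lambda>\<omega>. norm (Y0 \<omega>) powr p)"
    and "0 < \<rho>" and "\<rho> \<le> 1" and "0 < L" and "0 < L'"
    and "coeff_regular norm T p \<rho> L L' b"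
    and "coeff_regular matrix_onorm T p \<rho> L L' \<sigma>"
    and "coeff_regular matrix_onorm T p \<rho> L L' \<theta>"
    and "\<forall>t\<in>{0..T}. \<forall>\<mu>\<in>prob_dists p. affine_map (\<lambda>x. b t x \<mu>)"
    and "\<forall>\<mu>\<in>prob_dists p. \<forall>\<nu>\<in>prob_dists p. \<mu> \<preceq>cv \<nu> \<longrightarrow>
           (\<forall>t\<in>{0..T}. \<forall>x. b t x \<mu> = b t x \<nu>)"
    and "\<forall>t\<in>{0..T}. \<forall>\<mu>\<in>prob_dists p. \<forall>x y. \<forall>u\<in>{0..1}.
           \<sigma> t (u *\<^sub>R x + (1 - u) *\<^sub>R y) \<mu> \<preceq>m u *\<^sub>R \<sigma> t x \<mu> + (1 - u) *\<^sub>R \<sigma> t y \<mu>"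
    and "\<forall>\<mu>\<in>prob_dists p. \<forall>\<nu>\<in>prob_dists p. \<mu> \<preceq>cv \<nu> \<longrightarrow>
           (\<forall>t\<in>{0..T}. \<forall>x. \<theta> t x \<mu> \<preceq>m \<theta> t x \<nu>)"
    and "\<forall>t\<in>{0..T}. \<forall>x. \<forall>\<mu>\<in>prob_dists p. \<sigma> t x \<mu> \<preceq>m \<theta> t x \<mu>"
    and "law M X0 \<preceq>cv law M Y0"
    and "mckean_vlasov_solution M F B T p b \<sigma> X0 X"
    and "mckean_vlasov_solution M F B T p b \<theta> Y0 Y"
  shows "\<forall>t\<in>{0..T}. law M (X t) \<preceq>cv law M (Y t)"
proof
  note hyps = assms
  interpret prob_space M by (rule hyps(1))
  interpret brownian_filtration M F B by unfold_locales (rule hyps(2), rule hyps(3))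
  fix t assume t: "t \<in> {0..T}"
  let ?c = "real (CARD('d) * CARD('q))"
  have p1: "1 \<le> p" using hyps(5) by simp
  have b: "regular_coeff T p \<rho> L L' b"
    by unfold_locales (use hyps(5,10,12,13,14) in auto)
  \<comment> \<open>The factor \<open>?c\<close> is the cost of passing from the operator norm to
    the type class norm.\<close>
  have \<sigma>: "regular_coeff T p \<rho> (?c * L) (?c * L') \<sigma>" and \<theta>: "regular_coeff T p \<rho> (?c * L) (?c * L') \<theta>"
    by unfold_locales (use hyps(5,10,12,13) coeff_regular_onorm[OF hyps(15)] coeff_regular_onorm[OF hyps(16)] in auto)
  have order: "law M (euler b \<sigma> h X0 k) \<preceq>cv law M (euler b \<theta> h Y0 k)" if "0 \<le> h" "real k * h \<le> T" for h k
    by (rule euler_convex_order[OF that(1) b \<sigma> \<theta> hyps(6,7,8,9) _ _ _ _ _ hyps(22) that(2)])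
      (use hyps(17-21) in auto)
  have sol: "X t \<in> borel_measurable M \<and> integrable M (\<lambda>\<omega>. norm (X t \<omega>) powr p)"
    if "mckean_vlasov_solution M F B T p b \<sigma> X0 X" for X X0 :: "_ \<Rightarrow> _" and \<sigma>
  proof -
    have ca: "\<And>s. s \<in> {0..T} \<Longrightarrow> X s \<in> borel_measurable (F s)" "\<And>\<omega>. \<omega> \<in> space M \<Longrightarrow> continuous_on {0..T} (\<lambda>s. X s \<omega>)"
      and fin: "(\<integral>\<^sup>+\<omega>. (SUP t\<in>{0..T}. ennreal (norm (X t \<omega>) powr p)) \<partial>M) < \<infinity>"
      using that by (auto simp: mckean_vlasov_solution_def continuous_adapted_def)
    have XM: "X s \<in> borel_measurable M" if "s \<in> {0..T}" for s using measurable_F[OF _ ca(1)[OF that]] that by simp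
    have "integrable M (\<lambda>\<omega>. norm (X t \<omega>) powr p)"
      by (rule regular_coeff_process(1)[OF b hyps(4) XM ca(2) fin t])
    then show ?thesis using XM[OF t] by blast
  qed
  note X = conjunct1[OF sol[OF hyps(23)]] conjunct2[OF sol[OF hyps(23)]]
  note Y = conjunct1[OF sol[OF hyps(24)]] conjunct2[OF sol[OF hyps(24)]]
  show "law M (X t) \<preceq>cv law M (Y t)"
  proof (rule convex_orderI)
    show "law M (X t) \<in> prob_dists 1" "law M (Y t) \<in> prob_dists 1"
      by (rule law_prob_dists_1[OF p1 X], rule law_prob_dists_1[OF p1 Y])
    fix \<phi> :: "real^'d \<Rightarrow> real" and C assume \<phi>: "convex_on UNIV \<phi>" "C-lipschitz_on UNIV \<phi>"
    have C: "0 \<le> C" using \<phi>(2) by (rule lipschitz_on_nonneg)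
    have \<phi>m: "\<phi> \<in> borel_measurable borel"
      using lipschitz_on_continuous_on[OF \<phi>(2)] by (rule borel_measurable_continuous_onI)
    have "(\<integral>\<omega>. \<phi> (X t \<omega>) \<partial>M) \<le> (\<integral>\<omega>. \<phi> (Y t \<omega>) \<partial>M)"
    proof (rule field_le_epsilon)
      fix e :: real assume e: "0 < e"
      \<comment> \<open>Each scheme contributes an error of at most \<open>C * (2 * \<eta>)\<close>,
        so the two together stay within \<open>e\<close>; \<open>C + 1\<close> covers
        \<open>C = 0\<close>.\<close>
      define \<eta> where "\<eta> = e / 4 / (C + 1)"
      have nz: "C + 1 \<noteq> 0" using C by linarith
      have \<eta>: "0 < \<eta>" "C * (2 * \<eta>) \<le> e / 2"
      proof -
        show pos: "0 < \<eta>" using e C by (simp add: \<eta>_def)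
        have "C * (2 * \<eta>) \<le> 2 * (\<eta> * (C + 1))" using pos by (simp add: algebra_simps)
        also have "\<eta> * (C + 1) = e / 4" by (rule iffD1[OF nonzero_eq_divide_eq[OF nz] \<eta>_def])
        finally show "C * (2 * \<eta>) \<le> e / 2" by simp
      qed
      have \<eta>p: "0 < \<eta> powr p" using \<eta> by simp
      obtain N1 where N1: "\<And>N. N1 \<le> N \<Longrightarrow> 0 < N \<Longrightarrow>
        integrable M (\<lambda>\<omega>. norm (X t \<omega> - euler b \<sigma> (t / real N) X0 N \<omega>) powr p) \<and>
        (\<integral>\<omega>. norm (X t \<omega> - euler b \<sigma> (t / real N) X0 N \<omega>) powr p \<partial>M) \<le> \<eta> powr p"
        by (rule euler_convergence[OF hyps(5,4) b \<sigma> hyps(6,7,23) t \<eta>p]) blast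
      obtain N2 where N2: "\<And>N. N2 \<le> N \<Longrightarrow> 0 < N \<Longrightarrow>
        integrable M (\<lambda>\<omega>. norm (Y t \<omega> - euler b \<theta> (t / real N) Y0 N \<omega>) powr p) \<and>
        (\<integral>\<omega>. norm (Y t \<omega> - euler b \<theta> (t / real N) Y0 N \<omega>) powr p \<partial>M) \<le> \<eta> powr p"
        by (rule euler_convergence[OF hyps(5,4) b \<theta> hyps(8,9,24) t \<eta>p]) blast
      \<comment> \<open>One common number of steps, so that both schemes live on the same grid and
        can be compared; the successor makes it positive.\<close>
      define N where "N = Suc (max N1 N2)"
      have N: "N1 \<le> N" "N2 \<le> N" "0 < N" by (auto simp: N_def)
      define h where "h = t / real N"
      have h: "0 \<le> h" "real N * h = t" "real N * h \<le> T" using t N(3) by (auto simp: h_def)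
      let ?U = "euler b \<sigma> h X0 N" and ?V = "euler b \<theta> h Y0 N"
      have U: "?U \<in> borel_measurable M" "integrable M (\<lambda>\<omega>. norm (?U \<omega>) powr p)"
        and V: "?V \<in> borel_measurable M" "integrable M (\<lambda>\<omega>. norm (?V \<omega>) powr p)"
        using euler_measurable_integrable[OF b \<sigma> h(1) hyps(6,7) h(3)] euler_measurable_integrable[OF b \<theta> h(1) hyps(8,9) h(3)]
          measurable_F[of "real N * h"] h t by auto
      note i = integrable_powr_imp_integrable[OF p1 X] integrable_powr_imp_integrable[OF p1 Y]
        integrable_powr_imp_integrable[OF p1 U] integrable_powr_imp_integrable[OF p1 V]
      have "\<bar>(\<integral>\<omega>. \<phi> (X t \<omega>) \<partial>M) - (\<integral>\<omega>. \<phi> (?U \<omega>) \<partial>M)\<bar> \<le> C * (2 * \<eta>)"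
        using N1[OF N(1,3)] unfolding h_def[symmetric]
        by (intro integral_lipschitz_diff_le[OF p1 i(1,3) \<phi>(2) _ _ \<eta>(1)]) auto
      moreover have "\<bar>(\<integral>\<omega>. \<phi> (Y t \<omega>) \<partial>M) - (\<integral>\<omega>. \<phi> (?V \<omega>) \<partial>M)\<bar> \<le> C * (2 * \<eta>)"
        using N2[OF N(2,3)] unfolding h_def[symmetric]
        by (intro integral_lipschitz_diff_le[OF p1 i(2,4) \<phi>(2) _ _ \<eta>(1)]) auto
      moreover have "(\<integral>\<omega>. \<phi> (?U \<omega>) \<partial>M) \<le> (\<integral>\<omega>. \<phi> (?V \<omega>) \<partial>M)"
        using convex_orderD[OF order[OF h(1,3)] \<phi>] integral_distr[OF U(1) \<phi>m] integral_distr[OF V(1) \<phi>m] by simp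
      ultimately show "(\<integral>\<omega>. \<phi> (X t \<omega>) \<partial>M) \<le> (\<integral>\<omega>. \<phi> (Y t \<omega>) \<partial>M) + e"
        using \<eta>(2) by linarith
    qed
    then show "(\<integral>x. \<phi> x \<partial>law M (X t)) \<le> (\<integral>x. \<phi> x \<partial>law M (Y t))"
      using integral_distr[OF X(1) \<phi>m] integral_distr[OF Y(1) \<phi>m] by simp
  qed
qed

end
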